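(* Let $n\ge 1$ and let $A_1,\dots,A_n$ be (nondeterministic) attributed tree transducers with look-around ($atts^U$), the output alphabet of $A_i$ being the input alphabet of $A_{i+1}$ for $i<n$, such that the composition $\tau_{A_1}\circ\cdots\circ\tau_{A_n}$ is a (partial) function. Then deterministic attributed tree transducers with look-around ($datts^U$) $D_1,\dots,D_n$ can be effectively constructed such that $\tau_{D_1}\circ\cdots\circ\tau_{D_n}=\tau_{A_1}\circ\cdots\circ\tau_{A_n}$.
   Context: Trees. A ranked alphabet $\Sigma$ is a finite set of symbols each with a unique rank $k\ge 0$; $\Sigma_k$ is the set of symbols of rank $k$; $T_\Sigma$ is the set of (finite ordered) trees over $\Sigma$, and $[k]=\{1,\dots,k\}$. Nodes are strings over $\mathbb{N}$: the root is $\epsilon$, the $i$-th child of $v$ is $v.i$; $V(t)$ is the set of nodes of $t$ and $t[v]$ the label of $v$. For a set $\Lambda$ disjoint from $\Sigma$, $T_\Sigma[\Lambda]$ is the set of trees over $\Sigma$ where elements of $\Lambda$ may also occur as leaf labels. Attributed tree transducers. An $att$ is $A=(S,I,\Sigma,\Delta,a_0,R)$ where $S,I$ are disjoint finite sets of synthesized and inherited attributes, $\Sigma,\Delta$ are ranked alphabets (input, output), $a_0\in S$ is the initial attribute, and $R=(R_\sigma\mid\sigma\in\Sigma\cup\{\#\})$ is a collection of finite rule sets, where $\#\notin\Sigma$ is a root marker of rank 1. For $\sigma\in\Sigma_k$, $R_\sigma$ contains arbitrarily many rules $a(\pi)\to\xi$ for each $a\in S$ and arbitrarily many rules $b(\pi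 i)\to\xi$ for each $b\in I$, $i\in[k]$, with $\xi\in T_\Delta[\{a'(\pi i)\mid a'\in S,i\in[k]\}\cup\{b'(\pi)\mid b'\in I\}]$ ($\pi$ is a node variable). $R_\#$ is defined analogously (with $k=1$), but contains no rules with synthesized attributes on the left-hand side and no inherited attributes on right-hand sides. $A$ is deterministic (a $datt$) if each left-hand side has at most one rule in each $R_\sigma$ and in $R_\#$. Semantics. For $s\in T_\Sigma$ let $s^\#=\#(s)$ and $\mathrm{SI}(s^\#)=\{\alpha(v)\mid \alpha\in S\cup I, v\in V(s^\#)\}$. With the conventions $\pi 0=\pi$, $v.0=v$, for $t,t'\in T_\Delta[\mathrm{SI}(s^\#)]$ write $t\Rightarrow_{A,s^\#}t'$ if $t'$ arises from $t$ by replacing one leaf labeled $\gamma(v.i)$ (where $i=0$ if $\gamma\in S$, and $i>0$ if $\gamma\in I$) by $\xi[\pi\leftarrow v]$ for some rule $\gamma(\pi i)\to\xi$ in $R_{s^\#[v]}$, where $[\pi\leftarrow v]$ replaces every occurrence of $\pi$ by $v$. The translation of $A$ is $\tau_A=\{(s,t)\in T_\Sigma\times T_\Delta\mid a_0(1)\Rightarrow^*_{A,s^\#}t\}$. Circular $atts$ (where some $\alpha(v)$ derives in one or more steps a tree containing $\alpha(v)$) are allowed. Look-around. A bottom-up relabeling is $B=(P,\Sigma,\Sigma',F,R)$ with finite state set $P$, ranked alphabets $\Sigma,\Sigma'$, final states $F\subseteq P$, and for every $\sigma\in\Sigma_k$, $p_1,\dots,p_k\in P$ at most one rule $\sigma(p_1(x_1),\dots,p_k(x_k))\to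 p(\sigma'(x_1,\dots,x_k))$ with $p\in P$, $\sigma'\in\Sigma'_k$; it relabels trees bottom-up in the usual way and $\tau_B=\{(s,s')\mid s\Rightarrow_B^* p(s'),\ p\in F\}$. A top-down relabeling is a $datt$ without inherited attributes in which every rule for $\sigma\in\Sigma_k$ has the form $q(\pi)\to\sigma'(q_1(\pi1),\dots,q_k(\pi k))$ with $\sigma'$ of rank $k$. A look-around is a pair $U=(B,T)$ of a bottom-up relabeling $B$ and a top-down relabeling $T$, with $\tau_U=\tau_B\circ\tau_T$ (first $B$, then $T$). An $att$ with look-around ($att^U$) is a pair $(U,A')$ of a look-around $U$ and an $att$ $A'$, realizing $\tau_U\circ\tau_{A'}$ (first $U$, then $A'$); it is a $datt^U$ if $A'$ is a $datt$. Relation composition is $\rho\circ\rho'=\{(x,z)\mid\exists y:(x,y)\in\rho,(y,z)\in\rho'\}$. A relation $\rho$ is a function if $(x,y),(x,y')\in\rho$ implies $y=y'$. *)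

theory Defs
  imports Main "HOL-Library.Nat_Bijection"
begin

section \<open>Ranked alphabets and trees\<close>

text \<open>
  Symbols, attributes and states are natural numbers, so that transducers are finite objects
  which an algorithm can process. A ranked alphabet is a finite set of pairs (symbol, rank).
\<close>

type_synonym ralph = "(nat \<times> nat) set"

definition ranked_alphabet :: "ralph \<Rightarrow> bool" where
  "ranked_alphabet \<Sigma> \<longleftrightarrow> finite \<Sigma> \<and> single_valued \<Sigma>"

datatype 'a tree = Node 'a "'a tree list"

inductive_set trees :: "('a \<times> nat) set \<Rightarrow> 'a tree set" for \<Sigma> where
  "(f, length ts) \<in> \<Sigma> \<Longrightarrow> (\<forall>t \<in> set ts. t \<in> trees \<Sigma>) \<Longrightarrow> Node f ts \<in> trees \<Sigma>"

text \<open>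
  \<open>trees_with \<Delta> \<Lambda>\<close> is $T_\Delta[\Lambda]$. The sum type makes \<open>\<Delta>\<close> and \<open>\<Lambda>\<close> disjoint; the tree
  \<open>t \<in> trees \<Delta>\<close> appears in it as \<open>map_tree Inl t\<close>.
\<close>

definition trees_with :: "ralph \<Rightarrow> 'l set \<Rightarrow> (nat + 'l) tree set" where
  "trees_with \<Delta> \<Lambda> =
     trees ({(Inl \<delta>, k) | \<delta> k. (\<delta>, k) \<in> \<Delta>} \<union> {(Inr l, 0) | l. l \<in> \<Lambda>})"

text \<open>Nodes are strings of positive numbers; the children of a node are numbered from 1.\<close>

type_synonym node = "nat list"

fun label_at :: "'a tree \<Rightarrow> node \<Rightarrow> 'a option" where
  "label_at (Node f ts) [] = Some f"
| "label_at (Node f ts) (i # v) =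
     (if 1 \<le> i \<and> i \<le> length ts then label_at (ts ! (i - 1)) v else None)"

text \<open>\<open>child v i\<close> is $v.i$, with the convention $v.0 = v$.\<close>

definition child :: "node \<Rightarrow> nat \<Rightarrow> node" where
  "child v i = (if i = 0 then v else v @ [i])"


section \<open>Attributed tree transducers\<close>

text \<open>
  In a rule, the pair \<open>(\<gamma>, i)\<close> stands for $\gamma(\pi i)$, where $\pi 0 = \pi$. The tuple
  \<open>(\<sigma>, \<gamma>, i, \<xi>)\<close> is the rule $\gamma(\pi i) \to \xi$ of $R_\sigma$. The root marker is \<open>None\<close> and
  the input symbol \<open>\<sigma>\<close> is \<open>Some \<sigma>\<close>.
\<close>

type_synonym rhs = "(nat + nat \<times> nat) tree"
type_synonym rule = "nat option \<times> nat \<times> nat \<times> rhs"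

record att =
  syn :: "nat set"
  inh :: "nat set"
  inalph :: ralph
  outalph :: ralph
  init :: nat
  rules :: "rule set"

definition att_rule_ok :: "att \<Rightarrow> rule \<Rightarrow> bool" where
  "att_rule_ok A r \<longleftrightarrow> (case r of
     (Some \<sigma>, \<gamma>, i, \<xi>) \<Rightarrow> \<exists>k. (\<sigma>, k) \<in> inalph A
        \<and> (\<gamma> \<in> syn A \<and> i = 0 \<or> \<gamma> \<in> inh A \<and> i \<in> {1..k})
        \<and> \<xi> \<in> trees_with (outalph A) (syn A \<times> {1..k} \<union> inh A \<times> {0})
   | (None, \<gamma>, i, \<xi>) \<Rightarrow> \<gamma> \<in> inh A \<and> i = 1 \<and> \<xi> \<in> trees_with (outalph A) (syn A \<times> {1}))"

definition is_att :: "att \<Rightarrow> bool" where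
  "is_att A \<longleftrightarrow> finite (syn A) \<and> finite (inh A) \<and> syn A \<inter> inh A = {}
     \<and> ranked_alphabet (inalph A) \<and> ranked_alphabet (outalph A)
     \<and> init A \<in> syn A \<and> finite (rules A) \<and> (\<forall>r \<in> rules A. att_rule_ok A r)"

definition deterministic :: "att \<Rightarrow> bool" where
  "deterministic A \<longleftrightarrow>
     (\<forall>\<sigma> \<gamma> i \<xi> \<xi>'. (\<sigma>, \<gamma>, i, \<xi>) \<in> rules A \<and> (\<sigma>, \<gamma>, i, \<xi>') \<in> rules A \<longrightarrow> \<xi> = \<xi>')"

definition is_datt :: "att \<Rightarrow> bool" where
  "is_datt A \<longleftrightarrow> is_att A \<and> deterministic A"

text \<open>The tree $s^\#$, and sentential forms, whose leaves \<open>(\<gamma>, v)\<close> stand for $\gamma(v)$.\<close>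

definition mark :: "nat tree \<Rightarrow> nat option tree" where
  "mark s = Node None [map_tree Some s]"

type_synonym sform = "(nat + nat \<times> node) tree"

definition at_node :: "rhs \<Rightarrow> node \<Rightarrow> sform" where
  "at_node \<xi> v = map_tree (map_sum id (\<lambda>(\<gamma>, i). (\<gamma>, child v i))) \<xi>"

text \<open>
  For an att, \<open>att_rule_ok\<close> guarantees that in the first clause \<open>i = 0\<close> if \<open>\<gamma>\<close> is synthesized and
  \<open>i > 0\<close> if it is inherited. The second clause is closure under contexts, so that one step rewrites
  exactly one leaf.
\<close>

inductive att_step :: "att \<Rightarrow> nat option tree \<Rightarrow> sform \<Rightarrow> sform \<Rightarrow> bool" for A u where
  "label_at u v = Some \<sigma> \<Longrightarrow> (\<sigma>, \<gamma>, i, \<xi>) \<in> rules A \<Longrightarrow>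
     att_step A u (Node (Inr (\<gamma>, child v i)) []) (at_node \<xi> v)"
| "att_step A u t t' \<Longrightarrow> att_step A u (Node f (ts @ t # ts')) (Node f (ts @ t' # ts'))"

definition att_rel :: "att \<Rightarrow> (nat tree \<times> nat tree) set" where
  "att_rel A = {(s, t). s \<in> trees (inalph A) \<and> t \<in> trees (outalph A)
     \<and> (att_step A (mark s))\<^sup>*\<^sup>* (Node (Inr (init A, [1])) []) (map_tree Inl t)}"


section \<open>Look-around\<close>

text \<open>The tuple \<open>(\<sigma>, [p\<^sub>1, \<dots>, p\<^sub>k], p, \<sigma>')\<close> is the rule
  $\sigma(p_1(x_1),\ldots,p_k(x_k)) \to p(\sigma'(x_1,\ldots,x_k))$.\<close>

record burel =
  bu_states :: "nat set"
  bu_in :: ralph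
  bu_out :: ralph
  bu_final :: "nat set"
  bu_rules :: "(nat \<times> nat list \<times> nat \<times> nat) set"

definition is_burel :: "burel \<Rightarrow> bool" where
  "is_burel B \<longleftrightarrow> finite (bu_states B) \<and> ranked_alphabet (bu_in B) \<and> ranked_alphabet (bu_out B)
     \<and> bu_final B \<subseteq> bu_states B \<and> finite (bu_rules B)
     \<and> (\<forall>(\<sigma>, ps, p, \<sigma>') \<in> bu_rules B. (\<sigma>, length ps) \<in> bu_in B \<and> set ps \<subseteq> bu_states B
           \<and> p \<in> bu_states B \<and> (\<sigma>', length ps) \<in> bu_out B)
     \<and> (\<forall>\<sigma> ps p \<sigma>' q \<sigma>''. (\<sigma>, ps, p, \<sigma>') \<in> bu_rules B \<and> (\<sigma>, ps, q, \<sigma>'') \<in> bu_rules B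
           \<longrightarrow> p = q \<and> \<sigma>' = \<sigma>'')"

text \<open>\<open>bu_run B s p s'\<close> means $s \Rightarrow_B^* p(s')$.\<close>

inductive bu_run :: "burel \<Rightarrow> nat tree \<Rightarrow> nat \<Rightarrow> nat tree \<Rightarrow> bool" for B where
  "(\<sigma>, ps, p, \<sigma>') \<in> bu_rules B \<Longrightarrow> length ss = length ps \<Longrightarrow> length ss' = length ps \<Longrightarrow>
     (\<forall>j < length ps. bu_run B (ss ! j) (ps ! j) (ss' ! j)) \<Longrightarrow>
     bu_run B (Node \<sigma> ss) p (Node \<sigma>' ss')"

definition bu_rel :: "burel \<Rightarrow> (nat tree \<times> nat tree) set" where
  "bu_rel B = {(s, s'). s \<in> trees (bu_in B) \<and> (\<exists>p \<in> bu_final B. bu_run B s p s')}"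

definition is_tdrel :: "att \<Rightarrow> bool" where
  "is_tdrel T \<longleftrightarrow> is_datt T \<and> inh T = {}
     \<and> (\<forall>\<sigma> q i \<xi>. (Some \<sigma>, q, i, \<xi>) \<in> rules T \<longrightarrow>
          (\<exists>k \<sigma>' qs. (\<sigma>, k) \<in> inalph T \<and> (\<sigma>', k) \<in> outalph T \<and> length qs = k
             \<and> \<xi> = Node (Inl \<sigma>') (map (\<lambda>j. Node (Inr (qs ! j, Suc j)) []) [0..<k])))"

type_synonym lookaround = "burel \<times> att"

definition is_lookaround :: "lookaround \<Rightarrow> bool" where
  "is_lookaround U \<longleftrightarrow> is_burel (fst U) \<and> is_tdrel (snd U) \<and> bu_out (fst U) = inalph (snd U)"

definition la_rel :: "lookaround \<Rightarrow> (nat tree \<times> nat tree) set" where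
  "la_rel U = bu_rel (fst U) O att_rel (snd U)"

type_synonym attU = "lookaround \<times> att"

definition is_attU :: "attU \<Rightarrow> bool" where
  "is_attU A \<longleftrightarrow> is_lookaround (fst A) \<and> is_att (snd A)
     \<and> outalph (snd (fst A)) = inalph (snd A)"

definition is_dattU :: "attU \<Rightarrow> bool" where
  "is_dattU A \<longleftrightarrow> is_attU A \<and> deterministic (snd A)"

definition attU_rel :: "attU \<Rightarrow> (nat tree \<times> nat tree) set" where
  "attU_rel A = la_rel (fst A) O att_rel (snd A)"

definition inalphU :: "attU \<Rightarrow> ralph" where
  "inalphU A = bu_in (fst (fst A))"

definition outalphU :: "attU \<Rightarrow> ralph" where
  "outalphU A = outalph (snd A)"

definition composable :: "attU list \<Rightarrow> bool" where
  "composable As \<longleftrightarrow> (\<forall>i. Suc i < length As \<longrightarrow> outalphU (As ! i) = inalphU (As ! Suc i))"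

definition composition :: "attU list \<Rightarrow> (nat tree \<times> nat tree) set" where
  "composition As = foldr (\<lambda>A \<rho>. attU_rel A O \<rho>) As Id"


section \<open>Effectiveness\<close>

text \<open>
  The partial recursive functions, presented as unary functions on the natural numbers: tuples are
  coded by the Cantor pairing function, which replaces the projections of arbitrary arity.
\<close>

inductive partial_recursive :: "(nat \<Rightarrow> nat option) \<Rightarrow> bool" where
  zero: "partial_recursive (\<lambda>_. Some 0)"
| succ: "partial_recursive (\<lambda>x. Some (Suc x))"
| left: "partial_recursive (\<lambda>x. Some (fst (prod_decode x)))"
| right: "partial_recursive (\<lambda>x. Some (snd (prod_decode x)))"
| pair: "partial_recursive f \<Longrightarrow> partial_recursive g \<Longrightarrow>
    partial_recursive (\<lambda>x. case (f x, g x) of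
      (Some y, Some z) \<Rightarrow> Some (prod_encode (y, z)) | _ \<Rightarrow> None)"
| comp: "partial_recursive f \<Longrightarrow> partial_recursive g \<Longrightarrow>
    partial_recursive (\<lambda>x. Option.bind (g x) f)"
| prec: "partial_recursive f \<Longrightarrow> partial_recursive g \<Longrightarrow>
    partial_recursive (\<lambda>x. case prod_decode x of (a, m) \<Rightarrow>
      rec_nat (f a) (\<lambda>k r. Option.bind r (\<lambda>y. g (prod_encode (a, prod_encode (k, y))))) m)"
| mu: "partial_recursive f \<Longrightarrow>
    partial_recursive (\<lambda>a.
      if \<exists>m. f (prod_encode (a, m)) = Some 0 \<and> (\<forall>k < m. f (prod_encode (a, k)) \<noteq> None)
      then Some (LEAST m. f (prod_encode (a, m)) = Some 0) else None)"

text \<open>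
  Finite sets are coded by \<open>set_encode\<close> of the set of codes of their elements. Every transducer
  thus has exactly one code, and it can be recovered from its code (\<open>inj_on_code_attUs\<close>).
\<close>

definition code_set :: "('a \<Rightarrow> nat) \<Rightarrow> 'a set \<Rightarrow> nat" where
  "code_set c X = set_encode (c ` X)"

primrec code_tree :: "('a \<Rightarrow> nat) \<Rightarrow> 'a tree \<Rightarrow> nat" where
  "code_tree c (Node f ts) = prod_encode (c f, list_encode (map (code_tree c) ts))"

definition code_rhs :: "rhs \<Rightarrow> nat" where
  "code_rhs = code_tree (\<lambda>l. sum_encode (map_sum id prod_encode l))"

fun code_rule :: "rule \<Rightarrow> nat" where
  "code_rule (\<sigma>, \<gamma>, i, \<xi>) =
     list_encode [case \<sigma> of None \<Rightarrow> 0 | Some x \<Rightarrow> Suc x, \<gamma>, i, code_rhs \<xi>]"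

definition code_att :: "att \<Rightarrow> nat" where
  "code_att A = list_encode
     [set_encode (syn A), set_encode (inh A), code_set prod_encode (inalph A),
      code_set prod_encode (outalph A), init A, code_set code_rule (rules A)]"

fun code_bu_rule :: "nat \<times> nat list \<times> nat \<times> nat \<Rightarrow> nat" where
  "code_bu_rule (\<sigma>, ps, p, \<sigma>') = list_encode [\<sigma>, list_encode ps, p, \<sigma>']"

definition code_burel :: "burel \<Rightarrow> nat" where
  "code_burel B = list_encode
     [set_encode (bu_states B), code_set prod_encode (bu_in B), code_set prod_encode (bu_out B),
      set_encode (bu_final B), code_set code_bu_rule (bu_rules B)]"

fun code_attU :: "attU \<Rightarrow> nat" where
  "code_attU ((B, T), A) = list_encode [code_burel B, code_att T, code_att A]"

definition code_attUs :: "attU list \<Rightarrow> nat" where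
  "code_attUs As = list_encode (map code_attU As)"

lemma code_set_inject:
  assumes "inj c" "finite X" "finite Y" "code_set c X = code_set c Y"
  shows "X = Y"
proof -
  have "c ` X = c ` Y"
    using assms(2-4) inj_on_set_encode unfolding code_set_def
    by (metis finite_imageI set_encode_inverse)
  then show ?thesis using assms(1) by (simp add: inj_image_eq_iff)
qed

lemma set_encode_inject: "finite X \<Longrightarrow> finite Y \<Longrightarrow> set_encode X = set_encode Y \<Longrightarrow> X = Y"
  by (metis set_encode_inverse)

lemma inj_code_tree:
  assumes "inj c"
  shows "inj (code_tree c)"
proof (rule injI)
  fix s t show "code_tree c s = code_tree c t \<Longrightarrow> s = t"
  proof (induction s arbitrary: t)
    case (Node f ts)
    obtain g us where t: "t = Node g us" by (cases t)
    from Node.prems have "c f = c g" and eq: "map (code_tree c) ts = map (code_tree c) us"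
      by (simp_all add: t list_encode_eq)
    moreover have "ts = us"
    proof (rule nth_equalityI)
      show len: "length ts = length us" using eq map_eq_imp_length_eq by blast
      fix i assume i: "i < length ts"
      then have "code_tree c (ts ! i) = code_tree c (us ! i)"
        using eq len by (metis nth_map)
      then show "ts ! i = us ! i" using Node.IH i by (simp add: nth_mem)
    qed
    ultimately show ?case using assms by (simp add: t inj_eq)
  qed
qed

lemma inj_code_rhs: "inj code_rhs"
  unfolding code_rhs_def
proof (rule inj_code_tree, rule injI)
  fix x y :: "nat + nat \<times> nat"
  assume "sum_encode (map_sum id prod_encode x) = sum_encode (map_sum id prod_encode y)"
  then have "map_sum id prod_encode x = map_sum id prod_encode y"
    by (simp add: sum_encode_eq)
  then show "x = y" by (cases x; cases y) simp_all
qed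

lemma inj_code_rule: "inj code_rule"
proof (rule injI)
  fix x y assume "code_rule x = code_rule y"
  then show "x = y"
    by (cases x; cases y) (auto simp: inj_eq[OF inj_code_rhs] split: option.splits)
qed

lemma inj_code_bu_rule: "inj code_bu_rule"
proof (rule injI)
  fix x y assume "code_bu_rule x = code_bu_rule y"
  then show "x = y" by (cases x; cases y) (auto simp: list_encode_eq)
qed

lemma code_att_inject:
  assumes "is_att A" "is_att A'" "code_att A = code_att A'"
  shows "A = A'"
  using assms code_set_inject[OF inj_code_rule, of "rules A" "rules A'"]
    code_set_inject[OF inj_prod_encode, of "inalph A" "inalph A'"]
    code_set_inject[OF inj_prod_encode, of "outalph A" "outalph A'"]
    set_encode_inject[of "syn A" "syn A'"] set_encode_inject[of "inh A" "inh A'"]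
  by (simp add: code_att_def is_att_def ranked_alphabet_def)

lemma code_burel_inject:
  assumes "is_burel B" "is_burel B'" "code_burel B = code_burel B'"
  shows "B = B'"
proof -
  have "finite (bu_final B)" "finite (bu_final B')"
    using assms(1,2) by (auto simp: is_burel_def intro: finite_subset)
  then show ?thesis
    using assms code_set_inject[OF inj_code_bu_rule, of "bu_rules B" "bu_rules B'"]
      code_set_inject[OF inj_prod_encode, of "bu_in B" "bu_in B'"]
      code_set_inject[OF inj_prod_encode, of "bu_out B" "bu_out B'"]
      set_encode_inject[of "bu_states B" "bu_states B'"]
      set_encode_inject[of "bu_final B" "bu_final B'"]
    by (simp add: code_burel_def is_burel_def ranked_alphabet_def)
qed

lemma inj_on_code_attU: "inj_on code_attU {A. is_attU A}"
proof (rule inj_onI)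
  fix X Y assume X: "X \<in> {A. is_attU A}" and Y: "Y \<in> {A. is_attU A}"
    and eq: "code_attU X = code_attU Y"
  obtain B T A where x: "X = ((B, T), A)" by (metis prod.collapse)
  obtain B' T' A' where y: "Y = ((B', T'), A')" by (metis prod.collapse)
  from X Y eq show "X = Y"
    using code_burel_inject[of B B'] code_att_inject[of T T'] code_att_inject[of A A']
    by (simp add: x y is_attU_def is_lookaround_def is_tdrel_def is_datt_def)
qed

lemma inj_on_code_attUs: "inj_on code_attUs {As. \<forall>A \<in> set As. is_attU A}"
proof (rule inj_onI)
  fix As As' assume A: "As \<in> {As. \<forall>A \<in> set As. is_attU A}" "As' \<in> {As. \<forall>A \<in> set As. is_attU A}"
    and eq: "code_attUs As = code_attUs As'"
  have "map code_attU As = map code_attU As'" using eq by (simp add: code_attUs_def list_encode_eq)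
  moreover have "inj_on code_attU (set As \<union> set As')"
    by (rule inj_on_subset[OF inj_on_code_attU]) (use A in auto)
  ultimately show "As = As'" by (simp add: inj_on_map_eq_map)
qed

end

theory Submission
  imports Defs
begin

text \<open>
  Each att is replaced, from last to first, by a deterministic one with look-around whose translation
  is contained in that of the original att, restricted to outputs in the (regular) domain of the
  transducers that follow, and has the same domain as this restriction. Since the composition is a
  function, containment and equality of domains give equality.

  If $a_0(1)$ derives an output tree, then it does so by a derivation that uses one fixed rule for each
  attribute at each node: choose the rule that leads to a derivation of minimal height
  (to control the output, attributes are first paired with states of a tree automaton). A
  nondeterministic finite-state relabeling guesses these rules. It certifies that they are not
  circular by guessing an evaluation order of the attributes of each node, where the orders at a node
  and at its children must be restrictions of one order in which every chosen rule refers only to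
  earlier attributes. The domain of the relabeling is the domain of the att, and a look-around computes
  one of its runs, after which the att is deterministic. Everything is a primitive recursive list
  program in the codes of the transducers.
\<close>

section \<open>Computable functions on coded data\<close>

text \<open>The single transducers need not be functional, and an output of one may lie outside the
  domain of the next. Each step therefore has to choose among outputs while steering into the domain
  of the rest, which is why an automaton is carried along. The relabeling that guesses the rules of
  one transducer is itself the automaton for the outputs of its predecessor. Rules are fixed per
  attribute and automaton state, because one attribute at one node may be called to yield trees of
  several states. Minimal height makes the choices compatible: whatever the context of a call, the
  attributes called by the chosen rule have strictly smaller height. The obstacle is that
  dependencies may run up and down the tree many times, so circularity is invisible at any single
  node. Since a node has finitely many attributes, an order on them is finite information, and
  agreement of neighbours makes local checks sufficient. The root marker cannot be relabeled, so the
  choice of its rules has to be stored in the names of attributes.\<close>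

definition total_rec :: "(nat \<Rightarrow> nat) \<Rightarrow> bool" where
  "total_rec f \<longleftrightarrow> partial_recursive (\<lambda>x. Some (f x))"

lemma total_rec_comp: "total_rec f \<Longrightarrow> total_rec g \<Longrightarrow> total_rec (\<lambda>x. f (g x))"
  unfolding total_rec_def by (drule (1) partial_recursive.comp) simp

lemma total_rec_pair:
  "total_rec f \<Longrightarrow> total_rec g \<Longrightarrow> total_rec (\<lambda>x. prod_encode (f x, g x))"
  unfolding total_rec_def by (drule (1) partial_recursive.pair) simp

lemma total_rec_fst: "total_rec (\<lambda>x. fst (prod_decode x))"
  and total_rec_snd: "total_rec (\<lambda>x. snd (prod_decode x))"
  and total_rec_Suc: "total_rec Suc"
  and total_rec_zero: "total_rec (\<lambda>_. 0)"
  unfolding total_rec_def by (rule partial_recursive.intros)+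

lemma total_rec_const: "total_rec (\<lambda>_. n)"
  by (induction n) (use total_rec_zero total_rec_comp[OF total_rec_Suc] in auto)

lemma total_rec_id: "total_rec (\<lambda>x. x)"
  using total_rec_pair[OF total_rec_fst total_rec_snd] by simp

lemma total_rec_prec:
  assumes "total_rec f" "total_rec g"
  shows "total_rec (\<lambda>x. rec_nat (f (fst (prod_decode x)))
    (\<lambda>k r. g (prod_encode (fst (prod_decode x), prod_encode (k, r)))) (snd (prod_decode x)))"
proof -
  have "rec_nat (Some (f a)) (\<lambda>k r. Option.bind r (\<lambda>y. Some (g (prod_encode (a, prod_encode (k, y)))))) m
      = Some (rec_nat (f a) (\<lambda>k r. g (prod_encode (a, prod_encode (k, r)))) m)" for a m
    by (induction m) auto
  then show ?thesis
    using partial_recursive.prec[OF assms[unfolded total_rec_def]]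
    unfolding total_rec_def by (simp add: case_prod_unfold)
qed

section \<open>Data types with injective numerical codes\<close>

class enc =
  fixes enc :: "'a \<Rightarrow> nat"
  assumes inj_enc: "inj enc"

lemma enc_eq_iff [simp]: "enc x = enc y \<longleftrightarrow> x = y"
  by (rule inj_eq[OF inj_enc])

instantiation nat :: enc begin
definition enc_nat :: "nat \<Rightarrow> nat" where [simp]: "enc_nat n = n"
instance by standard (simp add: inj_on_def)
end

instantiation bool :: enc begin
definition enc_bool :: "bool \<Rightarrow> nat" where "enc_bool b = (if b then 1 else 0)"
instance by standard (simp add: inj_on_def enc_bool_def)
end

instantiation prod :: (enc, enc) enc begin
definition enc_prod :: "'a \<times> 'b \<Rightarrow> nat" where
  "enc_prod p = prod_encode (enc (fst p), enc (snd p))"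
instance by standard (auto simp: inj_on_def enc_prod_def)
end

instantiation sum :: (enc, enc) enc begin
definition enc_sum :: "'a + 'b \<Rightarrow> nat" where
  "enc_sum x = sum_encode (map_sum enc enc x)"
instance
proof
  show "inj (enc :: 'a + 'b \<Rightarrow> nat)"
  proof (rule injI)
    fix x y :: "'a + 'b" assume "enc x = enc y"
    then show "x = y" by (cases x; cases y) (auto simp: enc_sum_def sum_encode_eq)
  qed
qed
end

instantiation list :: (enc) enc begin
definition enc_list :: "'a list \<Rightarrow> nat" where
  "enc_list xs = list_encode (map enc xs)"
instance by standard (simp add: inj_on_def enc_list_def list_encode_eq inj_map_eq_map[OF inj_enc])
end

instantiation option :: (enc) enc begin
definition enc_option :: "'a option \<Rightarrow> nat" where
  "enc_option x = (case x of None \<Rightarrow> 0 | Some y \<Rightarrow> Suc (enc y))"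
instance by standard (auto simp: inj_on_def enc_option_def split: option.splits)
end

instantiation tree :: (enc) enc begin
definition enc_tree :: "'a tree \<Rightarrow> nat" where
  "enc_tree = code_tree enc"
instance by standard (simp add: enc_tree_def inj_code_tree inj_enc)
end

lemma enc_Node: "enc (Node f ts) = prod_encode (enc f, enc ts)"
  by (simp add: enc_tree_def enc_list_def)

lemma code_rhs_eq_enc: "code_rhs = enc"
proof -
  have "(\<lambda>l :: nat + nat \<times> nat. sum_encode (map_sum id prod_encode l)) = enc"
  proof
    fix l :: "nat + nat \<times> nat"
    show "sum_encode (map_sum id prod_encode l) = enc l"
      by (cases l) (auto simp: enc_sum_def enc_prod_def)
  qed
  then show ?thesis by (simp add: code_rhs_def enc_tree_def)
qed

text \<open>The realizer \<open>g\<close> is unconstrained on numbers that are not codes, so the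
  closure rules never have to decide whether a number is a code.\<close>

definition computable :: "('a::enc \<Rightarrow> 'b::enc) \<Rightarrow> bool" where
  "computable f \<longleftrightarrow> (\<exists>g. total_rec g \<and> (\<forall>x. g (enc x) = enc (f x)))"

lemma computableI: "total_rec g \<Longrightarrow> (\<And>x. g (enc x) = enc (f x)) \<Longrightarrow> computable f"
  unfolding computable_def by blast

text \<open>A number is its own code. This leads back from the typed programs to
  \<open>partial_recursive\<close> at the very end.\<close>

lemma computable_nat_iff: "computable (f :: nat \<Rightarrow> nat) \<longleftrightarrow> total_rec f"
proof
  assume "computable f"
  then obtain g where "total_rec g" "\<forall>x. g x = f x" unfolding computable_def by auto
  moreover then have "g = f" by auto
  ultimately show "total_rec f" by simp
qed (auto intro: computableI)

named_theorems comp_intros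

lemma computable_comp:
  assumes "computable f" "computable g" shows "computable (\<lambda>e. f (g e))"
proof -
  obtain f' g' where "total_rec f'" "\<And>x. f' (enc x) = enc (f x)"
    "total_rec g'" "\<And>x. g' (enc x) = enc (g x)"
    using assms unfolding computable_def by blast
  then show ?thesis by (intro computableI[OF total_rec_comp[of f' g']]) auto
qed

lemma computable_id [comp_intros]: "computable (\<lambda>e. e)"
  by (rule computableI[OF total_rec_id]) simp

lemma computable_const [comp_intros]: "computable (\<lambda>e. c)"
  by (rule computableI[OF total_rec_const[of "enc c"]]) simp

lemma computable_Pair [comp_intros]:
  assumes "computable f" "computable g" shows "computable (\<lambda>e. (f e, g e))"
proof -
  obtain f' g' where "total_rec f'" "\<And>x. f' (enc x) = enc (f x)"
    "total_rec g'" "\<And>x. g' (enc x) = enc (g x)"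
    using assms unfolding computable_def by blast
  then show ?thesis by (intro computableI[OF total_rec_pair[of f' g']]) (auto simp: enc_prod_def)
qed

lemma computable_fst [comp_intros]: "computable f \<Longrightarrow> computable (\<lambda>e. fst (f e))"
  by (rule computable_comp[of fst], rule computableI[OF total_rec_fst]) (auto simp: enc_prod_def)

lemma computable_snd [comp_intros]: "computable f \<Longrightarrow> computable (\<lambda>e. snd (f e))"
  by (rule computable_comp[of snd], rule computableI[OF total_rec_snd]) (auto simp: enc_prod_def)

text \<open>Closure rules with bound variables ask for the body as a function of nested pairs: first
  the environment, then the bound variables. This lemma and \<open>computable3\<close> instantiate
  such a body with computed arguments.\<close>

lemma computable2:
  assumes "computable (\<lambda>p. h (fst p) (snd p))" "computable f" "computable g"
  shows "computable (\<lambda>e. h (f e) (g e))"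
  using computable_comp[OF assms(1) computable_Pair[OF assms(2,3)]] by simp

lemma computable_enc [comp_intros]: "computable f \<Longrightarrow> computable (\<lambda>e. enc (f e))"
  by (rule computable_comp[of enc], rule computableI[OF total_rec_id]) auto

lemma computable_Suc [comp_intros]: "computable f \<Longrightarrow> computable (\<lambda>e. Suc (f e))"
  by (rule computable_comp[of Suc], rule computableI[OF total_rec_Suc]) auto

lemma computable_rec_nat [comp_intros]:
  assumes "computable z" "computable (\<lambda>p. s (fst p) (fst (snd p)) (snd (snd p)))" "computable n"
  shows "computable (\<lambda>e. rec_nat (z e) (\<lambda>k r. s e k r) (n e))"
proof -
  obtain z' s' where z: "total_rec z'" "\<And>x. z' (enc x) = enc (z x)"
    and s: "total_rec s'" "\<And>p. s' (enc p) = enc (s (fst p) (fst (snd p)) (snd (snd p)))"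
    using assms unfolding computable_def by metis
  have "s' (prod_encode (enc e, prod_encode (k, enc r))) = enc (s e k r)" for e k r
    using s(2)[of "(e, k, r)"] by (simp add: enc_prod_def)
  then have "rec_nat (enc (z e)) (\<lambda>k r. s' (prod_encode (enc e, prod_encode (k, r)))) m
      = enc (rec_nat (z e) (\<lambda>k r. s e k r) m)" for e m
    by (induction m) auto
  then have "computable (\<lambda>p. rec_nat (z (fst p)) (\<lambda>k r. s (fst p) k r) (snd p))"
    by (intro computableI[OF total_rec_prec[OF z(1) s(1)]]) (auto simp: enc_prod_def z)
  then show ?thesis using computable2[of "\<lambda>e m. rec_nat (z e) (\<lambda>k r. s e k r) m"] assms(3)
      computable_id by blast
qed

lemma computable_case_nat [comp_intros]:
  assumes "computable z" "computable (\<lambda>p. s (fst p) (snd p))" "computable n"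
  shows "computable (\<lambda>e. case_nat (z e) (\<lambda>k. s e k) (n e))"
proof -
  have *: "case_nat (z e) (\<lambda>k. s e k) (n e) = rec_nat (z e) (\<lambda>k r. s e k) (n e)" for e
    by (cases "n e") auto
  show ?thesis unfolding *
    by (rule computable_rec_nat[where s="\<lambda>e k r. s e k"],
        rule assms, rule computable2[OF assms(2)], (rule comp_intros assms)+)
qed

lemma computable_as_nat:
  assumes "computable (\<lambda>e. enc (f e))" shows "computable f"
  using assms unfolding computable_def by (simp)

lemma computable_if [comp_intros]:
  assumes "computable b" "computable f" "computable g"
  shows "computable (\<lambda>e. if b e then f e else g e)"
proof -
  have *: "(if b e then f e else g e) = case_nat (g e) (\<lambda>k. f e) (enc (b e))" for e
    by (simp add: enc_bool_def)
  show ?thesis unfolding *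
    by (intro computable_case_nat computable_enc assms computable_comp[OF assms(2)] comp_intros)
qed

lemma computable_not [comp_intros]:
  assumes "computable b" shows "computable (\<lambda>e. \<not> b e)"
proof -
  have *: "(\<not> x) = (if x then False else True)" for x by simp
  show ?thesis unfolding * by (intro computable_if computable_const assms)
qed

lemma computable_conj [comp_intros]:
  assumes "computable b" "computable c" shows "computable (\<lambda>e. b e \<and> c e)"
proof -
  have *: "(x \<and> y) = (if x then y else False)" for x y by simp
  show ?thesis unfolding * by (intro computable_if computable_const assms)
qed

lemma computable_disj [comp_intros]:
  assumes "computable b" "computable c" shows "computable (\<lambda>e. b e \<or> c e)"
proof -
  have *: "(x \<or> y) = (if x then True else y)" for x y by simp
  show ?thesis unfolding * by (intro computable_if computable_const assms)
qed

lemma computable_imp [comp_intros]: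
  assumes "computable b" "computable c" shows "computable (\<lambda>e. b e \<longrightarrow> c e)"
proof -
  have *: "(x \<longrightarrow> y) = (if x then y else True)" for x y by simp
  show ?thesis unfolding * by (intro computable_if computable_const assms)
qed

lemma computable_pred: "computable f \<Longrightarrow> computable (\<lambda>e. f e - Suc 0)"
proof -
  assume "computable f"
  have *: "f e - Suc 0 = case_nat 0 (\<lambda>k. k) (f e)" for e by (cases "f e") auto
  show ?thesis unfolding *
    by (intro comp_intros \<open>computable f\<close>)
qed

lemma computable_diff [comp_intros]:
  fixes f g :: "_ \<Rightarrow> nat"
  assumes "computable f" "computable g" shows "computable (\<lambda>e. f e - g e)"
proof -
  have **: "rec_nat m (\<lambda>k r. r - Suc 0) n = m - n" for m n by (induction n) auto
  have *: "f e - g e = rec_nat (f e) (\<lambda>k r. r - Suc 0) (g e)" for e by (rule **[symmetric])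
  show ?thesis unfolding *
    by (intro computable_rec_nat computable_pred comp_intros assms)
qed

lemma computable_add [comp_intros]:
  fixes f g :: "_ \<Rightarrow> nat"
  assumes "computable f" "computable g" shows "computable (\<lambda>e. f e + g e)"
proof -
  have **: "rec_nat m (\<lambda>k r. Suc r) n = m + n" for m n by (induction n) auto
  show ?thesis unfolding **[symmetric]
    by (intro computable_rec_nat comp_intros assms)
qed

lemma computable_eq [comp_intros]:
  assumes "computable f" "computable g" shows "computable (\<lambda>e. f e = g e)"
proof -
  have *: "f e = g e \<longleftrightarrow> \<not> (case_nat False (\<lambda>_. True) ((enc (f e) - enc (g e)) + (enc (g e) - enc (f e))))" for e
  proof -
    have "f e = g e \<longleftrightarrow> (enc (f e) - enc (g e)) + (enc (g e) - enc (f e)) = 0" using enc_eq_iff[of "f e" "g e"] by linarith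
    then show ?thesis by (auto split: nat.split simp del: add_is_0 diff_is_0_eq)
  qed
  show ?thesis unfolding *
    by (intro comp_intros assms)
qed

section \<open>Lists and course-of-values recursion\<close>

definition list_tl :: "nat \<Rightarrow> nat" where
  "list_tl n = (case n of 0 \<Rightarrow> 0 | Suc m \<Rightarrow> snd (prod_decode m))"

definition list_hd :: "nat \<Rightarrow> nat" where
  "list_hd n = (case n of 0 \<Rightarrow> 0 | Suc m \<Rightarrow> fst (prod_decode m))"

definition list_nth :: "nat \<Rightarrow> nat \<Rightarrow> nat" where
  "list_nth n k = list_hd (rec_nat n (\<lambda>_ r. list_tl r) k)"

text \<open>The code of the empty list is 0. With 0 as its tail, iterating \<open>list_tl\<close>
  agrees with \<open>drop\<close> even beyond the end of the list.\<close>

lemma list_nth_encode: "k < length xs \<Longrightarrow> list_nth (list_encode xs) k = xs ! k"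
proof -
  have "rec_nat (list_encode xs) (\<lambda>_ r. list_tl r) k = list_encode (drop k xs)" for k
    by (induction k)
      (auto simp: list_tl_def drop_Suc tl_drop[symmetric] split: nat.split,
        (metis list.sel(2) list_encode.elims nat.distinct(1)),
        metis drop_Suc list.sel(3) list_encode.elims nat.distinct(1) nat.inject prod_encode_inverse snd_conv tl_drop)
  then show "k < length xs \<Longrightarrow> ?thesis"
    by (simp add: list_nth_def list_hd_def flip: Cons_nth_drop_Suc)
qed

lemma computable_prod_decode [comp_intros]:
  "computable f \<Longrightarrow> computable (\<lambda>e. prod_decode (f e))"
  by (rule computable_comp[of prod_decode], rule computableI[OF total_rec_id]) (auto simp: enc_prod_def)

lemma computable_list_nth [comp_intros]:
  assumes "computable f" "computable g"
  shows "computable (\<lambda>e. list_nth (f e) (g e))"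
  unfolding list_nth_def list_hd_def list_tl_def
  by (intro comp_intros assms)

lemma computable_prod_encode [comp_intros]:
  "computable f \<Longrightarrow> computable g \<Longrightarrow> computable (\<lambda>e. prod_encode (f e, g e))"
  using computable_enc[OF computable_Pair, of f g] by (simp add: enc_prod_def)

text \<open>The third argument of \<open>h\<close> codes the values of the function on all smaller arguments, latest
  first.\<close>

lemma course_of_values:
  fixes h :: "'a::enc \<Rightarrow> nat \<Rightarrow> nat \<Rightarrow> nat" and G :: "'a \<Rightarrow> nat \<Rightarrow> nat"
  assumes h: "computable (\<lambda>p. h (fst p) (fst (snd p)) (snd (snd p)))"
    and G: "\<And>e n. G e n = h e n (list_encode (map (G e) (rev [0..<n])))"
  shows "computable (\<lambda>p. G (fst p) (snd p))"
proof -
  \<comment> \<open>\<open>Suc (prod_encode (x, r))\<close> is the code of the list with head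
    \<open>x\<close> whose tail has code \<open>r\<close>, so each round puts one value in front of
    the table.\<close>
  let ?T = "\<lambda>e. rec_nat 0 (\<lambda>k r. Suc (prod_encode (h e k r, r)))"
  have T: "?T e n = list_encode (map (G e) (rev [0..<n]))" for e n
    by (induction n) (auto simp: G[symmetric])
  have "computable (\<lambda>p. h (fst p) (snd p) (?T (fst p) (snd p)))"
    by (rule computable_comp[OF h, of "\<lambda>p. (fst p, snd p, ?T (fst p) (snd p))", simplified])
      (intro comp_intros computable_rec_nat computable_const computable_prod_encode
        computable_comp[OF h, of "\<lambda>p. (fst (fst p), snd p)", simplified])
  then show ?thesis by (simp add: T G[symmetric])
qed

text \<open>The table for \<open>n\<close> begins with the value at \<open>n - 1\<close>, which puts
  the value at \<open>c\<close> at position \<open>n - Suc c\<close>.\<close>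

lemma table_lookup:
  "c < n \<Longrightarrow> list_nth (list_encode (map G (rev [0..<n]))) (n - Suc c) = G c"
  by (subst list_nth_encode) (auto simp: rev_nth)

lemma snd_prod_decode_le: "snd (prod_decode m) \<le> m"
  by (metis le_prod_encode_2 prod.collapse prod_decode_inverse)

text \<open>Together with \<open>snd_prod_decode_le\<close> this makes the code itself a termination
  measure for recursion through the children of a coded tree.\<close>

lemma list_decode_less: "x \<in> set (list_decode m) \<Longrightarrow> x < m"
proof (induction m arbitrary: x rule: less_induct)
  case (less m)
  show ?case
  proof (cases m)
    case (Suc n)
    obtain a b where ab: "prod_decode n = (a, b)" by (cases "prod_decode n")
    then have "a \<le> n" "b \<le> n"
      by (metis le_prod_encode_1 le_prod_encode_2 prod_decode_inverse)+
    then have "b < m" "a < m" using Suc by auto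
    have "x = a \<or> x \<in> set (list_decode b)" using less.prems Suc ab by auto
    then show ?thesis using less.IH[OF \<open>b < m\<close>] \<open>b < m\<close> \<open>a < m\<close> by force
  qed (use less in auto)
qed

lemma enc_nat_list: "enc (xs :: nat list) = list_encode xs"
  by (simp add: enc_list_def map_idI)

lemma computable_list_encode [comp_intros]:
  "computable f \<Longrightarrow> computable (\<lambda>e. list_encode (f e))"
  by (rule computable_comp[of list_encode], rule computableI[OF total_rec_id]) (auto simp: enc_nat_list)

lemma computable_list_decode [comp_intros]:
  "computable f \<Longrightarrow> computable (\<lambda>e. list_decode (f e))"
  by (rule computable_comp[of list_decode], rule computableI[OF total_rec_id]) (auto simp: enc_nat_list)

lemma computable_Nil [comp_intros]: "computable (\<lambda>e. [])"
  by (rule computable_const)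

lemma computable_Cons [comp_intros]:
  assumes "computable f" "computable g" shows "computable (\<lambda>e. f e # g e)"
  by (rule computable_as_nat) (simp add: enc_list_def, intro comp_intros
    computable_enc[OF assms(2), unfolded enc_list_def] assms)

text \<open>The code of the tail is smaller than that of the list, so recursion on lists is
  course-of-values recursion on codes. \<open>G\<close> reads every number as a list of numbers,
  because not every number is the code of a list over the element type.\<close>

lemma computable_rec_list [comp_intros]:
  assumes "computable z" "computable (\<lambda>p. s (fst p) (fst (snd p)) (fst (snd (snd p))) (snd (snd (snd p))))"
    "computable l"
  shows "computable (\<lambda>e. rec_list (z e) (\<lambda>x xs r. s e x xs r) (l e))"
proof -
  obtain s' where s': "total_rec s'"
    and *: "\<And>p. s' (enc p) = enc (s (fst p) (fst (snd p)) (fst (snd (snd p))) (snd (snd (snd p))))"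
    using assms(2) unfolding computable_def by blast
  have s: "s' (prod_encode (enc e, prod_encode (enc x, prod_encode (enc xs, enc r)))) = enc (s e x xs r)" for e x xs r
    using *[of "(e, x, xs, r)"] by (simp add: enc_prod_def)
  define G where "G e n = rec_list (enc (z e))
    (\<lambda>x xs r. s' (prod_encode (enc e, prod_encode (x, prod_encode (list_encode xs, r))))) (list_decode n)" for e n
  define h where "h e n T = (case n of 0 \<Rightarrow> enc (z e) | Suc m \<Rightarrow> s' (prod_encode (enc e,
    prod_encode (fst (prod_decode m), prod_encode (snd (prod_decode m),
      list_nth T (n - Suc (snd (prod_decode m))))))))" for e n T
  have comp_s': "computable s'" using s' by (simp add: computable_nat_iff)
  have "computable (\<lambda>p. h (fst p) (fst (snd p)) (snd (snd p)))"
    unfolding h_def by (intro comp_intros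
      computable_comp[OF comp_s'] computable_comp[OF assms(1)])
  moreover have "G e n = h e n (list_encode (map (G e) (rev [0..<n])))" for e n
  proof (cases n)
    case (Suc m)
    have "snd (prod_decode m) < n" using snd_prod_decode_le[of m] Suc by simp
    then show ?thesis unfolding h_def Suc
      by (simp only: nat.case table_lookup) (simp add: G_def split: prod.split)
  qed (simp add: G_def h_def)
  ultimately have "computable (\<lambda>p. G (fst p) (snd p))" by (rule course_of_values)
  moreover have "G e (enc xs) = enc (rec_list (z e) (s e) xs)" for e xs
  proof (induction xs)
    case (Cons x xs)
    then show ?case using s by (simp add: G_def enc_list_def)
  qed (simp add: G_def enc_list_def)
  ultimately have "computable (\<lambda>e. enc (rec_list (z e) (s e) (l e)))"
    using computable2[of G, OF _ computable_id computable_enc[OF assms(3)]] by simp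
  then show ?thesis by (rule computable_as_nat)
qed

lemma computable_foldr [comp_intros]:
  assumes "computable (\<lambda>p. s (fst p) (fst (snd p)) (snd (snd p)))" "computable l" "computable z"
  shows "computable (\<lambda>e. foldr (\<lambda>x r. s e x r) (l e) (z e))"
proof -
  have *: "foldr (\<lambda>x r. s e x r) (l e) (z e) = rec_list (z e) (\<lambda>x xs r. s e x r) (l e)" for e
  proof -
    have "foldr (\<lambda>x r. s e x r) xs (z e) = rec_list (z e) (\<lambda>x xs r. s e x r) xs" for xs
      by (induction xs) auto
    then show ?thesis .
  qed
  show ?thesis unfolding *
    by (rule computable_rec_list[where s="\<lambda>e x xs r. s e x r"], rule assms,
      rule computable_comp[OF assms(1), of "\<lambda>p. (fst p, fst (snd p), snd (snd (snd p)))", simplified])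
     (intro comp_intros assms)+
qed

lemma computable3:
  assumes "computable (\<lambda>p. h (fst p) (fst (snd p)) (snd (snd p)))" "computable f" "computable g" "computable k"
  shows "computable (\<lambda>e. h (f e) (g e) (k e))"
  using computable_comp[OF assms(1) computable_Pair[OF assms(2) computable_Pair[OF assms(3,4)]]] by simp

lemma computable_map [comp_intros]:
  assumes "computable (\<lambda>p. f (fst p) (snd p))" "computable l"
  shows "computable (\<lambda>e. map (\<lambda>x. f e x) (l e))"
proof -
  have *: "map f xs = foldr (\<lambda>x r. f x # r) xs []" for f :: "'b \<Rightarrow> 'c" and xs
    by (induction xs) auto
  show ?thesis unfolding *
    by (intro comp_intros assms computable2[OF assms(1)])
qed


lemma computable_append [comp_intros]:
  assumes "computable f" "computable g" shows "computable (\<lambda>e. f e @ g e)"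
proof -
  have *: "xs @ ys = foldr (\<lambda>x r. x # r) xs ys" for xs ys :: "'b list" by (induction xs) auto
  show ?thesis unfolding * by (intro comp_intros assms)
qed

lemma computable_concat [comp_intros]:
  assumes "computable f" shows "computable (\<lambda>e. concat (f e))"
proof -
  have *: "concat xs = foldr (\<lambda>x r. x @ r) xs []" for xs :: "'b list list" by (induction xs) auto
  show ?thesis unfolding * by (intro comp_intros assms)
qed

lemma computable_filter [comp_intros]:
  assumes "computable (\<lambda>p. P (fst p) (snd p))" "computable l"
  shows "computable (\<lambda>e. filter (\<lambda>x. P e x) (l e))"
proof -
  have *: "filter P xs = foldr (\<lambda>x r. if P x then x # r else r) xs []" for P :: "'b \<Rightarrow> bool" and xs
    by (induction xs) auto
  show ?thesis unfolding * by (intro comp_intros assms computable2[OF assms(1)])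
qed

lemma computable_Ball [comp_intros]:
  assumes "computable (\<lambda>p. P (fst p) (snd p))" "computable l"
  shows "computable (\<lambda>e. \<forall>x \<in> set (l e). P e x)"
proof -
  have *: "(\<forall>x \<in> set xs. P x) \<longleftrightarrow> foldr (\<lambda>x r. P x \<and> r) xs True" for P :: "'b \<Rightarrow> bool" and xs
    by (induction xs) auto
  show ?thesis unfolding *
    by (intro comp_intros assms computable2[OF assms(1)])
qed

lemma computable_Bex [comp_intros]:
  assumes "computable (\<lambda>p. P (fst p) (snd p))" "computable l"
  shows "computable (\<lambda>e. \<exists>x \<in> set (l e). P e x)"
proof -
  have *: "(\<exists>x \<in> set xs. P x) \<longleftrightarrow> foldr (\<lambda>x r. P x \<or> r) xs False" for P :: "'b \<Rightarrow> bool" and xs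
    by (induction xs) auto
  show ?thesis unfolding *
    by (intro comp_intros assms computable2[OF assms(1)])
qed

lemma computable_member [comp_intros]:
  assumes "computable f" "computable l"
  shows "computable (\<lambda>e. f e \<in> set (l e))"
proof -
  have *: "y \<in> set xs \<longleftrightarrow> (\<exists>x \<in> set xs. x = y)" for y :: 'b and xs by auto
  show ?thesis by (subst *) (intro comp_intros assms computable_comp[OF assms(1)])
qed

lemma computable_length [comp_intros]:
  assumes "computable f" shows "computable (\<lambda>e. length (f e))"
proof -
  have *: "length xs = foldr (\<lambda>x r. Suc r) xs 0" for xs :: "'b list" by (induction xs) auto
  show ?thesis unfolding * by (intro comp_intros assms)
qed

lemma computable_upt [comp_intros]:
  assumes "computable n" shows "computable (\<lambda>e. [0..<n e])"
proof -
  have *: "[0..<m] = rec_nat [] (\<lambda>k r. r @ [k]) m" for m by (induction m) auto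
  show ?thesis unfolding * by (intro comp_intros assms)
qed

lemma computable_case_list [comp_intros]:
  assumes "computable z" "computable (\<lambda>p. s (fst p) (fst (snd p)) (snd (snd p)))" "computable l"
  shows "computable (\<lambda>e. case_list (z e) (\<lambda>x xs. s e x xs) (l e))"
proof -
  have *: "case_list (z e) (\<lambda>x xs. s e x xs) (l e) = rec_list (z e) (\<lambda>x xs r. s e x xs) (l e)" for e
    by (cases "l e") auto
  show ?thesis unfolding * by (intro computable_rec_list computable3[OF assms(2)] comp_intros assms)
qed

lemma computable_case_prod [comp_intros]:
  assumes "computable (\<lambda>p. s (fst p) (fst (snd p)) (snd (snd p)))" "computable f"
  shows "computable (\<lambda>e. case_prod (\<lambda>x y. s e x y) (f e))"
  unfolding case_prod_unfold by (intro computable3[OF assms(1)] comp_intros assms)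

lemma computable_Some [comp_intros]:
  assumes "computable f" shows "computable (\<lambda>e. Some (f e))"
  by (rule computable_as_nat) (simp add: enc_option_def, intro comp_intros assms)

definition opt_of :: "nat \<Rightarrow> nat option" where
  "opt_of n = (case n of 0 \<Rightarrow> None | Suc m \<Rightarrow> Some m)"

lemma computable_opt_of [comp_intros]:
  "computable f \<Longrightarrow> computable (\<lambda>e. opt_of (f e))"
  by (rule computable_comp[of opt_of], rule computableI[OF total_rec_id])
    (auto simp: enc_option_def opt_of_def split: nat.split)

text \<open>For \<open>nat option\<close> the predecessor of the code of \<open>Some y\<close> is
  \<open>y\<close> itself, which lets the case distinction on numbers do the work.\<close>

lemma computable_case_option [comp_intros]:
  assumes "computable z" "computable (\<lambda>p. s (fst p) (snd p))" "computable f"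
  shows "computable (\<lambda>e. case_option (z e) (\<lambda>x. s e x) (f e :: nat option))"
proof -
  have *: "case_option z s x = case_nat z s (enc x)" for z :: 'c and s and x :: "nat option"
    by (cases x) (auto simp: enc_option_def)
  show ?thesis unfolding * by (intro comp_intros assms)
qed

section \<open>Finite sets as bit patterns\<close>

lemma computable_half:
  fixes f :: "_ \<Rightarrow> nat"
  assumes "computable f" shows "computable (\<lambda>e. f e div 2)"
proof -
  \<comment> \<open>The recursion is \<open>Suc k div 2 = k - k div 2\<close>.\<close>
  have *: "m div 2 = rec_nat 0 (\<lambda>k r. k - r) m" for m :: nat by (induction m) auto
  show ?thesis unfolding * by (intro comp_intros assms)
qed

lemma computable_odd:
  fixes f :: "_ \<Rightarrow> nat"
  assumes "computable f" shows "computable (\<lambda>e. odd (f e))"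
proof -
  have *: "odd m \<longleftrightarrow> m - (m div 2 + m div 2) = 1" for m :: nat by presburger
  show ?thesis unfolding * by (intro comp_intros computable_half assms)
qed

lemma computable_set_decode [comp_intros]:
  assumes "computable f" "computable g" shows "computable (\<lambda>e. f e \<in> set_decode (g e))"
proof -
  have *: "x \<in> set_decode n \<longleftrightarrow> odd (rec_nat n (\<lambda>_ r. r div 2) x)" for x n
  proof -
    have "rec_nat n (\<lambda>_ r. r div 2) x = n div 2 ^ x"
      by (induction x) (auto simp: div_mult2_eq[symmetric] mult.commute)
    then show ?thesis by (simp add: set_decode_def)
  qed
  show ?thesis unfolding *
    by (intro computable_odd computable_rec_nat computable_half comp_intros assms)
qed

text \<open>Membership of \<open>x\<close> is bit \<open>x\<close> of the code; the recursion
  computes \<open>2 ^ x\<close> by repeated doubling.\<close>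

definition set_insert :: "nat \<Rightarrow> nat \<Rightarrow> nat" where
  "set_insert x n = (if x \<in> set_decode n then n else n + rec_nat 1 (\<lambda>_ r. r + r) x)"

lemma set_insert: "finite X \<Longrightarrow> set_insert x (set_encode X) = set_encode (insert x X)"
proof -
  have "rec_nat 1 (\<lambda>_ r. r + r) x = (2::nat) ^ x" by (induction x) auto
  then show "finite X \<Longrightarrow> ?thesis" by (simp add: set_insert_def insert_absorb)
qed

lemma computable_set_encode [comp_intros]:
  assumes "computable l" shows "computable (\<lambda>e. set_encode (set (l e)))"
proof -
  have *: "set_encode (set xs) = foldr (\<lambda>x r. set_insert x r) xs 0" for xs
    by (induction xs) (auto simp: set_insert[symmetric])
  show ?thesis unfolding * set_insert_def
    by (intro comp_intros assms)
qed

text \<open>A member \<open>x\<close> contributes \<open>2 ^ x > x\<close> to the code, so the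
  search can stop below \<open>n\<close>.\<close>

definition set_list :: "nat \<Rightarrow> nat list" where
  "set_list n = filter (\<lambda>x. x \<in> set_decode n) [0..<n]"

lemma set_set_list [simp]: "set (set_list n) = set_decode n"
proof -
  have "x < n" if "x \<in> set_decode n" for x
  proof -
    have "n div 2 ^ x \<noteq> 0" using that by (intro notI) (simp add: set_decode_def)
    then have "2 ^ x \<le> n" by (simp add: div_eq_0_iff)
    then show ?thesis using less_exp[of x] by linarith
  qed
  then show ?thesis by (auto simp: set_list_def)
qed

lemma computable_set_list [comp_intros]:
  assumes "computable f" shows "computable (\<lambda>e. set_list (f e))"
  unfolding set_list_def by (intro comp_intros assms computable_comp[OF assms])

section \<open>Disjoint sums and trees\<close>

lemma computable_Inl [comp_intros]:
  assumes "computable f" shows "computable (\<lambda>e. Inl (f e))"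
proof -
  have "enc (Inl x :: 'b + 'c) = enc x + enc x" for x :: 'b
    by (simp add: enc_sum_def sum_encode_def)
  then show ?thesis
    by (intro computable_as_nat[where f="\<lambda>e. Inl (f e)"]) (auto intro!: comp_intros assms)
qed

lemma computable_Inr [comp_intros]:
  assumes "computable f" shows "computable (\<lambda>e. Inr (f e))"
proof -
  have "enc (Inr x :: 'c + 'b) = Suc (enc x + enc x)" for x :: 'b
    by (simp add: enc_sum_def sum_encode_def)
  then show ?thesis
    by (intro computable_as_nat[where f="\<lambda>e. Inr (f e)"]) (auto intro!: comp_intros assms)
qed

lemma computable_case_sum [comp_intros]:
  assumes l: "computable (\<lambda>p. l (fst p) (snd p))" and r: "computable (\<lambda>p. r (fst p) (snd p))"
    and f: "computable f"
  shows "computable (\<lambda>e. case_sum (\<lambda>x. l e x) (\<lambda>x. r e x) (f e))"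
proof -
  obtain l' where l': "total_rec l'" "\<And>p. l' (enc p) = enc (l (fst p) (snd p))"
    using l unfolding computable_def by blast
  obtain r' where r': "total_rec r'" "\<And>p. r' (enc p) = enc (r (fst p) (snd p))"
    using r unfolding computable_def by blast
  \<comment> \<open>Left injections have even codes and right injections odd ones; half of the code,
    rounded down, is the code of the injected element.\<close>
  have "enc (case_sum (l e) (r e) x) =
    (if odd (enc x) then r' (prod_encode (enc e, enc x div 2)) else l' (prod_encode (enc e, enc x div 2)))" for e x
    using l'(2)[of "(e, projl x)"] r'(2)[of "(e, projr x)"]
    by (cases x) (auto simp: enc_prod_def enc_sum_def sum_encode_def)
  then show ?thesis
    by (intro computable_as_nat[where f="\<lambda>e. case_sum (l e) (r e) (f e)"])
      (auto intro!: comp_intros computable_comp[OF l'(1)[folded computable_nat_iff]] computable_comp[OF r'(1)[folded computable_nat_iff]] computable_odd computable_half f)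
qed

fun label :: "'a tree \<Rightarrow> 'a" where "label (Node f ts) = f"
fun subtrees :: "'a tree \<Rightarrow> 'a tree list" where "subtrees (Node f ts) = ts"

lemma computable_Node [comp_intros]:
  assumes "computable f" "computable g" shows "computable (\<lambda>e. Node (f e) (g e))"
  by (rule computable_as_nat) (simp add: enc_Node, intro comp_intros assms)

lemma computable_label [comp_intros]: "computable f \<Longrightarrow> computable (\<lambda>e. label (f e))"
proof (rule computable_comp[of label], rule computableI[OF total_rec_fst])
  fix t :: "'b tree" show "fst (prod_decode (enc t)) = enc (label t)"
    by (cases t) (simp add: enc_Node)
qed

lemma computable_subtrees [comp_intros]: "computable f \<Longrightarrow> computable (\<lambda>e. subtrees (f e))"
proof (rule computable_comp[of subtrees], rule computableI[OF total_rec_snd])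
  fix t :: "'b tree" show "snd (prod_decode (enc t)) = enc (subtrees t)"
    by (cases t) (simp add: enc_Node)
qed

primrec fold_tree :: "('a \<Rightarrow> 'b list \<Rightarrow> 'b) \<Rightarrow> 'a tree \<Rightarrow> 'b" where
  "fold_tree h (Node f ts) = h f (map (fold_tree h) ts)"

text \<open>This is \<open>fold_tree\<close> transported to codes. It has to be defined on every
  number, since the table of course-of-values recursion also contains the values at numbers that
  code no tree.\<close>

function fold_code :: "(nat \<Rightarrow> nat) \<Rightarrow> nat \<Rightarrow> nat" where
  "fold_code h n = h (prod_encode (fst (prod_decode n), list_encode (map (fold_code h) (list_decode (snd (prod_decode n))))))"
  by auto
termination
proof (relation "measure snd")
  fix h :: "nat \<Rightarrow> nat" and n z assume "z \<in> set (list_decode (snd (prod_decode n)))"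
  then show "((h, z), (h, n)) \<in> measure snd"
    using list_decode_less[of z] snd_prod_decode_le[of n] by fastforce
qed simp
declare fold_code.simps [simp del]

lemma computable_fold_tree [comp_intros]:
  assumes "computable (\<lambda>p. h (fst p) (fst (snd p)) (snd (snd p)))" "computable t"
  shows "computable (\<lambda>e. fold_tree (\<lambda>f bs. h e f bs) (t e))"
proof -
  obtain h' where h': "total_rec h'"
    and *: "\<And>p. h' (enc p) = enc (h (fst p) (fst (snd p)) (snd (snd p)))"
    using assms(1) unfolding computable_def by blast
  have h: "h' (prod_encode (enc e, prod_encode (enc f, list_encode (map enc bs)))) = enc (h e f bs)" for e f bs
    using *[of "(e, f, bs)"] by (simp add: enc_prod_def enc_list_def)
  define G where "G e = fold_code (\<lambda>x. h' (prod_encode (enc e, x)))" for e :: 'a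
  have "G e n = h' (prod_encode (enc e, prod_encode (fst (prod_decode n),
      list_encode (map (\<lambda>c. list_nth (list_encode (map (G e) (rev [0..<n]))) (n - Suc c))
        (list_decode (snd (prod_decode n)))))))" for e n
  proof -
    have "c < n" if "c \<in> set (list_decode (snd (prod_decode n)))" for c
      using list_decode_less[OF that] snd_prod_decode_le[of n] by simp
    then have "map (\<lambda>c. list_nth (list_encode (map (G e) (rev [0..<n]))) (n - Suc c))
        (list_decode (snd (prod_decode n))) = map (G e) (list_decode (snd (prod_decode n)))"
      by (auto intro!: table_lookup)
    moreover have "G e n = h' (prod_encode (enc e, prod_encode (fst (prod_decode n),
        list_encode (map (G e) (list_decode (snd (prod_decode n)))))))"
      unfolding G_def by (subst fold_code.simps) (rule refl)
    ultimately show ?thesis by (simp only:)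
  qed
  then have "computable (\<lambda>p. G (fst p) (snd p))"
    by (rule course_of_values[rotated])
      (intro comp_intros computable_comp[OF h'[folded computable_nat_iff]])
  moreover have "G e (enc t) = enc (fold_tree (h e) t)" for e t
  proof (induction t)
    case (Node f ts)
    then have "map (G e) (map enc ts) = map enc (map (fold_tree (h e)) ts)" by simp
    moreover have "G e (enc (Node f ts)) =
        h' (prod_encode (enc e, prod_encode (enc f, list_encode (map (G e) (map enc ts)))))"
      unfolding G_def by (subst fold_code.simps) (simp add: enc_Node enc_list_def)
    ultimately show ?case by (simp only: h fold_tree.simps)
  qed
  ultimately have "computable (\<lambda>e. enc (fold_tree (h e) (t e)))"
    using computable2[of G, OF _ computable_id computable_enc[OF assms(2)]] by simp
  then show ?thesis by (rule computable_as_nat)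
qed

text \<open>The codes of the labels are onto, and children have smaller codes than their tree. Hence
  \<open>rhs_of\<close> is the identity on codes and thereby computable, although it is defined by
  choice.\<close>

lemma surj_enc_rhs: "\<exists>t :: rhs. enc t = n"
proof (induction n rule: less_induct)
  case (less n)
  let ?cs = "list_decode (snd (prod_decode n))"
  have "\<forall>c \<in> set ?cs. \<exists>t :: rhs. enc t = c"
    using less list_decode_less snd_prod_decode_le by (meson order_less_le_trans)
  then obtain d where "\<forall>c \<in> set ?cs. enc (d c :: rhs) = c" by metis
  then have "map enc (map d ?cs) = ?cs" by (simp add: map_idI)
  moreover have "\<exists>l :: nat + nat \<times> nat. enc l = k" for k
  proof (cases "sum_decode k")
    case (Inl a)
    then have "enc (Inl a :: nat + nat \<times> nat) = k"
      by (simp add: enc_sum_def) (metis sum_decode_inverse)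
    then show ?thesis by blast
  next
    case (Inr b)
    then have "enc (Inr (prod_decode b) :: nat + nat \<times> nat) = k"
      by (simp add: enc_sum_def enc_prod_def) (metis sum_decode_inverse)
    then show ?thesis by blast
  qed
  then obtain l :: "nat + nat \<times> nat" where "enc l = fst (prod_decode n)" by blast
  ultimately have "enc (Node l (map d ?cs)) = n" by (simp add: enc_Node enc_list_def)
  then show ?case by blast
qed

definition rhs_of :: "nat \<Rightarrow> rhs" where "rhs_of n = (SOME t. enc t = n)"

lemma enc_rhs_of: "enc (rhs_of n) = n"
  unfolding rhs_of_def using surj_enc_rhs by (rule someI_ex)

lemma rhs_of_enc [simp]: "rhs_of (enc t) = t"
  using enc_rhs_of[of "enc t"] by simp

lemma computable_rhs_of [comp_intros]: "computable f \<Longrightarrow> computable (\<lambda>e. rhs_of (f e))"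
  by (rule computable_comp[of rhs_of], rule computableI[OF total_rec_id]) (auto simp: enc_rhs_of)

section \<open>Big-step semantics\<close>

fun subtree_at :: "'a tree \<Rightarrow> node \<Rightarrow> 'a tree option" where
  "subtree_at t [] = Some t"
| "subtree_at (Node f ts) (i # v) =
     (if 1 \<le> i \<and> i \<le> length ts then subtree_at (ts ! (i - 1)) v else None)"

lemma label_at_eq: "label_at t v = map_option label (subtree_at t v)"
  by (induction t v rule: label_at.induct) auto

lemma subtree_at_append:
  "subtree_at t (v @ w) = Option.bind (subtree_at t v) (\<lambda>t. subtree_at t w)"
  by (induction t v rule: subtree_at.induct) auto

lemma subtree_at_child:
  "subtree_at t v = Some (Node f ts) \<Longrightarrow> j < length ts \<Longrightarrow> subtree_at t (v @ [Suc j]) = Some (ts ! j)"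
  by (simp add: subtree_at_append)

lemma label_at_map: "label_at (map_tree f t) v = map_option f (label_at t v)"
  by (induction t v rule: label_at.induct) auto

lemma trees_Node: "Node f ts \<in> trees \<Sigma> \<longleftrightarrow> (f, length ts) \<in> \<Sigma> \<and> (\<forall>t \<in> set ts. t \<in> trees \<Sigma>)"
  by (auto intro: trees.intros elim: trees.cases)

lemma trees_map:
  assumes "t \<in> trees \<Sigma>" "\<And>f k. (f, k) \<in> \<Sigma> \<Longrightarrow> (h f, k) \<in> \<Sigma>'"
  shows "map_tree h t \<in> trees \<Sigma>'"
  using assms(1) by induction (auto simp: trees_Node assms(2))

text \<open>The bound \<open>n\<close> counts nested attribute calls only, and output symbols cost
  nothing. Its least value is the height that the choice of rules minimizes.\<close>

inductive eval :: "att \<Rightarrow> nat option tree \<Rightarrow> nat \<Rightarrow> sform \<Rightarrow> nat tree \<Rightarrow> bool" for A u where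
  eval_attr: "label_at u v = Some \<sigma> \<Longrightarrow> (\<sigma>, \<gamma>, i, \<xi>) \<in> rules A \<Longrightarrow> eval A u n (at_node \<xi> v) t \<Longrightarrow>
     eval A u (Suc n) (Node (Inr (\<gamma>, child v i)) []) t"
| eval_out: "length ts' = length ts \<Longrightarrow> \<forall>j < length ts. eval A u n (ts ! j) (ts' ! j) \<Longrightarrow>
     eval A u n (Node (Inl \<delta>) ts) (Node \<delta> ts')"

lemma eval_mono: "eval A u n sf t \<Longrightarrow> n \<le> m \<Longrightarrow> eval A u m sf t"
proof (induction arbitrary: m rule: eval.induct)
  case (eval_attr v \<sigma> \<gamma> i \<xi> n t)
  then obtain m' where "m = Suc m'" "n \<le> m'" by (cases m) auto
  then show ?case using eval_attr by (auto intro: eval.eval_attr)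
qed (auto intro: eval.eval_out)

lemma eval_outI:
  assumes "length ts' = length ts" "\<And>j. j < length ts \<Longrightarrow> \<exists>n. eval A u n (ts ! j) (ts' ! j)"
  shows "\<exists>n. eval A u n (Node (Inl \<delta>) ts) (Node \<delta> ts')"
proof -
  obtain n where n: "\<And>j. j < length ts \<Longrightarrow> eval A u (n j) (ts ! j) (ts' ! j)" using assms(2) by metis
  have "eval A u (Max (n ` {..<length ts})) (ts ! j) (ts' ! j)" if "j < length ts" for j
    using n[OF that] by (rule eval_mono) (use that in auto)
  then show ?thesis using assms(1) by (blast intro: eval.eval_out)
qed

lemma eval_final: "\<exists>n. eval A u n (map_tree Inl t) t"
proof (induction t)
  case (Node f ts)
  then show ?case by (auto intro!: eval_outI)
qed

lemma eval_OutE: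
  assumes "eval A u n (Node (Inl \<delta>) ts) t"
  obtains ts' where "t = Node \<delta> ts'" "length ts' = length ts" "\<And>j. j < length ts \<Longrightarrow> eval A u n (ts ! j) (ts' ! j)"
  using assms by (cases rule: eval.cases) auto

lemma eval_AttrE:
  assumes "eval A u n (Node (Inr (\<gamma>, w)) ts) t"
  obtains v \<sigma> i \<xi> m where "ts = []" "n = Suc m" "w = child v i" "label_at u v = Some \<sigma>"
    "(\<sigma>, \<gamma>, i, \<xi>) \<in> rules A" "eval A u m (at_node \<xi> v) t"
  using assms by (cases rule: eval.cases) auto

text \<open>A step rewrites one leaf, so the children are completed one after the other from left to
  right; \<open>pre\<close> holds those already completed.\<close>

lemma att_steps_children:
  assumes "length us = length ts" "\<And>j. j < length ts \<Longrightarrow> (att_step A u)\<^sup>*\<^sup>* (ts ! j) (us ! j)"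
  shows "(att_step A u)\<^sup>*\<^sup>* (Node f (pre @ ts)) (Node f (pre @ us))"
  using assms
proof (induction us ts arbitrary: pre rule: list_induct2)
  case (Cons t' us t ts)
  have "(att_step A u)\<^sup>*\<^sup>* t t'" using Cons.prems[of 0] by simp
  then have "(att_step A u)\<^sup>*\<^sup>* (Node f (pre @ t # ts)) (Node f (pre @ t' # ts))"
    by induction (auto intro: rtranclp.rtrancl_into_rtrancl att_step.intros(2))
  moreover have "(att_step A u)\<^sup>*\<^sup>* (Node f ((pre @ [t']) @ ts)) (Node f ((pre @ [t']) @ us))"
    using Cons.IH[of "pre @ [t']"] Cons.prems[of "Suc _"] by fastforce
  ultimately show ?case by simp
qed simp

lemma eval_imp_steps: "eval A u n sf t \<Longrightarrow> (att_step A u)\<^sup>*\<^sup>* sf (map_tree Inl t)"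
proof (induction rule: eval.induct)
  case (eval_attr v \<sigma> \<gamma> i \<xi> n t)
  then show ?case by (meson att_step.intros(1) converse_rtranclp_into_rtranclp)
next
  case (eval_out ts' ts n \<delta>)
  then show ?case using att_steps_children[of "map (map_tree Inl) ts'" ts A u "Inl \<delta>" "[]"] by simp
qed

text \<open>Different leaves are rewritten independently, so an evaluation of the result of a step
  extends backwards over that step. Backward induction along a derivation then yields a big-step
  evaluation.\<close>

lemma step_eval:
  assumes "att_step A u sf sf'" "eval A u n sf' t" shows "\<exists>n. eval A u n sf t"
  using assms
proof (induction arbitrary: t n rule: att_step.induct)
  case (1 v \<sigma> \<gamma> i \<xi>)
  then show ?case by (blast intro: eval.eval_attr)
next
  case (2 x y f ts ts')
  show ?case
  proof (cases f)
    case (Inl \<delta>)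
    with 2(3) obtain us where us: "t = Node \<delta> us" "length us = length (ts @ y # ts')"
      "\<And>j. j < length (ts @ y # ts') \<Longrightarrow> eval A u n ((ts @ y # ts') ! j) (us ! j)"
      by (auto elim: eval_OutE)
    have "\<exists>m. eval A u m ((ts @ x # ts') ! j) (us ! j)" if "j < length (ts @ x # ts')" for j
    proof (cases "j = length ts")
      case True
      then show ?thesis using us(3)[of j] 2(2) that by simp
    next
      case False
      then have "(ts @ x # ts') ! j = (ts @ y # ts') ! j" by (simp add: nth_append nth_Cons')
      then show ?thesis using us(3)[of j] that by auto
    qed
    then show ?thesis using us(1,2) Inl by (auto intro!: eval_outI)
  next
    case (Inr x)
    \<comment> \<open>An evaluable node labeled by an attribute has no children, so it cannot be the
      top of a proper context.\<close>
    then show ?thesis using 2(3) by (cases x) (auto elim: eval_AttrE)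
  qed
qed

lemma steps_iff_eval: "(att_step A u)\<^sup>*\<^sup>* sf (map_tree Inl t) \<longleftrightarrow> (\<exists>n. eval A u n sf t)"
proof
  assume "(att_step A u)\<^sup>*\<^sup>* sf (map_tree Inl t)"
  then show "\<exists>n. eval A u n sf t"
    by (induction rule: converse_rtranclp_induct) (auto intro: eval_final step_eval)
qed (auto intro: eval_imp_steps)

lemma trees_with_mono: "t \<in> trees_with \<Delta> \<Lambda> \<Longrightarrow> \<Lambda> \<subseteq> \<Lambda>' \<Longrightarrow> t \<in> trees_with \<Delta> \<Lambda>'"
  unfolding trees_with_def by (drule trees_map[where h="\<lambda>x. x"]) (auto simp: tree.map_ident)

lemma trees_with_at_node: "\<xi> \<in> trees_with \<Delta> \<Lambda> \<Longrightarrow> at_node \<xi> v \<in> trees_with \<Delta> UNIV"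
  unfolding at_node_def trees_with_def by (erule trees_map) auto

lemma trees_with_Inl: "Node (Inl \<delta>) ts \<in> trees_with \<Delta> \<Lambda> \<longleftrightarrow>
    (\<delta>, length ts) \<in> \<Delta> \<and> (\<forall>t \<in> set ts. t \<in> trees_with \<Delta> \<Lambda>)"
  by (auto simp: trees_with_def trees_Node)

lemma trees_with_Inr: "Node (Inr l) ts \<in> trees_with \<Delta> \<Lambda> \<longleftrightarrow> ts = [] \<and> l \<in> \<Lambda>"
  by (auto simp: trees_with_def trees_Node)

lemma rule_rhs_trees:
  assumes "is_att A" "(\<sigma>, \<gamma>, i, \<xi>) \<in> rules A" shows "\<xi> \<in> trees_with (outalph A) UNIV"
proof -
  have "att_rule_ok A (\<sigma>, \<gamma>, i, \<xi>)" using assms unfolding is_att_def by blast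
  then show ?thesis by (cases \<sigma>) (auto simp: att_rule_ok_def intro: trees_with_mono)
qed

lemma eval_trees:
  assumes "is_att A" "eval A u n sf t" "sf \<in> trees_with (outalph A) UNIV"
  shows "t \<in> trees (outalph A)"
  using assms(2,3)
proof (induction rule: eval.induct)
  case (eval_attr v \<sigma> \<gamma> i \<xi> n t)
  then show ?case using rule_rhs_trees[OF assms(1)] trees_with_at_node by blast
next
  case (eval_out ts' ts n \<delta>)
  have "ts' ! j \<in> trees (outalph A)" if "j < length ts" for j
    using eval_out that by (auto simp: trees_with_Inl)
  then show ?case using eval_out by (auto simp: trees_with_Inl trees_Node in_set_conv_nth)
qed

lemma att_rel_eval:
  assumes "is_att A"
  shows "(s, t) \<in> att_rel A \<longleftrightarrow>
    s \<in> trees (inalph A) \<and> (\<exists>n. eval A (mark s) n (Node (Inr (init A, [1])) []) t)"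
  using eval_trees[OF assms] by (auto simp: att_rel_def steps_iff_eval trees_with_Inr)

section \<open>Relabelings as sets of transitions\<close>

type_synonym transition = "nat \<times> nat list \<times> nat \<times> nat"

text \<open>Runs depend on the rules alone, and the other components are filled with dummies. One
  notion thus serves bottom-up relabelings, top-down relabelings and automata.\<close>

definition run :: "transition set \<Rightarrow> nat tree \<Rightarrow> nat \<Rightarrow> nat tree \<Rightarrow> bool" where
  "run R = bu_run \<lparr>bu_states = {}, bu_in = {}, bu_out = {}, bu_final = {}, bu_rules = R\<rparr>"

lemma run_Node:
  "run R (Node \<sigma> ss) p s' \<longleftrightarrow> (\<exists>ps \<sigma>' ss'. s' = Node \<sigma>' ss' \<and> (\<sigma>, ps, p, \<sigma>') \<in> R \<and>
     length ss = length ps \<and> length ss' = length ps \<and>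
     (\<forall>j < length ps. run R (ss ! j) (ps ! j) (ss' ! j)))"
  unfolding run_def by (subst bu_run.simps) auto

lemma bu_run_eq: "bu_run B s p s' \<longleftrightarrow> run (bu_rules B) s p s'"
proof (induction s arbitrary: p s')
  case (Node \<sigma> ss)
  then have "bu_run B (ss ! j) q t \<longleftrightarrow> run (bu_rules B) (ss ! j) q t" if "j < length ss" for j q t
    using that by simp
  then show ?case by (subst bu_run.simps) (auto simp: run_Node, (metis+))
qed

lemma run_trees_in:
  "run R s p s' \<Longrightarrow> (\<And>\<sigma> ps p \<sigma>'. (\<sigma>, ps, p, \<sigma>') \<in> R \<Longrightarrow> (\<sigma>, length ps) \<in> \<Sigma>) \<Longrightarrow> s \<in> trees \<Sigma>"
proof (induction s arbitrary: p s')
  case (Node \<sigma> ss)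
  then show ?case by (auto simp: run_Node trees_Node in_set_conv_nth) metis+
qed

lemma run_trees_out:
  "run R s p s' \<Longrightarrow> (\<And>\<sigma> ps p \<sigma>'. (\<sigma>, ps, p, \<sigma>') \<in> R \<Longrightarrow> (\<sigma>', length ps) \<in> \<Sigma>) \<Longrightarrow> s' \<in> trees \<Sigma>"
proof (induction s arbitrary: p s')
  case (Node \<sigma> ss)
  then show ?case by (auto simp: run_Node trees_Node in_set_conv_nth) metis+
qed

definition td_rhs :: "nat \<Rightarrow> nat list \<Rightarrow> rhs" where
  "td_rhs \<sigma> qs = Node (Inl \<sigma>) (map (\<lambda>j. Node (Inr (qs ! j, Suc j)) []) [0..<length qs])"

text \<open>A nondeterministic run has no direction: a top-down rule is the same tuple as a
  bottom-up transition, and only determinism distinguishes the two.\<close>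

definition td_transitions :: "att \<Rightarrow> transition set" where
  "td_transitions T = {(\<sigma>, qs, q, \<sigma>'). (Some \<sigma>, q, 0, td_rhs \<sigma>' qs) \<in> rules T}"

lemma td_rule:
  assumes "is_tdrel T" "(\<sigma>, q, i, \<xi>) \<in> rules T"
  obtains \<sigma>0 \<sigma>' qs where "\<sigma> = Some \<sigma>0" "i = 0" "\<xi> = td_rhs \<sigma>' qs" "(\<sigma>0, length qs) \<in> inalph T"
    "(\<sigma>', length qs) \<in> outalph T"
proof -
  have "att_rule_ok T (\<sigma>, q, i, \<xi>)" and "inh T = {}"
    using assms by (auto simp: is_tdrel_def is_datt_def is_att_def)
  then obtain \<sigma>0 where "\<sigma> = Some \<sigma>0" "i = 0" by (cases \<sigma>) (auto simp: att_rule_ok_def)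
  moreover obtain k \<sigma>' qs where "(\<sigma>0, k) \<in> inalph T" "(\<sigma>', k) \<in> outalph T" "length qs = k"
     "\<xi> = Node (Inl \<sigma>') (map (\<lambda>j. Node (Inr (qs ! j, Suc j)) []) [0..<k])"
    using assms calculation by (simp add: is_tdrel_def) blast
  ultimately show ?thesis by (intro that[of \<sigma>0 \<sigma>' qs]) (auto simp: td_rhs_def)
qed

lemma at_node_Inl: "at_node (Node (Inl \<delta>) ts) v = Node (Inl \<delta>) (map (\<lambda>t. at_node t v) ts)"
  by (simp add: at_node_def)

lemma at_node_Inr: "at_node (Node (Inr (\<gamma>, i)) ts) v = Node (Inr (\<gamma>, child v i)) (map (\<lambda>t. at_node t v) ts)"
  by (simp add: at_node_def)

lemma at_node_td_rhs: "at_node (td_rhs \<sigma> qs) v =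
    Node (Inl \<sigma>) (map (\<lambda>j. Node (Inr (qs ! j, v @ [Suc j])) []) [0..<length qs])"
  by (simp add: td_rhs_def at_node_Inl at_node_Inr child_def)

lemma eval_td:
  assumes T: "is_tdrel T" and "s \<in> trees (inalph T)" "subtree_at u v = Some (map_tree Some s)"
  shows "(\<exists>n. eval T u n (Node (Inr (q, v)) []) t) \<longleftrightarrow> run (td_transitions T) s q t"
  using assms(2,3)
proof (induction s arbitrary: q v t rule: tree.induct)
  case (Node \<sigma> ss)
  have lab: "label_at u v = Some (Some \<sigma>)" using Node.prems(2) by (simp add: label_at_eq)
  have sv: "single_valued (inalph T)"
    using T by (auto simp: is_tdrel_def is_datt_def is_att_def ranked_alphabet_def)
  have IH: "(\<exists>n. eval T u n (Node (Inr (q, v @ [Suc j])) []) t) \<longleftrightarrow> run (td_transitions T) (ss ! j) q t"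
    if "j < length ss" for j q t
  proof (rule Node.IH)
    show "ss ! j \<in> set ss" "ss ! j \<in> trees (inalph T)"
      using that Node.prems(1) by (auto simp: trees_Node)
    show "subtree_at u (v @ [Suc j]) = Some (map_tree Some (ss ! j))"
      using subtree_at_child[OF Node.prems(2)[simplified], of j] that by simp
  qed
  show ?case
  proof
    assume "\<exists>n. eval T u n (Node (Inr (q, v)) []) t"
    then obtain m v' \<sigma>1 i \<xi> where 1: "v = child v' i" "label_at u v' = Some \<sigma>1"
      "(\<sigma>1, q, i, \<xi>) \<in> rules T" "eval T u m (at_node \<xi> v') t" by (auto elim: eval_AttrE)
    from td_rule[OF T 1(3)] obtain \<sigma>0 \<sigma>' qs where 2: "\<sigma>1 = Some \<sigma>0" "i = 0" "\<xi> = td_rhs \<sigma>' qs"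
      "(\<sigma>0, length qs) \<in> inalph T" by metis
    have v: "v' = v" "\<sigma>0 = \<sigma>" using 1 2 lab by (auto simp: child_def)
    \<comment> \<open>The rank used by the rule and the number of children of the node agree,
      because the input alphabet gives each symbol only one rank.\<close>
    have len: "length ss = length qs"
      using 2(4) Node.prems(1) sv v by (auto simp: trees_Node dest: single_valuedD)
    from 1(4)[unfolded 2 v at_node_td_rhs] obtain ts' where ts': "t = Node \<sigma>' ts'"
      "length ts' = length qs" "\<And>j. j < length qs \<Longrightarrow> eval T u m (Node (Inr (qs ! j, v @ [Suc j])) []) (ts' ! j)"
      by (auto elim!: eval_OutE)
    then have "\<forall>j < length qs. run (td_transitions T) (ss ! j) (qs ! j) (ts' ! j)"
      by (metis IH len ts'(3))
    then show "run (td_transitions T) (Node \<sigma> ss) q t"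
      using 1(3) 2 v len ts'(1,2) by (auto simp: run_Node) (auto simp: td_transitions_def)
  next
    assume "run (td_transitions T) (Node \<sigma> ss) q t"
    then obtain qs \<sigma>' ts' where 1: "t = Node \<sigma>' ts'" "(Some \<sigma>, q, 0, td_rhs \<sigma>' qs) \<in> rules T"
      "length ss = length qs" "length ts' = length qs"
      "\<forall>j < length qs. run (td_transitions T) (ss ! j) (qs ! j) (ts' ! j)"
      by (auto simp: run_Node td_transitions_def)
    then have "\<exists>n. eval T u n (at_node (td_rhs \<sigma>' qs) v) t"
      using IH unfolding 1(1) at_node_td_rhs by (intro eval_outI) auto
    then show "\<exists>n. eval T u n (Node (Inr (q, v)) []) t"
      using eval_attr[OF lab 1(2)] by (auto simp: child_def)
  qed
qed

lemma subtree_at_mark: "subtree_at (mark s) [1] = Some (map_tree Some s)"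
  by (simp add: mark_def)

lemma att_rel_td:
  assumes "is_tdrel T"
  shows "(s, t) \<in> att_rel T \<longleftrightarrow> s \<in> trees (inalph T) \<and> run (td_transitions T) s (init T) t"
proof -
  have "is_att T" using assms by (simp add: is_tdrel_def is_datt_def)
  then show ?thesis
    using att_rel_eval eval_td[OF assms _ subtree_at_mark] by blast
qed

section \<open>Uniformization of relabelings by look-around\<close>

text \<open>Unlike \<open>!\<close>, which is unspecified beyond the end of the list, \<open>get\<close> is computable.\<close>

definition get :: "nat list \<Rightarrow> nat \<Rightarrow> nat" where
  "get xs j = list_nth (list_encode xs) j"

lemma get_nth [simp]: "j < length xs \<Longrightarrow> get xs j = xs ! j"
  by (simp add: get_def list_nth_encode)

lemma computable_get [comp_intros]:
  "computable f \<Longrightarrow> computable g \<Longrightarrow> computable (\<lambda>e. get (f e) (g e))"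
  unfolding get_def by (intro computable_list_nth computable_list_encode)

lemma td_rhs_get: "td_rhs \<sigma> qs = Node (Inl \<sigma>) (map (\<lambda>j. Node (Inr (get qs j, Suc j)) []) [0..<length qs])"
  by (simp add: td_rhs_def)

lemma td_rhs_eq_iff: "td_rhs \<sigma> qs = td_rhs \<sigma>' qs' \<longleftrightarrow> \<sigma> = \<sigma>' \<and> qs = qs'"
proof
  assume eq: "td_rhs \<sigma> qs = td_rhs \<sigma>' qs'"
  then have m: "map (\<lambda>j. Node (Inr (qs ! j, Suc j)) []) [0..<length qs] =
      map (\<lambda>j. Node (Inr (qs' ! j, Suc j)) [] :: rhs) [0..<length qs']" by (simp add: td_rhs_def)
  have "length qs = length qs'" using arg_cong[OF m, of length] by simp
  moreover have "qs ! j = qs' ! j" if "j < length qs" for j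
    using arg_cong[OF m, of "\<lambda>xs. xs ! j"] that \<open>length qs = length qs'\<close> by simp
  moreover have "\<sigma> = \<sigma>'" using eq by (simp add: td_rhs_def)
  ultimately show "\<sigma> = \<sigma>' \<and> qs = qs'" by (metis nth_equalityI)
qed simp

text \<open>A nondeterministic relabeling \<open>N\<close> is uniformized by a look-around: the bottom-up relabeling is
  the subset automaton of \<open>N\<close> and writes the states of the children into the labels, and the top-down
  relabeling then follows the first transition of \<open>N\<close> that can be completed to a run.\<close>

definition subset_codes :: "nat list \<Rightarrow> nat list" where
  "subset_codes xs = foldr (\<lambda>x r. r @ map (\<lambda>n. set_insert x n) r) xs [0]"

type_synonym alph = "(nat \<times> nat) list"

lemma set_subset_codes: "set (subset_codes xs) = set_encode ` Pow (set xs)"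
proof (induction xs)
  case (Cons x xs)
  have "set_insert x ` set_encode ` Pow (set xs) = set_encode ` insert x ` Pow (set xs)"
    by (force simp: image_image set_insert intro!: image_cong dest: finite_subset)
  then show ?case using Cons by (simp add: subset_codes_def Pow_insert image_Un)
qed (simp add: subset_codes_def)

definition matches :: "nat list \<Rightarrow> nat list \<Rightarrow> bool" where
  "matches ps Ps \<longleftrightarrow> length ps = length Ps \<and>
     (\<forall>j \<in> set [0..<length ps]. get ps j \<in> set_decode (get Ps j))"

lemma matches_iff: "matches ps Ps \<longleftrightarrow> length ps = length Ps \<and> (\<forall>j < length Ps. ps ! j \<in> set_decode (Ps ! j))"
  by (auto simp: matches_def)

text \<open>State 0 is the distinguished state at the root of every automaton here, and it must be
  available even if no transition mentions it.\<close>

definition states_of :: "transition list \<Rightarrow> nat list" where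
  "states_of N = 0 # concat (map (\<lambda>(\<sigma>, ps, p, l). p # ps) N)"

definition enabled :: "transition list \<Rightarrow> nat \<Rightarrow> nat list \<Rightarrow> transition list" where
  "enabled N \<sigma> Ps = filter (\<lambda>(\<sigma>', ps, p, l). \<sigma>' = \<sigma> \<and> matches ps Ps) N"

definition successor :: "transition list \<Rightarrow> nat \<Rightarrow> nat list \<Rightarrow> nat" where
  "successor N \<sigma> Ps = set_encode (set (map (\<lambda>(\<sigma>, ps, p, l). p) (enabled N \<sigma> Ps)))"

definition subset_symbols :: "transition list \<Rightarrow> alph \<Rightarrow> (nat \<times> nat list) list" where
  "subset_symbols N \<Sigma> =
     concat (map (\<lambda>(\<sigma>, k). map (\<lambda>Ps. (\<sigma>, Ps)) (List.n_lists k (subset_codes (states_of N)))) \<Sigma>)"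

definition first :: "'a list \<Rightarrow> 'a list" where
  "first xs = (case xs of [] \<Rightarrow> [] | x # _ \<Rightarrow> [x])"

definition subset_alph :: "transition list \<Rightarrow> alph \<Rightarrow> alph" where
  "subset_alph N \<Sigma> = map (\<lambda>(\<sigma>, Ps). (enc (\<sigma>, Ps), length Ps)) (subset_symbols N \<Sigma>)"

definition subset_finals :: "transition list \<Rightarrow> nat list" where
  "subset_finals N = filter (\<lambda>P. 0 \<in> set_decode P) (subset_codes (states_of N))"

definition subset_rules :: "transition list \<Rightarrow> alph \<Rightarrow> transition list" where
  "subset_rules N \<Sigma> = map (\<lambda>(\<sigma>, Ps). (\<sigma>, Ps, successor N \<sigma> Ps, enc (\<sigma>, Ps))) (subset_symbols N \<Sigma>)"

definition subset_burel :: "transition list \<Rightarrow> alph \<Rightarrow> burel" where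
  "subset_burel N \<Sigma> = \<lparr>bu_states = set (subset_codes (states_of N)), bu_in = set \<Sigma>,
     bu_out = set (subset_alph N \<Sigma>), bu_final = set (subset_finals N),
     bu_rules = set (subset_rules N \<Sigma>)\<rparr>"

definition choice_rules :: "transition list \<Rightarrow> alph \<Rightarrow> rule list" where
  "choice_rules N \<Sigma> = concat (map (\<lambda>(\<sigma>, Ps). concat (map (\<lambda>q.
     map (\<lambda>(\<sigma>', ps, p, l). (Some (enc (\<sigma>, Ps)), q, 0, td_rhs l ps))
       (first (filter (\<lambda>(\<sigma>', ps, p, l). p = q) (enabled N \<sigma> Ps)))) (states_of N))) (subset_symbols N \<Sigma>))"

definition choice_tdrel :: "transition list \<Rightarrow> alph \<Rightarrow> alph \<Rightarrow> att" where
  "choice_tdrel N \<Sigma> \<Delta> = \<lparr>syn = set (states_of N), inh = {}, inalph = set (subset_alph N \<Sigma>),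
     outalph = set \<Delta>, init = 0, rules = set (choice_rules N \<Sigma>)\<rparr>"

section \<open>Correctness of the uniformization\<close>

lemma set_states_of: "set (states_of N) = insert 0 (\<Union>(\<sigma>, ps, p, l) \<in> set N. insert p (set ps))"
  by (auto simp: states_of_def)

lemma first_cases: "first xs = [] \<and> xs = [] \<or> (\<exists>x. first xs = [x] \<and> x \<in> set xs)"
  by (cases xs) (auto simp: first_def)

lemma set_enabled: "set (enabled N \<sigma> Ps) = {(\<sigma>', ps, p, l) \<in> set N. \<sigma>' = \<sigma> \<and> matches ps Ps}"
  by (auto simp: enabled_def)

lemma set_decode_successor:
  "set_decode (successor N \<sigma> Ps) = {p. \<exists>ps l. (\<sigma>, ps, p, l) \<in> set N \<and> matches ps Ps}"
  unfolding successor_def by (subst set_encode_inverse) (force simp: set_enabled)+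

lemma successor_in: "successor N \<sigma> Ps \<in> set (subset_codes (states_of N))"
  unfolding set_subset_codes successor_def by (rule imageI) (force simp: set_enabled set_states_of)

lemma set_subset_symbols: "set (subset_symbols N \<Sigma>) =
    {(\<sigma>, Ps). (\<sigma>, length Ps) \<in> set \<Sigma> \<and> set Ps \<subseteq> set (subset_codes (states_of N))}"
  by (auto simp: subset_symbols_def set_n_lists)

lemma subset_rules_iff: "(\<sigma>, Ps, p, x) \<in> set (subset_rules N \<Sigma>) \<longleftrightarrow>
    (\<sigma>, Ps) \<in> set (subset_symbols N \<Sigma>) \<and> p = successor N \<sigma> Ps \<and> x = enc (\<sigma>, Ps)"
  by (auto simp: subset_rules_def)

lemma subset_alph_iff: "(x, k) \<in> set (subset_alph N \<Sigma>) \<longleftrightarrow>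
    (\<exists>\<sigma> Ps. (\<sigma>, Ps) \<in> set (subset_symbols N \<Sigma>) \<and> x = enc (\<sigma>, Ps) \<and> k = length Ps)"
  by (auto simp: subset_alph_def)

lemma choice_rulesD:
  assumes "(x, q, i, \<xi>) \<in> set (choice_rules N \<Sigma>)"
  obtains \<sigma> Ps ps l where "x = Some (enc (\<sigma>, Ps))" "(\<sigma>, Ps) \<in> set (subset_symbols N \<Sigma>)" "i = 0"
    "(\<sigma>, ps, q, l) \<in> set N" "matches ps Ps" "\<xi> = td_rhs l ps"
    "first (filter (\<lambda>(\<sigma>', ps, p, l). p = q) (enabled N \<sigma> Ps)) = [(\<sigma>, ps, q, l)]"
proof -
  from assms obtain \<sigma> Ps \<sigma>' ps p l where
    1: "(\<sigma>, Ps) \<in> set (subset_symbols N \<Sigma>)" "x = Some (enc (\<sigma>, Ps))" "i = 0" "\<xi> = td_rhs l ps"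
    and 2: "(\<sigma>', ps, p, l) \<in> set (first (filter (\<lambda>(\<sigma>', ps, p, l). p = q) (enabled N \<sigma> Ps)))"
    by (auto simp: choice_rules_def)
  then have "(\<sigma>', ps, p, l) \<in> set (filter (\<lambda>(\<sigma>', ps, p, l). p = q) (enabled N \<sigma> Ps))"
    "first (filter (\<lambda>(\<sigma>', ps, p, l). p = q) (enabled N \<sigma> Ps)) = [(\<sigma>', ps, p, l)]"
    using first_cases[of "filter (\<lambda>(\<sigma>', ps, p, l). p = q) (enabled N \<sigma> Ps)"] by auto
  then show ?thesis using 1 by (intro that) (auto simp: set_enabled)
qed

text \<open>A state enters the subset only through some matching transition, so the candidates for
  this state are not exhausted and \<open>first\<close> picks one of them.\<close>

lemma choice_rulesI:
  assumes "(\<sigma>, Ps) \<in> set (subset_symbols N \<Sigma>)" "q \<in> set_decode (successor N \<sigma> Ps)"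
  shows "\<exists>ps l. (Some (enc (\<sigma>, Ps)), q, 0, td_rhs l ps) \<in> set (choice_rules N \<Sigma>) \<and> matches ps Ps"
proof -
  obtain ps l where 1: "(\<sigma>, ps, q, l) \<in> set N" "matches ps Ps"
    using assms(2) by (auto simp: set_decode_successor)
  let ?f = "filter (\<lambda>(\<sigma>', ps, p, l). p = q) (enabled N \<sigma> Ps)"
  have "(\<sigma>, ps, q, l) \<in> set ?f" using 1 by (auto simp: set_enabled)
  then have "?f \<noteq> []" by (metis empty_iff empty_set)
  then obtain x where "first ?f = [x]" "x \<in> set ?f" using first_cases[of ?f] by auto
  then obtain ps l where 2: "(\<sigma>, ps, q, l) \<in> set (first ?f)" "matches ps Ps" by (auto simp: set_enabled)
  have "q \<in> set (states_of N)" using 1 by (force simp: set_states_of)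
  then have "(Some (enc (\<sigma>, Ps)), q, 0, td_rhs l ps) \<in> set (choice_rules N \<Sigma>)"
    using 2(1) assms(1) unfolding choice_rules_def by force
  then show ?thesis using 2(2) by blast
qed

locale relabeling =
  fixes N :: "transition list" and \<Sigma> \<Delta> :: "alph"
  assumes N: "\<And>\<sigma> ps p l. (\<sigma>, ps, p, l) \<in> set N \<Longrightarrow> (\<sigma>, length ps) \<in> set \<Sigma> \<and> (l, length ps) \<in> set \<Delta>"
    and \<Sigma>: "ranked_alphabet (set \<Sigma>)" and \<Delta>: "ranked_alphabet (set \<Delta>)"
begin

abbreviation "B \<equiv> subset_burel N \<Sigma>"
abbreviation "T \<equiv> choice_tdrel N \<Sigma> \<Delta>"

lemma ranked_subset_alph: "ranked_alphabet (set (subset_alph N \<Sigma>))"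
  by (auto simp: ranked_alphabet_def subset_alph_iff single_valued_def)

lemma is_burel: "is_burel B"
  using \<Sigma> ranked_subset_alph successor_in
  by (auto simp: is_burel_def subset_burel_def subset_finals_def subset_rules_iff subset_alph_iff
    set_subset_symbols)

lemma is_tdrel: "is_tdrel T"
proof -
  have rule: "att_rule_ok T (x, q, i, \<xi>) \<and> (\<exists>\<sigma> k \<sigma>' qs. x = Some \<sigma> \<and> (\<sigma>, k) \<in> inalph T \<and> (\<sigma>', k) \<in> outalph T \<and> length qs = k \<and>
      \<xi> = Node (Inl \<sigma>') (map (\<lambda>j. Node (Inr (qs ! j, Suc j)) []) [0..<k]))"
    if r: "(x, q, i, \<xi>) \<in> rules T" for x q i \<xi>
  proof -
    from r have "(x, q, i, \<xi>) \<in> set (choice_rules N \<Sigma>)" by (simp add: choice_tdrel_def)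
    then obtain \<sigma> Ps ps l where 1: "x = Some (enc (\<sigma>, Ps))" "(\<sigma>, Ps) \<in> set (subset_symbols N \<Sigma>)" "i = 0"
      "(\<sigma>, ps, q, l) \<in> set N" "matches ps Ps" "\<xi> = td_rhs l ps" by (rule choice_rulesD)
    have "length ps = length Ps" using 1(5) by (simp add: matches_iff)
    then have a: "(enc (\<sigma>, Ps), length ps) \<in> inalph T" "(l, length ps) \<in> outalph T"
      using 1 N[OF 1(4)] by (auto simp: choice_tdrel_def subset_alph_iff)
    moreover have "q \<in> syn T" "set ps \<subseteq> syn T" using 1(4) by (force simp: choice_tdrel_def set_states_of)+
    then have "att_rule_ok T (x, q, i, \<xi>)"
      using a unfolding 1 att_rule_ok_def
      by (auto simp: td_rhs_def trees_with_Inl trees_with_Inr subset_iff intro!: exI[of _ "length ps"])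
    ultimately show ?thesis using 1 unfolding td_rhs_def by blast
  qed
  have "deterministic T"
    unfolding deterministic_def
  proof (intro allI impI)
    fix x q i \<xi> \<xi>' assume "(x, q, i, \<xi>) \<in> rules T \<and> (x, q, i, \<xi>') \<in> rules T"
    then have "(x, q, i, \<xi>) \<in> set (choice_rules N \<Sigma>)" "(x, q, i, \<xi>') \<in> set (choice_rules N \<Sigma>)"
      by (simp_all add: choice_tdrel_def)
    then show "\<xi> = \<xi>'" by (auto elim!: choice_rulesD simp: td_rhs_eq_iff)
  qed
  moreover have "is_att T"
    unfolding is_att_def using rule ranked_subset_alph \<Delta>
    by (auto simp: choice_tdrel_def set_states_of)
  ultimately show ?thesis using rule
    unfolding is_tdrel_def is_datt_def by (simp add: choice_tdrel_def) blast
qed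

lemma is_lookaround: "is_lookaround (B, T)"
  using is_burel is_tdrel by (simp add: is_lookaround_def subset_burel_def choice_tdrel_def)

lemma td_transitions_T: "td_transitions T =
   {(x, ps, q, l). (Some x, q, 0, td_rhs l ps) \<in> set (choice_rules N \<Sigma>)}"
  by (simp add: td_transitions_def choice_tdrel_def)

text \<open>The subset automaton never blocks: where no transition of \<open>N\<close> matches, it
  continues with the code of the empty set.\<close>

lemma run_subset_total:
  "s \<in> trees (set \<Sigma>) \<Longrightarrow> \<exists>P s'. P \<in> set (subset_codes (states_of N)) \<and> run (set (subset_rules N \<Sigma>)) s P s'"
proof (induction s rule: tree.induct)
  case (Node \<sigma> ss)
  then have "\<forall>j. \<exists>P s'. j < length ss \<longrightarrow> P \<in> set (subset_codes (states_of N)) \<and> run (set (subset_rules N \<Sigma>)) (ss ! j) P s'"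
    by (auto simp: trees_Node)
  then obtain P s' where 1: "\<And>j. j < length ss \<Longrightarrow> P j \<in> set (subset_codes (states_of N)) \<and>
    run (set (subset_rules N \<Sigma>)) (ss ! j) (P j) (s' j)" by metis
  let ?Ps = "map P [0..<length ss]"
  have "(\<sigma>, ?Ps) \<in> set (subset_symbols N \<Sigma>)"
    using 1 Node.prems by (auto simp: set_subset_symbols trees_Node)
  then have "(\<sigma>, ?Ps, successor N \<sigma> ?Ps, enc (\<sigma>, ?Ps)) \<in> set (subset_rules N \<Sigma>)"
    by (simp add: subset_rules_iff)
  then have "run (set (subset_rules N \<Sigma>)) (Node \<sigma> ss) (successor N \<sigma> ?Ps)
     (Node (enc (\<sigma>, ?Ps)) (map s' [0..<length ss]))"
    using 1 by (auto simp: run_Node intro!: exI[of _ ?Ps])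
  then show ?case using successor_in by blast
qed

text \<open>Together the claims say that \<open>P\<close> codes exactly the states to which
  \<open>N\<close> has a run on \<open>s\<close>, and that the top-down pass started in any of them
  never gets stuck. The latter holds because the chosen transition asks only for states in the
  subsets of the children.\<close>

lemma run_choice:
  assumes "run (set (subset_rules N \<Sigma>)) s P s1"
  shows "\<And>q s'. run (td_transitions T) s1 q s' \<Longrightarrow> run (set N) s q s'"
    and "\<And>q s'. run (set N) s q s' \<Longrightarrow> q \<in> set_decode P"
    and "\<And>q. q \<in> set_decode P \<Longrightarrow> \<exists>s'. run (td_transitions T) s1 q s'"
proof -
  have "(\<forall>q s'. run (td_transitions T) s1 q s' \<longrightarrow> run (set N) s q s') \<and>
    (\<forall>q s'. run (set N) s q s' \<longrightarrow> q \<in> set_decode P) \<and>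
    (\<forall>q. q \<in> set_decode P \<longrightarrow> (\<exists>s'. run (td_transitions T) s1 q s'))"
    using assms
  proof (induction s arbitrary: P s1)
    case (Node \<sigma> ss)
    then obtain Ps ss1 where 1: "s1 = Node (enc (\<sigma>, Ps)) ss1" "P = successor N \<sigma> Ps"
      "(\<sigma>, Ps) \<in> set (subset_symbols N \<Sigma>)" "length ss = length Ps" "length ss1 = length Ps"
      and 2: "\<And>j. j < length Ps \<Longrightarrow> run (set (subset_rules N \<Sigma>)) (ss ! j) (Ps ! j) (ss1 ! j)"
      by (auto simp: run_Node subset_rules_iff)
    have a: "run (set N) (ss ! j) q s'" if "j < length Ps" "run (td_transitions T) (ss1 ! j) q s'" for j q s'
      using Node.IH[OF nth_mem 2] that 1 by fastforce
    have b: "q \<in> set_decode (Ps ! j)" if "j < length Ps" "run (set N) (ss ! j) q s'" for j q s'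
      using Node.IH[OF nth_mem 2] that 1 by fastforce
    have c: "\<exists>s'. run (td_transitions T) (ss1 ! j) q s'" if "j < length Ps" "q \<in> set_decode (Ps ! j)" for j q
      using Node.IH[OF nth_mem 2] that 1 by fastforce
    have "run (set N) (Node \<sigma> ss) q s'" if r: "run (td_transitions T) s1 q s'" for q s'
    proof -
      from r[unfolded 1(1)] obtain ps l ss' where 3: "s' = Node l ss'" "(enc (\<sigma>, Ps), ps, q, l) \<in> td_transitions T"
        "length ss1 = length ps" "length ss' = length ps" "\<forall>j < length ps. run (td_transitions T) (ss1 ! j) (ps ! j) (ss' ! j)"
        by (auto simp: run_Node)
      then have "(\<sigma>, ps, q, l) \<in> set N" by (auto simp: td_transitions_T td_rhs_eq_iff elim: choice_rulesD)
      then show ?thesis using 3 1 a by (auto simp: run_Node)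
    qed
    moreover have "q \<in> set_decode P" if "run (set N) (Node \<sigma> ss) q s'" for q s'
    proof -
      from that obtain ps l ss' where "(\<sigma>, ps, q, l) \<in> set N" "length ss = length ps"
        "\<And>j. j < length ps \<Longrightarrow> run (set N) (ss ! j) (ps ! j) (ss' ! j)" by (auto simp: run_Node)
      moreover from this have "matches ps Ps" using b 1(4) by (auto simp: matches_iff)
      ultimately show ?thesis unfolding 1(2) set_decode_successor by blast
    qed
    moreover have "\<exists>s'. run (td_transitions T) s1 q s'" if "q \<in> set_decode P" for q
    proof -
      from choice_rulesI[OF 1(3) that[unfolded 1(2)]] obtain ps l where
        2: "(Some (enc (\<sigma>, Ps)), q, 0, td_rhs l ps) \<in> set (choice_rules N \<Sigma>)" "matches ps Ps" by blast
      then have 3: "(enc (\<sigma>, Ps), ps, q, l) \<in> td_transitions T" "matches ps Ps"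
        by (simp_all add: td_transitions_T)
      have "\<forall>j. \<exists>s'. j < length ps \<longrightarrow> run (td_transitions T) (ss1 ! j) (ps ! j) s'"
        using 3(2) c unfolding matches_iff by metis
      then obtain f where "\<And>j. j < length ps \<Longrightarrow> run (td_transitions T) (ss1 ! j) (ps ! j) (f j)" by metis
      then have "run (td_transitions T) s1 q (Node l (map f [0..<length ps]))"
        using 3 1 by (auto simp: run_Node matches_iff intro!: exI[of _ ps])
      then show ?thesis by blast
    qed
    ultimately show ?case by blast
  qed
  then show "\<And>q s'. run (td_transitions T) s1 q s' \<Longrightarrow> run (set N) s q s'"
    and "\<And>q s'. run (set N) s q s' \<Longrightarrow> q \<in> set_decode P"
    and "\<And>q. q \<in> set_decode P \<Longrightarrow> \<exists>s'. run (td_transitions T) s1 q s'" by blast+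
qed

lemma la_rel_sound: "(s, s') \<in> la_rel (B, T) \<Longrightarrow> run (set N) s 0 s'"
proof -
  assume "(s, s') \<in> la_rel (B, T)"
  then obtain s1 P where "run (bu_rules B) s P s1" "run (td_transitions T) s1 (init T) s'"
    unfolding la_rel_def bu_rel_def by (auto simp: bu_run_eq att_rel_td[OF is_tdrel])
  then show ?thesis using run_choice(1) by (simp add: subset_burel_def choice_tdrel_def)
qed

lemma la_rel_total:
  assumes "run (set N) s 0 s'"
  shows "\<exists>s''. (s, s'') \<in> la_rel (B, T)"
proof -
  have s: "s \<in> trees (set \<Sigma>)" using assms by (rule run_trees_in) (use N in blast)
  then obtain P s1 where 1: "P \<in> set (subset_codes (states_of N))" "run (set (subset_rules N \<Sigma>)) s P s1"
    using run_subset_total by blast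
  have "s1 \<in> trees (set (subset_alph N \<Sigma>))"
    using 1(2) by (rule run_trees_out) (auto simp: subset_rules_iff subset_alph_iff)
  moreover have "0 \<in> set_decode P" using run_choice(2)[OF 1(2) assms] .
  moreover from this obtain s2 where "run (td_transitions T) s1 0 s2" using run_choice(3)[OF 1(2)] by blast
  ultimately have "(s, s1) \<in> bu_rel B" "(s1, s2) \<in> att_rel T"
    using 1 s by (auto simp: bu_rel_def bu_run_eq att_rel_td[OF is_tdrel])
     (auto simp: subset_burel_def subset_finals_def choice_tdrel_def)
  then show ?thesis by (auto simp: la_rel_def)
qed

end

section \<open>Guessing non-circular deterministic computations\<close>

text \<open>The deterministic att has the attributes \<open>mk_attr \<gamma> q g\<close>: the attribute $\gamma$ together with the
  state \<open>q\<close> that the automaton \<open>L\<close> for the admissible output trees has to reach on its value. For an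
  inherited attribute of the root, the number \<open>g\<close> names the chosen rule of $R_\#$ (\<open>hashes\<close>); this makes
  $R_\#$ deterministic, although it cannot depend on the input tree.\<close>

definition mk_attr :: "nat \<Rightarrow> nat \<Rightarrow> nat \<Rightarrow> nat" where
  "mk_attr \<gamma> q g = prod_encode (\<gamma>, prod_encode (q, g))"

definition base :: "nat \<Rightarrow> nat" where "base \<alpha> = fst (prod_decode \<alpha>)"

definition target :: "nat \<Rightarrow> nat" where "target \<alpha> = fst (prod_decode (snd (prod_decode \<alpha>)))"

lemma base_mk [simp]: "base (mk_attr \<gamma> q g) = \<gamma>" and target_mk [simp]: "target (mk_attr \<gamma> q g) = q"
  and mk_attr_eq [simp]: "mk_attr \<gamma> q g = mk_attr \<gamma>' q' g' \<longleftrightarrow> \<gamma> = \<gamma>' \<and> q = q' \<and> g = g'"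
  by (auto simp: mk_attr_def base_def target_def)

type_synonym key = "nat \<times> nat"

type_synonym annot = "nat \<times> rhs \<times> key list"

text \<open>The triples \<open>(q, \<xi>', lv)\<close> such that \<open>\<xi>'\<close> arises from \<open>\<xi>\<close> by extending the attributes, with leaves
  \<open>lv\<close>, and \<open>L\<close> has a run on \<open>\<xi>'\<close> from the states at the leaves to \<open>q\<close>.\<close>

definition annotate_node :: "transition list \<Rightarrow> nat list \<Rightarrow> nat + key \<Rightarrow>
    annot list list \<Rightarrow> annot list" where
  "annotate_node L gs f Z = (case f of
     Inl \<delta> \<Rightarrow> concat (map (\<lambda>zs. concat (map (\<lambda>(\<delta>', qs, q, l). if \<delta>' = \<delta> \<and> qs = map fst zs
         then [(q, Node (Inl \<delta>) (map (\<lambda>z. fst (snd z)) zs), concat (map (\<lambda>z. snd (snd z)) zs))] else []) L))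
       (product_lists Z))
   | Inr (\<gamma>, i) \<Rightarrow> concat (map (\<lambda>q. map (\<lambda>g.
         (q, Node (Inr (mk_attr \<gamma> q g, i)) [], [(mk_attr \<gamma> q g, i)])) (if i = 0 then gs else [0])) (states_of L)))"

text \<open>\<open>gs\<close> lists the tags allowed for inherited attributes of the node itself.
  The attributes of children on a right-hand side are synthesized and always carry tag 0.\<close>

definition annotate :: "transition list \<Rightarrow> nat list \<Rightarrow> rhs \<Rightarrow> annot list" where
  "annotate L gs \<xi> = fold_tree (\<lambda>f Z. annotate_node L gs f Z) \<xi>"

lemma annotate_Node: "annotate L gs (Node f ts) = annotate_node L gs f (map (annotate L gs) ts)"
  by (simp add: annotate_def[abs_def])

section \<open>Right-hand sides annotated by automaton runs\<close>

definition strip :: "(nat + nat \<times> 'b) tree \<Rightarrow> (nat + nat \<times> 'b) tree" where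
  "strip = map_tree (map_sum id (\<lambda>(\<alpha>, x). (base \<alpha>, x)))"

text \<open>The states at attribute leaves are promises about the trees that will replace these
  leaves; \<open>det_eval_sound\<close> shows that they are kept.\<close>

inductive typed :: "transition list \<Rightarrow> (nat + nat \<times> 'b) tree \<Rightarrow> nat \<Rightarrow> bool" for L where
  "typed L (Node (Inr (\<alpha>, x)) []) (target \<alpha>)"
| "(\<delta>, qs, q, l) \<in> set L \<Longrightarrow> length ts = length qs \<Longrightarrow> \<forall>j < length qs. typed L (ts ! j) (qs ! j) \<Longrightarrow>
     typed L (Node (Inl \<delta>) ts) q"

text \<open>Forgetting its output turns a relabeling into a tree automaton. In this role the
  guessing relabeling of one transducer becomes the \<open>L\<close> of the preceding one.\<close>

definition accepts :: "transition list \<Rightarrow> nat tree \<Rightarrow> nat \<Rightarrow> bool" where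
  "accepts L t q \<longleftrightarrow> (\<exists>t'. run (set L) t q t')"

lemma accepts_Node: "accepts L (Node \<sigma> ts) q \<longleftrightarrow>
   (\<exists>qs l. (\<sigma>, qs, q, l) \<in> set L \<and> length ts = length qs \<and> (\<forall>j < length qs. accepts L (ts ! j) (qs ! j)))"
proof
  assume "\<exists>qs l. (\<sigma>, qs, q, l) \<in> set L \<and> length ts = length qs \<and> (\<forall>j < length qs. accepts L (ts ! j) (qs ! j))"
  then obtain qs l where 1: "(\<sigma>, qs, q, l) \<in> set L" "length ts = length qs"
    "\<forall>j < length qs. \<exists>t'. run (set L) (ts ! j) (qs ! j) t'" by (auto simp: accepts_def)
  then obtain f where "\<forall>j < length qs. run (set L) (ts ! j) (qs ! j) (f j)" by metis
  then have "run (set L) (Node \<sigma> ts) q (Node l (map f [0..<length qs]))"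
    using 1 by (auto simp: run_Node intro!: exI[of _ qs])
  then show "accepts L (Node \<sigma> ts) q" by (auto simp: accepts_def)
qed (auto simp: accepts_def run_Node)

lemma accepts_state: "accepts L t q \<Longrightarrow> q \<in> set (states_of L)"
  by (cases t) (force simp: accepts_Node set_states_of)

lemma annotate_Inl: "(q, \<xi>', lv) \<in> set (annotate L gs (Node (Inl \<delta>) ts)) \<longleftrightarrow>
  (\<exists>qs l zs. (\<delta>, qs, q, l) \<in> set L \<and> length qs = length ts \<and> length zs = length ts \<and>
     (\<forall>j < length ts. (qs ! j, zs ! j) \<in> set (annotate L gs (ts ! j))) \<and>
     \<xi>' = Node (Inl \<delta>) (map fst zs) \<and> lv = concat (map snd zs))" (is "?l \<longleftrightarrow> ?r")
proof
  assume ?l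
  then obtain zs l where "list_all2 (\<lambda>z Z. z \<in> set Z) zs (map (annotate L gs) ts)"
    "(\<delta>, map fst zs, q, l) \<in> set L" "\<xi>' = Node (Inl \<delta>) (map (\<lambda>z. fst (snd z)) zs)" "lv = concat (map (\<lambda>z. snd (snd z)) zs)"
    by (auto simp: annotate_Node annotate_node_def product_lists_set split: if_splits)
  then show ?r
    by (intro exI[of _ "map fst zs"] exI[of _ l] exI[of _ "map snd zs"]) (auto simp: list_all2_conv_all_nth o_def)
next
  assume ?r
  then obtain qs l zs where 1: "(\<delta>, qs, q, l) \<in> set L" "length qs = length ts" "length zs = length ts"
     "\<forall>j < length ts. (qs ! j, zs ! j) \<in> set (annotate L gs (ts ! j))"
     "\<xi>' = Node (Inl \<delta>) (map fst zs)" "lv = concat (map snd zs)" by blast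
  let ?zs = "zip qs zs"
  have "?zs \<in> set (product_lists (map (annotate L gs) ts))"
    using 1 by (auto simp: product_lists_set list_all2_conv_all_nth)
  moreover have "map fst ?zs = qs" "map (\<lambda>z. fst (snd z)) ?zs = map fst zs" "map (\<lambda>z. snd (snd z)) ?zs = map snd zs"
    using 1 by (auto simp: list_eq_iff_nth_eq)
  ultimately show ?l using 1(1,5,6) unfolding annotate_Node annotate_node_def
    by (auto intro!: bexI[of _ ?zs] bexI[of _ "(\<delta>, qs, q, l)"])
qed

lemma annotate_Inr: "(q, \<xi>', lv) \<in> set (annotate L gs (Node (Inr (\<gamma>, i)) ts)) \<longleftrightarrow>
  (\<exists>g. q \<in> set (states_of L) \<and> g \<in> set (if i = 0 then gs else [0]) \<and>
     \<xi>' = Node (Inr (mk_attr \<gamma> q g, i)) [] \<and> lv = [(mk_attr \<gamma> q g, i)])"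
  by (auto simp: annotate_Node annotate_node_def)

lemma annotate_sound:
  assumes "\<xi> \<in> trees_with \<Delta> \<Lambda>" "(q, \<xi>', lv) \<in> set (annotate L gs \<xi>)"
  shows "strip \<xi>' = \<xi> \<and> typed L \<xi>' q \<and> \<xi>' \<in> trees_with \<Delta> (set lv) \<and>
    (\<forall>(\<alpha>, i) \<in> set lv. \<exists>\<gamma> q g. \<alpha> = mk_attr \<gamma> q g \<and> (\<gamma>, i) \<in> \<Lambda> \<and> q \<in> set (states_of L) \<and>
       g \<in> set (if i = 0 then gs else [0]))"
  using assms
proof (induction \<xi> arbitrary: q \<xi>' lv rule: tree.induct)
  case (Node f ts)
  show ?case
  proof (cases f)
    case (Inl \<delta>)
    obtain qs l zs where 1: "(\<delta>, qs, q, l) \<in> set L" "length qs = length ts" "length zs = length ts"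
     "\<And>j. j < length ts \<Longrightarrow> (qs ! j, zs ! j) \<in> set (annotate L gs (ts ! j))"
     "\<xi>' = Node (Inl \<delta>) (map fst zs)" "lv = concat (map snd zs)"
      using Node.prems(2) unfolding Inl annotate_Inl by blast
    have ts: "(\<delta>, length ts) \<in> \<Delta>" "\<And>j. j < length ts \<Longrightarrow> ts ! j \<in> trees_with \<Delta> \<Lambda>"
      using Node.prems(1) by (auto simp: Inl trees_with_Inl)
    have IH: "strip (fst (zs ! j)) = ts ! j \<and> typed L (fst (zs ! j)) (qs ! j) \<and>
      fst (zs ! j) \<in> trees_with \<Delta> (set (snd (zs ! j))) \<and>
      (\<forall>(\<alpha>, i) \<in> set (snd (zs ! j)). \<exists>\<gamma> q g. \<alpha> = mk_attr \<gamma> q g \<and> (\<gamma>, i) \<in> \<Lambda> \<and> q \<in> set (states_of L) \<and>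
         g \<in> set (if i = 0 then gs else [0]))" if "j < length ts" for j
      using Node.IH[OF nth_mem[OF that] ts(2)[OF that], of "qs ! j" "fst (zs ! j)" "snd (zs ! j)"] 1(4)[OF that]
      by (simp only: prod.collapse) blast
    have a: "strip \<xi>' = Node f ts"
      using IH 1(2,3) unfolding 1(5) Inl by (auto simp: strip_def intro!: nth_equalityI)
    have b: "typed L \<xi>' q" unfolding 1(5) using IH 1(1-3) by (intro typed.intros(2)) auto
    have "fst (zs ! j) \<in> trees_with \<Delta> (set lv)" if "j < length ts" for j
    proof (rule trees_with_mono)
      show "fst (zs ! j) \<in> trees_with \<Delta> (set (snd (zs ! j)))" using IH that by blast
      show "set (snd (zs ! j)) \<subseteq> set lv" using that 1(3) by (auto simp: 1(6) intro!: bexI[of _ "zs ! j"])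
    qed
    then have c: "\<xi>' \<in> trees_with \<Delta> (set lv)"
      using ts 1(3) unfolding 1(5) trees_with_Inl by (simp add: all_set_conv_all_nth)
    have "\<exists>\<gamma> q g. \<alpha> = mk_attr \<gamma> q g \<and> (\<gamma>, i) \<in> \<Lambda> \<and> q \<in> set (states_of L) \<and>
         g \<in> set (if i = 0 then gs else [0])" if "(\<alpha>, i) \<in> set lv" for \<alpha> i
    proof -
      from that obtain z where "z \<in> set zs" "(\<alpha>, i) \<in> set (snd z)" by (auto simp: 1(6))
      then obtain j where j: "j < length ts" "(\<alpha>, i) \<in> set (snd (zs ! j))" using 1(3) by (metis in_set_conv_nth)
      show ?thesis using IH[OF j(1)] j(2) by blast
    qed
    then show ?thesis using a b c by blast
  next
    case (Inr \<gamma>i)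
    obtain \<gamma> i where \<gamma>i: "\<gamma>i = (\<gamma>, i)" by (cases \<gamma>i)
    show ?thesis using Node.prems typed.intros(1)[of L "mk_attr \<gamma> q _" i]
      by (auto simp: Inr \<gamma>i annotate_Inr trees_with_Inr strip_def)
  qed
qed

definition producible :: "att \<Rightarrow> nat option tree \<Rightarrow> transition list \<Rightarrow> nat \<Rightarrow> nat \<Rightarrow> nat \<Rightarrow> node \<Rightarrow> bool" where
  "producible A u L n \<gamma> q w \<longleftrightarrow> (\<exists>t. eval A u n (Node (Inr (\<gamma>, w)) []) t \<and> accepts L t q)"

text \<open>A run of \<open>L\<close> on the value \<open>t\<close> restricts to the output part of
  \<open>\<xi>\<close>, and its states at the attribute leaves are realized by the subtrees
  evaluated there, under the same bound \<open>n\<close>. The function \<open>tg\<close> leaves the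
  choice of tags to the caller.\<close>

lemma annotate_complete:
  assumes "\<xi> \<in> trees_with \<Delta> \<Lambda>" "eval A u n (at_node \<xi> v) t" "accepts L t q"
    and "\<And>\<gamma> q i. (\<gamma>, i) \<in> \<Lambda> \<Longrightarrow> producible A u L n \<gamma> q (child v i) \<Longrightarrow> tg \<gamma> q (child v i) \<in> set (if i = 0 then gs else [0])"
  shows "\<exists>\<xi>' lv. (q, \<xi>', lv) \<in> set (annotate L gs \<xi>) \<and> (\<forall>(\<alpha>, i) \<in> set lv. \<exists>\<gamma> q.
     \<alpha> = mk_attr \<gamma> q (tg \<gamma> q (child v i)) \<and> (\<gamma>, i) \<in> \<Lambda> \<and> producible A u L n \<gamma> q (child v i))"
proof -
  define good where "good lv \<longleftrightarrow> (\<forall>(\<alpha>, i) \<in> set lv. \<exists>\<gamma> q.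
     \<alpha> = mk_attr \<gamma> q (tg \<gamma> q (child v i)) \<and> (\<gamma>, i) \<in> \<Lambda> \<and> producible A u L n \<gamma> q (child v i))" for lv :: "key list"
  have "\<exists>\<xi>' lv. (q, \<xi>', lv) \<in> set (annotate L gs \<xi>) \<and> good lv"
    using assms(1-3)
  proof (induction \<xi> arbitrary: t q rule: tree.induct)
    case (Node f ts)
    show ?case
    proof (cases f)
      case (Inl \<delta>)
      from Node.prems(2)[unfolded Inl at_node_Inl] obtain us where us: "t = Node \<delta> us" "length us = length ts"
        "\<And>j. j < length ts \<Longrightarrow> eval A u n (at_node (ts ! j) v) (us ! j)" by (auto elim: eval_OutE)
      obtain qs l where qs: "(\<delta>, qs, q, l) \<in> set L" "length ts = length qs"
        "\<And>j. j < length qs \<Longrightarrow> accepts L (us ! j) (qs ! j)"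
        using Node.prems(3) us by (auto simp: accepts_Node)
      have "\<forall>j. \<exists>z. j < length ts \<longrightarrow> (qs ! j, z) \<in> set (annotate L gs (ts ! j)) \<and> good (snd z)"
      proof
        fix j
        show "\<exists>z. j < length ts \<longrightarrow> (qs ! j, z) \<in> set (annotate L gs (ts ! j)) \<and> good (snd z)"
        proof (cases "j < length ts")
          case True
          then have "ts ! j \<in> trees_with \<Delta> \<Lambda>" using Node.prems(1) by (auto simp: Inl trees_with_Inl)
          from Node.IH[OF nth_mem[OF True] this us(3)[OF True] qs(3)[OF True[unfolded qs(2)]]]
          obtain \<xi>' lv where "(qs ! j, \<xi>', lv) \<in> set (annotate L gs (ts ! j))" "good lv" by blast
          then show ?thesis by (intro exI[of _ "(\<xi>', lv)"]) simp
        qed simp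
      qed
      then obtain z where z: "\<And>j. j < length ts \<Longrightarrow> (qs ! j, z j) \<in> set (annotate L gs (ts ! j))"
        "\<And>j. j < length ts \<Longrightarrow> good (snd (z j))" by metis
      let ?zs = "map z [0..<length ts]"
      have "(q, Node (Inl \<delta>) (map fst ?zs), concat (map snd ?zs)) \<in> set (annotate L gs (Node f ts))"
        unfolding Inl annotate_Inl
        by (rule exI[of _ qs], rule exI[of _ l], rule exI[of _ ?zs]) (use z(1) qs in auto)
      moreover have "good (concat (map snd ?zs))"
        using z(2) by (fastforce simp: good_def)
      ultimately show ?thesis by blast
    next
      case (Inr \<gamma>i)
      obtain \<gamma> i where \<gamma>i: "\<gamma>i = (\<gamma>, i)" by (cases \<gamma>i)
      have \<Lambda>: "(\<gamma>, i) \<in> \<Lambda>" "ts = []" using Node.prems(1) by (simp_all add: Inr \<gamma>i trees_with_Inr)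
      have p: "producible A u L n \<gamma> q (child v i)"
        using Node.prems(2,3) \<Lambda> by (auto simp: producible_def Inr \<gamma>i at_node_Inr)
      then show ?thesis using assms(4)[OF \<Lambda>(1) p] accepts_state[OF Node.prems(3)] \<Lambda>
        unfolding Inr \<gamma>i annotate_Inr by (force simp: good_def)
    qed
  qed
  then show ?thesis unfolding good_def .
qed

text \<open>The label that is guessed at a node $v$ with $k$ children lists attributes of $v$ ($i = 0$) and of
  its children $v.i$ in the order in which they can be evaluated, latest first. In an entry
  \<open>(\<alpha>, i, lv, ro)\<close> for $\alpha(\pi i)$, \<open>ro = [\<xi>]\<close> is the chosen right-hand side and \<open>lv\<close> are its leaves; if
  the rule for $\alpha(\pi i)$ is not a rule at $v$, then \<open>lv\<close> and \<open>ro\<close> are empty.\<close>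

type_synonym entry = "nat \<times> nat \<times> key list \<times> rhs list"

text \<open>With the code of the right-hand side as tag, the attribute on the left determines the
  rule. The successor keeps tag 0 free for all other attributes.\<close>

definition hashes :: "transition list \<Rightarrow> rule list \<Rightarrow> annot list" where
  "hashes L R = concat (map (\<lambda>(x, b, i, \<xi>). if x = None
     then map (\<lambda>(q, \<xi>', lv). (mk_attr b q (Suc (enc \<xi>')), \<xi>', lv)) (annotate L [0] \<xi>) else []) R)"

definition tags :: "transition list \<Rightarrow> rule list \<Rightarrow> nat list" where
  "tags L R = 0 # map (\<lambda>(\<beta>, \<xi>, lv). Suc (enc \<xi>)) (hashes L R)"

text \<open>Left-hand sides carry tag 0: a rule at a node below the marker defines synthesized
  attributes of that node or inherited attributes of its children, and never an inherited attribute
  of the node \<open>[1]\<close>.\<close>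

definition own_entries :: "transition list \<Rightarrow> rule list \<Rightarrow> nat \<Rightarrow> entry list" where
  "own_entries L R \<sigma> = concat (map (\<lambda>(x, \<gamma>, i, \<xi>). if x = Some \<sigma>
     then map (\<lambda>(q, \<xi>', lv). (mk_attr \<gamma> q 0, i, lv, [\<xi>'])) (annotate L (tags L R) \<xi>) else []) R)"

definition syn_attrs :: "transition list \<Rightarrow> nat list \<Rightarrow> nat list" where
  "syn_attrs L S = concat (map (\<lambda>a. map (\<lambda>q. mk_attr a q 0) (states_of L)) S)"

definition inh_attrs :: "transition list \<Rightarrow> rule list \<Rightarrow> nat list \<Rightarrow> nat list" where
  "inh_attrs L R I = concat (map (\<lambda>b. concat (map (\<lambda>q. map (\<lambda>g. mk_attr b q g) (tags L R)) (states_of L))) I)"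

definition entries :: "transition list \<Rightarrow> nat list \<Rightarrow> nat list \<Rightarrow> rule list \<Rightarrow> nat \<Rightarrow> nat \<Rightarrow> entry list" where
  "entries L S I R \<sigma> k = own_entries L R \<sigma>
     @ map (\<lambda>\<alpha>. (\<alpha>, 0, [], [])) (inh_attrs L R I)
     @ concat (map (\<lambda>j. map (\<lambda>\<alpha>. (\<alpha>, Suc j, [], [])) (syn_attrs L S)) [0..<k])"

section \<open>Evaluation orders and their restrictions\<close>

definition key_of :: "entry \<Rightarrow> key" where "key_of e = (fst e, fst (snd e))"

definition addable :: "entry \<Rightarrow> entry list \<Rightarrow> bool" where
  "addable e M \<longleftrightarrow> \<not> key_of e \<in> set (map (\<lambda>e. key_of e) M) \<and>
     (\<forall>l \<in> set (fst (snd (snd e))). l \<in> set (map (\<lambda>e. key_of e) M))"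

definition orders_upto :: "entry list \<Rightarrow> nat \<Rightarrow> entry list list" where
  "orders_upto E n = rec_nat [[]] (\<lambda>_ Ms. [] # concat (map (\<lambda>M.
     map (\<lambda>e. e # M) (filter (\<lambda>e. addable e M) E)) Ms)) n"

definition orders :: "entry list \<Rightarrow> entry list list" where
  "orders E = orders_upto E (length E)"

fun valid :: "entry list \<Rightarrow> entry list \<Rightarrow> bool" where
  "valid E [] \<longleftrightarrow> True"
| "valid E (e # M) \<longleftrightarrow> e \<in> set E \<and> addable e M \<and> valid E M"

lemma set_orders_upto: "set (orders_upto E n) = {M. valid E M \<and> length M \<le> n}"
proof (induction n)
  case (Suc n)
  have "set (orders_upto E (Suc n)) =
      insert [] {e # M | e M. M \<in> set (orders_upto E n) \<and> e \<in> set E \<and> addable e M}"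
    by (auto simp: orders_upto_def)
  then show ?case unfolding Suc by (auto simp: neq_Nil_conv)
qed (auto simp: orders_upto_def)

lemma valid_distinct: "valid E M \<Longrightarrow> distinct (map key_of M) \<and> set M \<subseteq> set E"
  by (induction M) (auto simp: addable_def)

text \<open>Keys do not repeat along a valid list, so its length is at most that of
  \<open>E\<close>, and the bounded enumeration is exhaustive.\<close>

lemma set_orders: "set (orders E) = {M. valid E M}"
proof -
  have "length M \<le> length E" if "valid E M" for M
    using valid_distinct[OF that] by (metis card_length card_mono distinct_card distinct_map finite_set le_trans)
  then show ?thesis by (auto simp: orders_def set_orders_upto)
qed

lemma valid_append: "valid E (M @ M') \<Longrightarrow> valid E M'"
  by (induction M) auto

text \<open>This restricts an order to the attributes of one node: the node itself for
  \<open>i = 0\<close>, its \<open>i\<close>-th child otherwise. Being part of the states, the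
  restrictions seen by a parent and by its child have to coincide.\<close>

definition proj :: "nat \<Rightarrow> entry list \<Rightarrow> nat list" where
  "proj i M = map (\<lambda>e. fst e) (filter (\<lambda>e. fst (snd e) = i) M)"

lemma set_proj: "\<alpha> \<in> set (proj i M) \<longleftrightarrow> (\<alpha>, i) \<in> key_of ` set M"
  by (force simp: proj_def key_of_def)

text \<open>A suffix of the order at one node stands for a moment of the evaluation; it is lifted to
  a moment in the larger order that also involves the children.\<close>

lemma proj_append_conv: "proj i M = w @ w' \<Longrightarrow> \<exists>M1 M'. M = M1 @ M' \<and> proj i M' = w'"
proof (induction M arbitrary: w)
  case (Cons e M)
  show ?case
  proof (cases "w = [] \<or> fst (snd e) \<noteq> i")
    case True
    show ?thesis
    proof (cases "fst (snd e) = i")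
      case True
      then show ?thesis using Cons.prems \<open>w = [] \<or> _\<close> by (intro exI[of _ "[]"] exI[of _ "e # M"]) auto
    next
      case False
      then have "proj i M = w @ w'" using Cons.prems by (simp add: proj_def)
      then show ?thesis using Cons.IH by (metis append_Cons)
    qed
  next
    case False
    then have "proj i M = tl w @ w'" using Cons.prems by (cases w) (auto simp: proj_def)
    then show ?thesis using Cons.IH by (metis append_Cons)
  qed
qed (auto simp: proj_def)

text \<open>The marker has no label that could contain a guessed order. The test at the accepting
  state takes its place: an inherited attribute of the topmost input node must have a marker rule
  that refers to earlier attributes only.\<close>

definition root_step :: "nat list \<Rightarrow> annot list \<Rightarrow> nat \<Rightarrow> nat list \<Rightarrow> bool" where
  "root_step I H \<beta> w \<longleftrightarrow> (base \<beta> \<in> set I \<longrightarrow>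
     (\<exists>h \<in> set H. fst h = \<beta> \<and> (\<forall>l \<in> set (snd (snd h)). fst l \<in> set w)))"

definition root_ok :: "nat list \<Rightarrow> annot list \<Rightarrow> nat list \<Rightarrow> bool" where
  "root_ok I H w = rec_list True (\<lambda>\<beta> w r. r \<and> root_step I H \<beta> w) w"

lemma root_ok_simps [simp]: "root_ok I H []" "root_ok I H (\<beta> # w) \<longleftrightarrow> root_ok I H w \<and> root_step I H \<beta> w"
  by (auto simp: root_ok_def)

text \<open>The successor keeps 0 free for the accepting state.\<close>

definition state :: "nat \<Rightarrow> nat \<Rightarrow> nat list \<Rightarrow> nat" where
  "state p t w = Suc (enc (p, t, w))"

lemma state_eq [simp]: "state p t w = state p' t' w' \<longleftrightarrow> p = p' \<and> t = t' \<and> w = w'"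
  and state_neq [simp]: "state p t w \<noteq> 0" "0 \<noteq> state p t w"
  by (auto simp: state_def)

text \<open>In \<open>mk_attr a0 0 0\<close>, the first 0 is the accepting state of
  \<open>L\<close>, demanded of the whole output, and the second is the tag of synthesized
  attributes.\<close>

definition final_ok :: "nat list \<Rightarrow> nat \<Rightarrow> transition list \<Rightarrow> nat list \<Rightarrow> rule list \<Rightarrow> nat \<Rightarrow>
    nat \<Rightarrow> nat \<Rightarrow> nat list \<Rightarrow> bool" where
  "final_ok F t0 L I R a0 p t w \<longleftrightarrow>
     p \<in> set F \<and> t = t0 \<and> mk_attr a0 0 0 \<in> set w \<and> root_ok I (hashes L R) w"

text \<open>A state consists of a state of the bottom-up relabeling, a state of the top-down relabeling, and
  the evaluation order of the attributes of the node; 0 is the accepting state at the root. Since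
  neighbouring nodes agree on the order of their shared attributes, the local orders exclude circular
  computations globally.\<close>

definition guesses :: "transition list \<Rightarrow> nat list \<Rightarrow> transition list \<Rightarrow> nat \<Rightarrow>
    nat list \<Rightarrow> nat list \<Rightarrow> rule list \<Rightarrow> nat \<Rightarrow> transition list \<Rightarrow> transition list" where
  "guesses Bt F Tt t0 S I R a0 L = concat (map (\<lambda>(\<sigma>, ps, p, \<sigma>1). concat (map (\<lambda>(\<sigma>1', ts, t, \<sigma>2).
     if \<sigma>1' = \<sigma>1 \<and> length ts = length ps then concat (map (\<lambda>M.
       map (\<lambda>n. (\<sigma>, map (\<lambda>j. state (get ps j) (get ts j) (proj (Suc j) M)) [0..<length ps], n, enc (\<sigma>2, M)))
         (state p t (proj 0 M) # (if final_ok F t0 L I R a0 p t (proj 0 M) then [0] else [])))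
       (orders (entries L S I R \<sigma>2 (length ps)))) else []) Tt)) Bt)"

lemma concat_mapI: "a \<in> set xs \<Longrightarrow> x \<in> set (f a) \<Longrightarrow> x \<in> set (concat (map f xs))"
  by auto

lemma guesses_iff:
  "(\<sigma>, ns, n, l) \<in> set (guesses Bt F Tt t0 S I R a0 L) \<longleftrightarrow> (\<exists>ps p \<sigma>1 ts t \<sigma>2 M.
     (\<sigma>, ps, p, \<sigma>1) \<in> set Bt \<and> (\<sigma>1, ts, t, \<sigma>2) \<in> set Tt \<and> length ts = length ps \<and>
     valid (entries L S I R \<sigma>2 (length ps)) M \<and>
     ns = map (\<lambda>j. state (ps ! j) (ts ! j) (proj (Suc j) M)) [0..<length ps] \<and> l = enc (\<sigma>2, M) \<and>
     (n = state p t (proj 0 M) \<or> n = 0 \<and> final_ok F t0 L I R a0 p t (proj 0 M)))" (is "?l \<longleftrightarrow> ?r")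
proof
  assume ?l
  then obtain ps p \<sigma>1 ts t \<sigma>2 M where "(\<sigma>, ps, p, \<sigma>1) \<in> set Bt" "(\<sigma>1, ts, t, \<sigma>2) \<in> set Tt"
    "length ts = length ps" "valid (entries L S I R \<sigma>2 (length ps)) M"
    "ns = map (\<lambda>j. state (get ps j) (get ts j) (proj (Suc j) M)) [0..<length ps]" "l = enc (\<sigma>2, M)"
    "n = state p t (proj 0 M) \<or> n = 0 \<and> final_ok F t0 L I R a0 p t (proj 0 M)"
    unfolding guesses_def by (auto simp: set_orders split: if_splits)
  then show ?r
    by (intro exI[of _ ps] exI[of _ p] exI[of _ \<sigma>1] exI[of _ ts] exI[of _ t] exI[of _ \<sigma>2] exI[of _ M])
      (auto cong: map_cong)
next
  assume ?r
  then obtain ps p \<sigma>1 ts t \<sigma>2 M where 1: "(\<sigma>, ps, p, \<sigma>1) \<in> set Bt" "(\<sigma>1, ts, t, \<sigma>2) \<in> set Tt"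
    "length ts = length ps" "valid (entries L S I R \<sigma>2 (length ps)) M"
    "ns = map (\<lambda>j. state (ps ! j) (ts ! j) (proj (Suc j) M)) [0..<length ps]" "l = enc (\<sigma>2, M)"
    "n = state p t (proj 0 M) \<or> n = 0 \<and> final_ok F t0 L I R a0 p t (proj 0 M)" by blast
  have "ns = map (\<lambda>j. state (get ps j) (get ts j) (proj (Suc j) M)) [0..<length ps]"
    using 1(3,5) by auto
  then have "(\<sigma>, ns, n, l) \<in> set (map (\<lambda>n. (\<sigma>, map (\<lambda>j. state (get ps j) (get ts j) (proj (Suc j) M)) [0..<length ps], n, enc (\<sigma>2, M)))
         (state p t (proj 0 M) # (if final_ok F t0 L I R a0 p t (proj 0 M) then [0] else [])))"
    using 1(6,7) by auto
  moreover have "M \<in> set (orders (entries L S I R \<sigma>2 (length ps)))" using 1(4) by (simp add: set_orders)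
  ultimately show ?l unfolding guesses_def
    by (intro concat_mapI[OF 1(1)], unfold prod.case, intro concat_mapI[OF 1(2)], unfold prod.case)
      (simp only: 1(3) simp_thms if_True, intro concat_mapI)
qed

section \<open>The deterministic att\<close>

definition det_symbols :: "transition list \<Rightarrow> nat list \<Rightarrow> nat list \<Rightarrow> rule list \<Rightarrow> alph \<Rightarrow> (nat \<times> nat \<times> entry list) list" where
  "det_symbols L S I R \<Gamma> = concat (map (\<lambda>(\<sigma>, k). map (\<lambda>M. (\<sigma>, k, M)) (orders (entries L S I R \<sigma> k))) \<Gamma>)"

definition det_alph :: "transition list \<Rightarrow> nat list \<Rightarrow> nat list \<Rightarrow> rule list \<Rightarrow> alph \<Rightarrow> alph" where
  "det_alph L S I R \<Gamma> = map (\<lambda>(\<sigma>, k, M). (enc (\<sigma>, M), k)) (det_symbols L S I R \<Gamma>)"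

definition det_rules :: "transition list \<Rightarrow> nat list \<Rightarrow> nat list \<Rightarrow> rule list \<Rightarrow> alph \<Rightarrow> rule list" where
  "det_rules L S I R \<Gamma> =
     concat (map (\<lambda>(\<sigma>, k, M). concat (map (\<lambda>(\<alpha>, i, lv, ro). map (\<lambda>\<xi>. (Some (enc (\<sigma>, M)), \<alpha>, i, \<xi>)) ro) M))
       (det_symbols L S I R \<Gamma>))
     @ map (\<lambda>(\<beta>, \<xi>, lv). (None, \<beta>, 1, \<xi>)) (hashes L R)"

definition det_att :: "transition list \<Rightarrow> nat list \<Rightarrow> nat list \<Rightarrow> rule list \<Rightarrow> nat \<Rightarrow>
    alph \<Rightarrow> alph \<Rightarrow> att" where
  "det_att L S I R a0 \<Gamma> \<Delta> = \<lparr>syn = set (syn_attrs L S), inh = set (inh_attrs L R I),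
     inalph = set (det_alph L S I R \<Gamma>), outalph = set \<Delta>, init = mk_attr a0 0 0, rules = set (det_rules L S I R \<Gamma>)\<rparr>"

lemma set_det_symbols: "(\<sigma>, k, M) \<in> set (det_symbols L S I R \<Gamma>) \<longleftrightarrow>
    (\<sigma>, k) \<in> set \<Gamma> \<and> valid (entries L S I R \<sigma> k) M"
  by (auto simp: det_symbols_def set_orders)

lemma set_det_alph: "(x, k) \<in> set (det_alph L S I R \<Gamma>) \<longleftrightarrow>
    (\<exists>\<sigma> M. x = enc (\<sigma>, M) \<and> (\<sigma>, k) \<in> set \<Gamma> \<and> valid (entries L S I R \<sigma> k) M)"
proof
  assume "\<exists>\<sigma> M. x = enc (\<sigma>, M) \<and> (\<sigma>, k) \<in> set \<Gamma> \<and> valid (entries L S I R \<sigma> k) M"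
  then obtain \<sigma> M where "x = enc (\<sigma>, M)" "(\<sigma>, k, M) \<in> set (det_symbols L S I R \<Gamma>)"
    by (auto simp: set_det_symbols)
  then show "(x, k) \<in> set (det_alph L S I R \<Gamma>)" by (force simp: det_alph_def)
qed (auto simp: det_alph_def set_det_symbols)

lemma set_det_rules: "(x, \<alpha>, i, \<xi>) \<in> set (det_rules L S I R \<Gamma>) \<longleftrightarrow>
    (\<exists>\<sigma> k M lv ro. x = Some (enc (\<sigma>, M)) \<and> (\<sigma>, k) \<in> set \<Gamma> \<and> valid (entries L S I R \<sigma> k) M \<and>
       (\<alpha>, i, lv, ro) \<in> set M \<and> \<xi> \<in> set ro) \<or>
    x = None \<and> i = 1 \<and> (\<exists>lv. (\<alpha>, \<xi>, lv) \<in> set (hashes L R))"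
proof -
  have "(x, \<alpha>, i, \<xi>) \<in> set (map (\<lambda>(\<beta>, \<xi>, lv). (None, \<beta>, 1, \<xi>)) (hashes L R)) \<longleftrightarrow>
      x = None \<and> i = 1 \<and> (\<exists>lv. (\<alpha>, \<xi>, lv) \<in> set (hashes L R))" by force
  moreover have "(x, \<alpha>, i, \<xi>) \<in> set (concat (map (\<lambda>(\<sigma>, k, M). concat (map (\<lambda>(\<alpha>, i, lv, ro).
        map (\<lambda>\<xi>. (Some (enc (\<sigma>, M)), \<alpha>, i, \<xi>)) ro) M)) (det_symbols L S I R \<Gamma>))) \<longleftrightarrow>
      (\<exists>\<sigma> k M lv ro. x = Some (enc (\<sigma>, M)) \<and> (\<sigma>, k) \<in> set \<Gamma> \<and> valid (entries L S I R \<sigma> k) M \<and>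
       (\<alpha>, i, lv, ro) \<in> set M \<and> \<xi> \<in> set ro)" (is "?l \<longleftrightarrow> ?r")
  proof
    assume ?r
    then obtain \<sigma> k M lv ro where 1: "x = Some (enc (\<sigma>, M))" "(\<sigma>, k, M) \<in> set (det_symbols L S I R \<Gamma>)"
       "(\<alpha>, i, lv, ro) \<in> set M" "\<xi> \<in> set ro" by (auto simp: set_det_symbols)
    show ?l
      by (rule concat_mapI[OF 1(2)], unfold prod.case, rule concat_mapI[OF 1(3)]) (use 1 in auto)
  next
    assume ?l
    then obtain \<sigma> k M lv ro where "x = Some (enc (\<sigma>, M))" "(\<sigma>, k, M) \<in> set (det_symbols L S I R \<Gamma>)"
       "(\<alpha>, i, lv, ro) \<in> set M" "\<xi> \<in> set ro" by auto
    then show ?r unfolding set_det_symbols by blast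
  qed
  ultimately show ?thesis unfolding det_rules_def set_append Un_iff by blast
qed

lemma set_hashes: "(\<beta>, \<xi>', lv) \<in> set (hashes L R) \<longleftrightarrow> (\<exists>b i \<xi> q. (None, b, i, \<xi>) \<in> set R \<and>
    \<beta> = mk_attr b q (Suc (enc \<xi>')) \<and> (q, \<xi>', lv) \<in> set (annotate L [0] \<xi>))"
  (is "?l \<longleftrightarrow> ?r")
proof
  assume ?r
  then show ?l unfolding hashes_def
    by (elim exE conjE) (erule concat_mapI, force)
next
  assume ?l
  then show ?r unfolding hashes_def by (auto split: if_splits)
qed

lemma set_own_entries: "(\<alpha>, i, lv, ro) \<in> set (own_entries L R \<sigma>) \<longleftrightarrow> (\<exists>\<gamma> \<xi> q \<xi>'. (Some \<sigma>, \<gamma>, i, \<xi>) \<in> set R \<and>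
    \<alpha> = mk_attr \<gamma> q 0 \<and> ro = [\<xi>'] \<and> (q, \<xi>', lv) \<in> set (annotate L (tags L R) \<xi>))"
  (is "?l \<longleftrightarrow> ?r")
proof
  assume ?r
  then show ?l unfolding own_entries_def
    by (elim exE conjE) (erule concat_mapI, force)
next
  assume ?l
  then show ?r unfolding own_entries_def by (auto split: if_splits)
qed

lemma set_tags: "g \<in> set (tags L R) \<longleftrightarrow> g = 0 \<or> (\<exists>\<beta> \<xi> lv. (\<beta>, \<xi>, lv) \<in> set (hashes L R) \<and> g = Suc (enc \<xi>))"
  by (force simp: tags_def)

lemma set_syn_attrs: "\<alpha> \<in> set (syn_attrs L S) \<longleftrightarrow> (\<exists>a q. a \<in> set S \<and> q \<in> set (states_of L) \<and> \<alpha> = mk_attr a q 0)"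
  by (auto simp: syn_attrs_def)

lemma set_inh_attrs: "\<beta> \<in> set (inh_attrs L R I) \<longleftrightarrow>
   (\<exists>b q g. b \<in> set I \<and> q \<in> set (states_of L) \<and> g \<in> set (tags L R) \<and> \<beta> = mk_attr b q g)"
  by (auto simp: inh_attrs_def)

lemma set_entries: "(\<alpha>, i, lv, ro) \<in> set (entries L S I R \<sigma> k) \<longleftrightarrow>
    (\<alpha>, i, lv, ro) \<in> set (own_entries L R \<sigma>) \<or>
    i = 0 \<and> \<alpha> \<in> set (inh_attrs L R I) \<and> lv = [] \<and> ro = [] \<or>
    1 \<le> i \<and> i \<le> k \<and> \<alpha> \<in> set (syn_attrs L S) \<and> lv = [] \<and> ro = []"
proof -
  have "(\<alpha>, i, lv, ro) \<in> set (concat (map (\<lambda>j. map (\<lambda>\<alpha>. (\<alpha>, Suc j, [], [])) (syn_attrs L S)) [0..<k])) \<longleftrightarrow>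
      1 \<le> i \<and> i \<le> k \<and> \<alpha> \<in> set (syn_attrs L S) \<and> lv = [] \<and> ro = []"
    by (cases i) auto
  then show ?thesis unfolding entries_def by auto
qed

lemma annotate_state: "(q, \<xi>', lv) \<in> set (annotate L gs \<xi>) \<Longrightarrow> q \<in> set (states_of L)"
proof (cases \<xi>)
  case (Node f ts)
  assume a: "(q, \<xi>', lv) \<in> set (annotate L gs \<xi>)"
  show ?thesis
  proof (cases f)
    case (Inl \<delta>)
    then obtain qs l where "(\<delta>, qs, q, l) \<in> set L" using a unfolding Node Inl annotate_Inl by blast
    then show ?thesis by (force simp: set_states_of)
  next
    case (Inr x)
    then show ?thesis using a unfolding Node Inr by (cases x) (auto simp: annotate_Inr)
  qed
qed

lemma strip_at_node: "strip (at_node \<xi> v) = at_node (strip \<xi>) v"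
proof -
  have "map_sum id (\<lambda>(\<alpha>, x). (base \<alpha>, x)) (map_sum id (\<lambda>(\<gamma>, i). (\<gamma>, child v i)) l) =
    map_sum id (\<lambda>(\<gamma>, i). (\<gamma>, child v i)) (map_sum id (\<lambda>(\<alpha>, x). (base \<alpha>, x)) l)" for l :: "nat + key"
    by (cases l) auto
  then show ?thesis by (simp add: strip_def at_node_def tree.map_comp o_def)
qed

lemma typed_at_node: "typed L \<xi> q \<Longrightarrow> typed L (at_node \<xi> v) q"
proof (induction rule: typed.induct)
  case (1 \<alpha> x)
  then show ?case by (simp add: at_node_Inr typed.intros)
next
  case (2 \<delta> qs q l ts)
  then show ?case unfolding at_node_Inl by (intro typed.intros(2)) auto
qed

lemma typed_Inl: "typed L (Node (Inl \<delta>) ts) q \<longleftrightarrow> (\<exists>qs l. (\<delta>, qs, q, l) \<in> set L \<and>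
    length ts = length qs \<and> (\<forall>j < length qs. typed L (ts ! j) (qs ! j)))"
  by (subst typed.simps) auto

lemma typed_Inr: "typed L (Node (Inr (\<alpha>, x)) ts) q \<longleftrightarrow> ts = [] \<and> q = target \<alpha>"
  by (subst typed.simps) auto

lemma mark_map: "mark (map_tree f s) = map_tree (map_option f) (mark s)"
  by (simp add: mark_def tree.map_comp o_def)

section \<open>Soundness: from guesses back to the original att\<close>

locale guess =
  fixes A :: att and S I :: "nat list" and R :: "rule list" and \<Gamma> \<Delta> :: "alph"
    and L :: "transition list" and Bt Tt :: "transition list" and F :: "nat list" and t0 :: nat
  assumes A: "is_att A" and S: "set S = syn A" and I: "set I = inh A" and R: "set R = rules A"
    and \<Gamma>: "set \<Gamma> = inalph A" and \<Delta>: "set \<Delta> = outalph A"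
    and Tt: "\<And>\<sigma> ts t \<sigma>'. (\<sigma>, ts, t, \<sigma>') \<in> set Tt \<Longrightarrow> (\<sigma>', length ts) \<in> set \<Gamma>"
begin

abbreviation "D \<equiv> det_att L S I R (init A) \<Gamma> \<Delta>"
abbreviation "N \<equiv> guesses Bt F Tt t0 S I R (init A) L"
abbreviation "E \<equiv> entries L S I R"
abbreviation "H \<equiv> hashes L R"
abbreviation "SA \<equiv> set (syn_attrs L S)"
abbreviation "IA \<equiv> set (inh_attrs L R I)"

lemma S_I_disjoint: "a \<in> set S \<Longrightarrow> a \<notin> set I"
  using A S I by (auto simp: is_att_def)

lemma single_valued_\<Gamma>: "(\<sigma>, k) \<in> set \<Gamma> \<Longrightarrow> (\<sigma>, k') \<in> set \<Gamma> \<Longrightarrow> k = k'"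
  using A \<Gamma> by (auto simp: is_att_def ranked_alphabet_def dest: single_valuedD)

lemma rule_Some:
  assumes "(Some \<sigma>, \<gamma>, i, \<xi>) \<in> set R" "(\<sigma>, k) \<in> set \<Gamma>"
  shows "\<gamma> \<in> set S \<and> i = 0 \<or> \<gamma> \<in> set I \<and> 1 \<le> i \<and> i \<le> k"
    and "\<xi> \<in> trees_with (set \<Delta>) (set S \<times> {1..k} \<union> set I \<times> {0})"
proof -
  have "att_rule_ok A (Some \<sigma>, \<gamma>, i, \<xi>)" using A assms R unfolding is_att_def by blast
  then obtain k' where "(\<sigma>, k') \<in> set \<Gamma>" "\<gamma> \<in> set S \<and> i = 0 \<or> \<gamma> \<in> set I \<and> 1 \<le> i \<and> i \<le> k'"
    "\<xi> \<in> trees_with (set \<Delta>) (set S \<times> {1..k'} \<union> set I \<times> {0})"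
    by (auto simp: att_rule_ok_def S I \<Gamma> \<Delta>)
  moreover have "k' = k" using calculation(1) assms(2) single_valued_\<Gamma> by blast
  ultimately show "\<gamma> \<in> set S \<and> i = 0 \<or> \<gamma> \<in> set I \<and> 1 \<le> i \<and> i \<le> k"
    and "\<xi> \<in> trees_with (set \<Delta>) (set S \<times> {1..k} \<union> set I \<times> {0})" by auto
qed

lemma rule_None:
  assumes "(None, b, i, \<xi>) \<in> set R"
  shows "b \<in> set I" "i = 1" "\<xi> \<in> trees_with (set \<Delta>) (set S \<times> {1})"
proof -
  have "att_rule_ok A (None, b, i, \<xi>)" using A assms R unfolding is_att_def by blast
  then show "b \<in> set I" "i = 1" "\<xi> \<in> trees_with (set \<Delta>) (set S \<times> {1})"
    by (auto simp: att_rule_ok_def S I \<Delta>)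
qed

lemma own_entry:
  assumes e: "(\<alpha>, i, lv, ro) \<in> set (E \<sigma> k)" and k: "(\<sigma>, k) \<in> set \<Gamma>" and \<xi>': "\<xi>' \<in> set ro"
  shows "(Some \<sigma>, base \<alpha>, i, strip \<xi>') \<in> rules A" "typed L \<xi>' (target \<alpha>)"
    "\<xi>' \<in> trees_with (set \<Delta>) (set lv)" "set lv \<subseteq> SA \<times> {1..k} \<union> IA \<times> {0}"
    "\<alpha> \<in> SA \<and> i = 0 \<or> \<alpha> \<in> IA \<and> 1 \<le> i \<and> i \<le> k"
proof -
  obtain \<gamma> \<xi> q where 1: "(Some \<sigma>, \<gamma>, i, \<xi>) \<in> set R" "\<alpha> = mk_attr \<gamma> q 0"
     "(q, \<xi>', lv) \<in> set (annotate L (tags L R) \<xi>)"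
    using e \<xi>' by (auto simp: set_entries set_own_entries)
  note r = rule_Some[OF 1(1) k]
  note s = annotate_sound[OF r(2) 1(3)]
  show "(Some \<sigma>, base \<alpha>, i, strip \<xi>') \<in> rules A" "typed L \<xi>' (target \<alpha>)"
    "\<xi>' \<in> trees_with (set \<Delta>) (set lv)" using s 1 R by auto
  show "\<alpha> \<in> SA \<and> i = 0 \<or> \<alpha> \<in> IA \<and> 1 \<le> i \<and> i \<le> k"
    using r(1) annotate_state[OF 1(3)] 1(2) unfolding set_syn_attrs set_inh_attrs set_tags by blast
  show "set lv \<subseteq> SA \<times> {1..k} \<union> IA \<times> {0}"
  proof
    fix l assume "l \<in> set lv"
    moreover obtain \<beta> j where l: "l = (\<beta>, j)" by (cases l)
    ultimately obtain \<gamma> q g where "\<beta> = mk_attr \<gamma> q g" "(\<gamma>, j) \<in> set S \<times> {1..k} \<union> set I \<times> {0}"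
      "q \<in> set (states_of L)" "g \<in> set (if j = 0 then tags L R else [0])" using s by blast
    then show "l \<in> SA \<times> {1..k} \<union> IA \<times> {0}"
      unfolding l by (cases "j = 0") (auto simp: set_syn_attrs set_inh_attrs)
  qed
qed

lemma hash:
  assumes "(\<beta>, \<xi>', lv) \<in> set H"
  shows "(None, base \<beta>, 1, strip \<xi>') \<in> rules A" "typed L \<xi>' (target \<beta>)"
    "\<xi>' \<in> trees_with (set \<Delta>) (set lv)" "set lv \<subseteq> SA \<times> {1}" "\<beta> \<in> IA"
proof -
  obtain b i \<xi> q where 1: "(None, b, i, \<xi>) \<in> set R" "\<beta> = mk_attr b q (Suc (enc \<xi>'))"
     "(q, \<xi>', lv) \<in> set (annotate L [0] \<xi>)" using assms unfolding set_hashes by blast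
  note r = rule_None[OF 1(1)]
  note s = annotate_sound[OF r(3) 1(3)]
  show "(None, base \<beta>, 1, strip \<xi>') \<in> rules A" "typed L \<xi>' (target \<beta>)"
    "\<xi>' \<in> trees_with (set \<Delta>) (set lv)" using s 1 r R by auto
  have "Suc (enc \<xi>') \<in> set (tags L R)" using assms unfolding set_tags by blast
  then show "\<beta> \<in> IA" using r(1) annotate_state[OF 1(3)] 1(2) unfolding set_inh_attrs by blast
  show "set lv \<subseteq> SA \<times> {1}"
  proof
    fix l assume "l \<in> set lv"
    moreover obtain \<beta> j where l: "l = (\<beta>, j)" by (cases l)
    ultimately obtain \<gamma> q g where "\<beta> = mk_attr \<gamma> q g" "(\<gamma>, j) \<in> set S \<times> {1}"
      "q \<in> set (states_of L)" "g \<in> set (if j = 0 then [0] else [0])" using s by blast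
    then show "l \<in> SA \<times> {1}" unfolding l by (auto simp: set_syn_attrs)
  qed
qed

lemma det_rule_Some:
  assumes "(Some l, \<alpha>, i, \<xi>') \<in> rules D"
  obtains \<sigma> k M lv ro where "l = enc (\<sigma>, M)" "(\<sigma>, k) \<in> set \<Gamma>" "valid (E \<sigma> k) M"
    "(\<alpha>, i, lv, ro) \<in> set M" "(\<alpha>, i, lv, ro) \<in> set (E \<sigma> k)" "\<xi>' \<in> set ro"
proof -
  obtain \<sigma> k M lv ro where "l = enc (\<sigma>, M)" "(\<sigma>, k) \<in> set \<Gamma>" "valid (E \<sigma> k) M"
    "(\<alpha>, i, lv, ro) \<in> set M" "\<xi>' \<in> set ro" using assms by (auto simp: det_att_def set_det_rules)
  moreover have "(\<alpha>, i, lv, ro) \<in> set (E \<sigma> k)" using valid_distinct[OF calculation(3)] calculation(4) by blast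
  ultimately show ?thesis using that by blast
qed

lemma det_rule_None:
  assumes "(None, \<beta>, i, \<xi>') \<in> rules D"
  obtains lv where "(\<beta>, \<xi>', lv) \<in> set H" "i = 1"
  using assms by (auto simp: det_att_def set_det_rules)

lemma single_right: "ro = [] \<or> (\<exists>\<xi>. ro = [\<xi>])" if "(\<alpha>, i, lv, ro) \<in> set (E \<sigma> k)"
  using that by (auto simp: set_entries set_own_entries)

text \<open>At an input symbol, the distinct keys of the guessed order leave at most one entry per
  left-hand side. At the marker, the tag of the attribute already contains the right-hand
  side.\<close>

lemma det_deterministic: "deterministic D"
  unfolding deterministic_def
proof (intro allI impI, elim conjE)
  fix x \<alpha> i \<xi> \<xi>' assume 1: "(x, \<alpha>, i, \<xi>) \<in> rules D" "(x, \<alpha>, i, \<xi>') \<in> rules D"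
  show "\<xi> = \<xi>'"
  proof (cases x)
    case None
    obtain lv lv' where "(\<alpha>, \<xi>, lv) \<in> set H" "(\<alpha>, \<xi>', lv') \<in> set H"
      using 1 unfolding None by (auto elim!: det_rule_None)
    then show ?thesis by (auto simp: set_hashes)
  next
    case (Some l)
    from 1(1)[unfolded Some] obtain \<sigma> k M lv ro where a: "l = enc (\<sigma>, M)" "(\<sigma>, k) \<in> set \<Gamma>" "valid (E \<sigma> k) M"
      "(\<alpha>, i, lv, ro) \<in> set M" "(\<alpha>, i, lv, ro) \<in> set (E \<sigma> k)" "\<xi> \<in> set ro" by (rule det_rule_Some)
    from 1(2)[unfolded Some] obtain \<sigma>' k' M' lv' ro' where b: "l = enc (\<sigma>' :: nat, M' :: entry list)"
      "(\<alpha>, i, lv', ro') \<in> set M'" "\<xi>' \<in> set ro'" by (rule det_rule_Some)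
    have "M' = M" using a b by simp
    moreover have "inj_on key_of (set M)" using valid_distinct[OF a(3)] by (simp add: distinct_map)
    ultimately have "(\<alpha>, i, lv, ro) = (\<alpha>, i, lv', ro')"
      using a(4) b(2) by (elim inj_onD) (auto simp: key_of_def)
    then show ?thesis using single_right[OF a(5)] a(6) b(3) by auto
  qed
qed

lemma det_is_att: "is_att D"
proof -
  have "SA \<inter> IA = {}" using S_I_disjoint by (auto simp: set_syn_attrs set_inh_attrs)
  moreover have "ranked_alphabet (set (det_alph L S I R \<Gamma>))"
    using single_valued_\<Gamma> by (auto simp: ranked_alphabet_def single_valued_def set_det_alph)
  moreover have "mk_attr (init A) 0 0 \<in> SA"
    using A S by (auto simp: set_syn_attrs is_att_def set_states_of)
  moreover have "ranked_alphabet (set \<Delta>)" using A \<Delta> by (simp add: is_att_def)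
  moreover have "att_rule_ok D (x, \<alpha>, i, \<xi>)" if r: "(x, \<alpha>, i, \<xi>) \<in> rules D" for x \<alpha> i \<xi>
  proof (cases x)
    case None
    then obtain lv where "(\<alpha>, \<xi>, lv) \<in> set H" "i = 1" using r by (auto elim: det_rule_None)
    then show ?thesis using hash[of \<alpha> \<xi> lv] trees_with_mono
      by (auto simp: None att_rule_ok_def det_att_def)
  next
    case (Some l)
    from r[unfolded Some] obtain \<sigma> k M lv ro where a: "l = enc (\<sigma>, M)" "(\<sigma>, k) \<in> set \<Gamma>" "valid (E \<sigma> k) M"
      "(\<alpha>, i, lv, ro) \<in> set (E \<sigma> k)" "\<xi> \<in> set ro" by (rule det_rule_Some)
    note o = own_entry[OF a(4) a(2) a(5)]
    have "(l, k) \<in> inalph D" using a by (auto simp: det_att_def set_det_alph)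
    moreover have "\<xi> \<in> trees_with (set \<Delta>) (SA \<times> {1..k} \<union> IA \<times> {0})" using o trees_with_mono by blast
    ultimately show ?thesis using o(5) by (auto simp: Some att_rule_ok_def) (auto simp: det_att_def)
  qed
  ultimately show ?thesis by (auto simp: is_att_def) (auto simp: det_att_def)
qed

definition symbol :: "nat \<Rightarrow> nat" where "symbol l = fst (prod_decode l)"

lemma symbol_enc [simp]: "symbol (enc (\<sigma> :: nat, M :: entry list)) = \<sigma>"
  by (simp add: symbol_def enc_prod_def)

lemma det_rule_sound:
  assumes "(x, \<alpha>, i, \<xi>') \<in> rules D"
  shows "(map_option symbol x, base \<alpha>, i, strip \<xi>') \<in> rules A" "typed L \<xi>' (target \<alpha>)"
proof -
  have "(map_option symbol x, base \<alpha>, i, strip \<xi>') \<in> rules A \<and> typed L \<xi>' (target \<alpha>)"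
  proof (cases x)
    case None
    then obtain lv where "(\<alpha>, \<xi>', lv) \<in> set H" "i = 1" using assms by (auto elim: det_rule_None)
    then show ?thesis using hash[of \<alpha> \<xi>' lv] None by auto
  next
    case (Some l)
    from assms[unfolded Some] obtain \<sigma> k M lv ro where a: "l = enc (\<sigma>, M :: entry list)" "(\<sigma>, k) \<in> set \<Gamma>"
      "(\<alpha>, i, lv, ro) \<in> set (E \<sigma> k)" "\<xi>' \<in> set ro" by (rule det_rule_Some)
    show ?thesis using own_entry[OF a(3,2,4)] a(1) Some by simp
  qed
  then show "(map_option symbol x, base \<alpha>, i, strip \<xi>') \<in> rules A" "typed L \<xi>' (target \<alpha>)" by auto
qed

text \<open>Forgetting states, tags and guesses maps each rule of \<open>D\<close> to a rule of
  \<open>A\<close>, hence evaluations to evaluations. Meanwhile the local runs of \<open>L\<close>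
  on right-hand sides fit together at the attribute leaves.\<close>

lemma det_eval_sound:
  assumes "eval D (mark s') n sf t"
  shows "eval A (mark (map_tree symbol s')) n (strip sf) t" "typed L sf q \<Longrightarrow> accepts L t q"
proof -
  have "eval A (mark (map_tree symbol s')) n (strip sf) t \<and> (\<forall>q. typed L sf q \<longrightarrow> accepts L t q)"
    using assms
  proof (induction rule: eval.induct)
    case (eval_attr v x \<alpha> i \<xi> n t)
    note r = det_rule_sound[OF eval_attr(2)]
    have "eval A (mark (map_tree symbol s')) (Suc n) (Node (Inr (base \<alpha>, child v i)) []) t"
    proof (rule eval.eval_attr[OF _ r(1)])
      show "label_at (mark (map_tree symbol s')) v = Some (map_option symbol x)"
        using eval_attr(1) by (simp add: mark_map label_at_map)
      show "eval A (mark (map_tree symbol s')) n (at_node (strip \<xi>) v) t"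
        using eval_attr.IH by (simp add: strip_at_node)
    qed
    moreover have "accepts L t (target \<alpha>)" using eval_attr.IH typed_at_node[OF r(2)] by blast
    ultimately show ?case by (auto simp: strip_def typed_Inr)
  next
    case (eval_out ts' ts n \<delta>)
    have "eval A (mark (map_tree symbol s')) n (strip (Node (Inl \<delta>) ts)) (Node \<delta> ts')"
      using eval_out unfolding strip_def by (auto intro!: eval.eval_out)
    moreover have "accepts L (Node \<delta> ts') q" if "typed L (Node (Inl \<delta>) ts) q" for q
      using that eval_out unfolding typed_Inl accepts_Node by metis
    ultimately show ?case by blast
  qed
  then show "eval A (mark (map_tree symbol s')) n (strip sf) t" "typed L sf q \<Longrightarrow> accepts L t q" by auto
qed

text \<open>States are products, so a run splits into runs of the two relabelings. The intermediate
  tree \<open>s1\<close> does not appear in the labels and is rebuilt from the transitions.\<close>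

lemma run_guess_sound:
  "run (set N) s (state p t w) s' \<Longrightarrow> \<exists>s1. run (set Bt) s p s1 \<and> run (set Tt) s1 t (map_tree symbol s')"
proof (induction s arbitrary: p t w s')
  case (Node \<sigma> ss)
  then obtain ns l ss' where 1: "s' = Node l ss'" "(\<sigma>, ns, state p t w, l) \<in> set N" "length ss = length ns"
    "length ss' = length ns" "\<And>j. j < length ns \<Longrightarrow> run (set N) (ss ! j) (ns ! j) (ss' ! j)"
    by (auto simp: run_Node)
  from 1(2) obtain ps \<sigma>1 ts \<sigma>2 M where 2: "(\<sigma>, ps, p, \<sigma>1) \<in> set Bt" "(\<sigma>1, ts, t, \<sigma>2) \<in> set Tt"
    "length ts = length ps" "ns = map (\<lambda>j. state (ps ! j) (ts ! j) (proj (Suc j) M)) [0..<length ps]" "l = enc (\<sigma>2, M)"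
    unfolding guesses_iff by auto
  have len: "length ns = length ps" using 2(4) by simp
  have "\<forall>j. \<exists>s1. j < length ps \<longrightarrow> run (set Bt) (ss ! j) (ps ! j) s1 \<and> run (set Tt) s1 (ts ! j) (map_tree symbol (ss' ! j))"
    using Node.IH 1(3,5) 2(4) len by (metis (no_types, lifting) add_0 diff_zero nth_map_upt nth_mem)
  from choice[OF this] obtain f where
    f: "\<And>j. j < length ps \<Longrightarrow> run (set Bt) (ss ! j) (ps ! j) (f j) \<and> run (set Tt) (f j) (ts ! j) (map_tree symbol (ss' ! j))"
    by blast
  have "run (set Bt) (Node \<sigma> ss) p (Node \<sigma>1 (map f [0..<length ps]))"
    unfolding run_Node using 1 2 f len by (auto intro!: exI[of _ ps])
  moreover have "run (set Tt) (Node \<sigma>1 (map f [0..<length ps])) t (map_tree symbol s')"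
    unfolding run_Node using 1 2 f len by (auto intro!: exI[of _ ts])
  ultimately show ?case by blast
qed

text \<open>Every transition into 0 duplicates one into a state that satisfies
  \<open>final_ok\<close>, with the same children and the same label.\<close>

lemma run_guess_final:
  "run (set N) s 0 s' \<longleftrightarrow> (\<exists>p t w. run (set N) s (state p t w) s' \<and> final_ok F t0 L I R (init A) p t w)"
proof (cases s)
  case (Node \<sigma> ss)
  have "(\<sigma>, ns, 0, l) \<in> set N \<longleftrightarrow> (\<exists>p t w. (\<sigma>, ns, state p t w, l) \<in> set N \<and> final_ok F t0 L I R (init A) p t w)" for ns l
    unfolding guesses_iff by (simp, blast)
  note trans = this
  show ?thesis
  proof
    assume "run (set N) s 0 s'"
    then obtain ns l ss' where 1: "s' = Node l ss'" "(\<sigma>, ns, 0, l) \<in> set N" "length ss = length ns"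
      "length ss' = length ns" "\<forall>j < length ns. run (set N) (ss ! j) (ns ! j) (ss' ! j)"
      unfolding Node by (auto simp: run_Node)
    obtain p t w where 2: "(\<sigma>, ns, state p t w, l) \<in> set N" "final_ok F t0 L I R (init A) p t w"
      using 1(2) trans by blast
    have "run (set N) s (state p t w) s'" unfolding Node 1(1) run_Node using 1 2(1) by blast
    then show "\<exists>p t w. run (set N) s (state p t w) s' \<and> final_ok F t0 L I R (init A) p t w"
      using 2(2) by blast
  next
    assume "\<exists>p t w. run (set N) s (state p t w) s' \<and> final_ok F t0 L I R (init A) p t w"
    then obtain p t w where 2: "run (set N) s (state p t w) s'" "final_ok F t0 L I R (init A) p t w" by blast
    from 2(1) obtain ns l ss' where 1: "s' = Node l ss'" "(\<sigma>, ns, state p t w, l) \<in> set N"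
      "length ss = length ns" "length ss' = length ns" "\<forall>j < length ns. run (set N) (ss ! j) (ns ! j) (ss' ! j)"
      unfolding Node by (auto simp: run_Node)
    have "(\<sigma>, ns, 0, l) \<in> set N" using 1(2) 2(2) trans by blast
    then show "run (set N) s 0 s'" unfolding Node 1(1) run_Node using 1 by blast
  qed
qed

end

section \<open>Sorting by rank\<close>

lemma sort_key_map_Pair:
  "sort_key g (map (\<lambda>\<alpha>. (\<alpha>, i)) ys) = map (\<lambda>\<alpha>. (\<alpha>, i)) (sort_key (\<lambda>\<alpha>. g (\<alpha>, i)) ys)"
proof (induction ys)
  case (Cons y ys)
  have "insort_key g (y, i) (map (\<lambda>\<alpha>. (\<alpha>, i)) zs) = map (\<lambda>\<alpha>. (\<alpha>, i)) (insort_key (\<lambda>\<alpha>. g (\<alpha>, i)) y zs)" for zs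
    by (induction zs) auto
  then show ?case using Cons by simp
qed simp

lemma filter_snd_concat:
  "filter (\<lambda>x. snd x = i) (concat (map (\<lambda>i. map (\<lambda>\<alpha>. (\<alpha>, i)) (en i)) [0..<k])) =
    (if i < k then map (\<lambda>\<alpha>. (\<alpha>, i)) (en i) else [])"
proof (induction k)
  case (Suc k)
  have "filter (\<lambda>x. snd x = i) (map (\<lambda>\<alpha>. (\<alpha>, k)) (en k)) = (if i = k then map (\<lambda>\<alpha>. (\<alpha>, i)) (en i) else [])"
    by (auto simp: filter_map o_def)
  then show ?case using Suc by auto
qed simp

text \<open>The measure \<open>f\<close> decreases strictly along references, so ties do no harm:
  every referenced key precedes its user in any sorted list. The reversal reflects that orders list
  the latest entry first.\<close>

lemma valid_sorted:
  fixes f :: "key \<Rightarrow> nat" and e :: "key \<Rightarrow> entry"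
  assumes "sorted (map f xs)" "distinct xs" "\<And>x. x \<in> set xs \<Longrightarrow> e x \<in> set E \<and> key_of (e x) = x"
    "\<And>x l. x \<in> set xs \<Longrightarrow> l \<in> set (fst (snd (snd (e x)))) \<Longrightarrow> l \<in> set xs \<and> f l < f x"
  shows "valid E (rev (map e xs))"
proof -
  have "valid E (rev (map e ys))" if "xs = ys @ zs" for ys zs
    using that
  proof (induction ys arbitrary: zs rule: rev_induct)
    case (snoc y ys)
    have keys: "map key_of (rev (map e ys)) = rev ys"
      using snoc.prems assms(3) by (auto simp: rev_map[symmetric] intro!: map_idI)
    have "l \<in> set ys" if "l \<in> set (fst (snd (snd (e y))))" for l
    proof -
      have "l \<in> set xs" "f l < f y" using assms(4)[of y l] that snoc.prems by auto
      moreover have "f y \<le> f z" if "z \<in> set (y # zs)" for z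
        using that assms(1) snoc.prems by (auto simp: sorted_append)
      ultimately have "l \<notin> set (y # zs)" by (meson leD)
      then show ?thesis using \<open>l \<in> set xs\<close> snoc.prems by auto
    qed
    then have "addable (e y) (rev (map e ys))"
      using snoc.prems assms(2,3) unfolding addable_def keys by auto
    then show ?case using snoc assms(3) by auto
  qed simp
  from this[of xs "[]"] show ?thesis by simp
qed

lemma rev_sorted_before:
  fixes f :: "'a \<Rightarrow> nat"
  assumes "sorted (map f xs)" "rev xs = w1 @ \<beta> # w2" "y \<in> set xs" "f y < f \<beta>"
  shows "y \<in> set w2"
proof -
  have "xs = rev w2 @ \<beta> # rev w1" using assms(2) by (metis append.assoc append_Cons append_Nil rev_append rev_rev_ident rev.simps(2))
  then show ?thesis using assms(1,3,4) by (auto simp: sorted_append not_less[symmetric])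
qed

lemma root_ok_decomp:
  "(\<And>w1 \<beta> w2. w = w1 @ \<beta> # w2 \<Longrightarrow> root_step I H \<beta> w2) \<Longrightarrow> root_ok I H w"
proof (induction w)
  case (Cons \<beta> w)
  have "root_step I H \<beta> w" using Cons.prems[of "[]"] by simp
  moreover have "root_ok I H w" using Cons.IH Cons.prems by (metis append_Cons)
  ultimately show ?case by simp
qed simp

section \<open>Guessed orders exclude circularity\<close>

context guess
begin

definition derives :: "nat option tree \<Rightarrow> nat \<Rightarrow> node \<Rightarrow> bool" where
  "derives u \<beta> v \<longleftrightarrow> (\<exists>n t. eval D u n (Node (Inr (\<beta>, v)) []) t)"

lemma eval_rhs_total:
  assumes "\<xi> \<in> trees_with \<Delta>' \<Lambda>" "\<And>\<alpha> i. (\<alpha>, i) \<in> \<Lambda> \<Longrightarrow> derives u \<alpha> (child v i)"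
  shows "\<exists>n t. eval D u n (at_node \<xi> v) t"
  using assms(1)
proof (induction \<xi> rule: tree.induct)
  case (Node f ts)
  show ?case
  proof (cases f)
    case (Inl \<delta>)
    have "\<exists>n t. eval D u n (at_node (ts ! j) v) t" if "j < length ts" for j
      using Node.IH[of "ts ! j"] Node.prems that by (auto simp: Inl trees_with_Inl)
    then obtain n t where "\<And>j. j < length ts \<Longrightarrow> eval D u (n j) (at_node (ts ! j) v) (t j)" by metis
    then have "\<exists>n. eval D u n (at_node (Node f ts) v) (Node \<delta> (map t [0..<length ts]))"
      unfolding Inl at_node_Inl by (intro eval_outI) auto
    then show ?thesis by blast
  next
    case (Inr l)
    obtain \<alpha> i where l: "l = (\<alpha>, i)" by (cases l)
    have "ts = []" "(\<alpha>, i) \<in> \<Lambda>" using Node.prems by (auto simp: Inr l trees_with_Inr)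
    then show ?thesis using assms(2) by (simp add: Inr l at_node_Inr derives_def)
  qed
qed

lemma derives_rule:
  assumes "label_at u v = Some x" "(x, \<alpha>, i, \<xi>) \<in> rules D" "\<xi> \<in> trees_with \<Delta>' \<Lambda>"
    "\<And>\<alpha> i. (\<alpha>, i) \<in> \<Lambda> \<Longrightarrow> derives u \<alpha> (child v i)"
  shows "derives u \<alpha> (child v i)"
  using eval_rhs_total[OF assms(3,4)] eval.eval_attr[OF assms(1,2)] unfolding derives_def by blast

text \<open>The claim is made for every suffix \<open>w'\<close> of the order, that is, for every
  moment of the evaluation: if the context has supplied the inherited attributes occurring by then,
  the subtree can supply the synthesized ones. This form lets evaluation enter and leave a subtree
  any number of times.\<close>

lemma guess_derives:
  assumes "run (set N) s (state p t w) s'" "subtree_at u v = Some (map_tree Some s')"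
    "w = w1 @ w'" "\<And>\<beta>. \<beta> \<in> set w' \<Longrightarrow> base \<beta> \<in> set I \<Longrightarrow> derives u \<beta> v" "\<beta> \<in> set w'"
  shows "derives u \<beta> v"
  using assms
proof (induction s arbitrary: p t w s' v w1 w' \<beta>)
  case (Node \<sigma> ss)
  obtain ns l ss' where 1: "s' = Node l ss'" "(\<sigma>, ns, state p t w, l) \<in> set N" "length ss = length ns"
    "length ss' = length ns" "\<And>j. j < length ns \<Longrightarrow> run (set N) (ss ! j) (ns ! j) (ss' ! j)"
    using Node.prems(1) by (auto simp: run_Node)
  from 1(2) obtain ps \<sigma>1 ts \<sigma>2 M where 2: "(\<sigma>1, ts, t, \<sigma>2) \<in> set Tt" "length ts = length ps"
    "ns = map (\<lambda>j. state (ps ! j) (ts ! j) (proj (Suc j) M)) [0..<length ps]" "l = enc (\<sigma>2, M)"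
    "valid (E \<sigma>2 (length ps)) M" "w = proj 0 M"
    unfolding guesses_iff by auto
  have len: "length ns = length ps" using 2(3) by simp
  have k: "(\<sigma>2, length ps) \<in> set \<Gamma>" using Tt[OF 2(1)] 2(2) by simp
  have lab: "label_at u v = Some (Some l)" using Node.prems(2) 1(1) by (simp add: label_at_eq)
  obtain M1 M' where M': "M = M1 @ M'" "proj 0 M' = w'"
    using proj_append_conv 2(6) Node.prems(3) by metis
  \<comment> \<open>The inner induction follows the evaluation order at this node; the outer one
    descends into the children.\<close>
  have "\<forall>(\<alpha>, i) \<in> key_of ` set M2. derives u \<alpha> (child v i)" if "M' = M3 @ M2" for M2 M3
    using that
  proof (induction M2 arbitrary: M3)
    case (Cons e M2)
    obtain \<alpha> i lv ro where e: "e = (\<alpha>, i, lv, ro)" by (metis prod_cases4)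
    have IH: "derives u \<alpha> (child v i)" if "(\<alpha>, i) \<in> key_of ` set M2" for \<alpha> i
      using Cons.IH[of "M3 @ [e]"] Cons.prems that by auto
    have "valid (E \<sigma>2 (length ps)) (e # M2)" using 2(5) M' Cons.prems valid_append by metis
    then have ent: "(\<alpha>, i, lv, ro) \<in> set (E \<sigma>2 (length ps))" and lv: "set lv \<subseteq> key_of ` set M2"
      by (auto simp: e addable_def)
    consider \<xi> where "ro = [\<xi>]" | "i = 0" "\<alpha> \<in> IA" | j where "i = Suc j" "j < length ps" "\<alpha> \<in> SA"
      using ent unfolding set_entries set_own_entries by (cases i) auto
    then have "derives u \<alpha> (child v i)"
    proof cases
      case 1
      have "(Some l, \<alpha>, i, \<xi>) \<in> rules D"
        using 2(4,5) k 1 e M' Cons.prems by (fastforce simp: det_att_def set_det_rules)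
      moreover have "\<xi> \<in> trees_with (set \<Delta>) (set lv)" using own_entry(3)[OF ent k] 1 by simp
      moreover have "derives u \<beta> (child v j)" if "(\<beta>, j) \<in> set lv" for \<beta> j
        using that lv IH by blast
      ultimately show ?thesis by (rule derives_rule[OF lab])
    next
      case 2
      have "\<alpha> \<in> set w'" unfolding M'(2)[symmetric] set_proj using 2 Cons.prems by (force simp: e key_of_def)
      moreover have "base \<alpha> \<in> set I" using 2 by (auto simp: set_inh_attrs)
      ultimately show ?thesis using Node.prems(4) 2 by (simp add: child_def)
    next
      case 3
      \<comment> \<open>For a synthesized attribute of a child, the outer hypothesis applies to the
        child's order up to and including \<open>\<alpha>\<close>. The inherited attributes in this
        part are earlier, so the inner hypothesis has already supplied them.\<close>
      have "ss ! j \<in> set ss" using 3(2) len 1(3) by simp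
      moreover have "run (set N) (ss ! j) (state (ps ! j) (ts ! j) (proj i M)) (ss' ! j)"
        using 1(5)[of j] 2(3) 3 by simp
      moreover have "subtree_at u (child v i) = Some (map_tree Some (ss' ! j))"
        using subtree_at_child[of u v "Some l" "map (map_tree Some) ss'" j] Node.prems(2) 1(1,4) 3 len
        by (simp add: child_def)
      moreover have "proj i M = proj i (M1 @ M3) @ proj i (e # M2)"
        using M' Cons.prems by (simp add: proj_def)
      moreover have "derives u \<beta> (child v i)" if "\<beta> \<in> set (proj i (e # M2))" "base \<beta> \<in> set I" for \<beta>
      proof -
        have "base \<alpha> \<in> set S" using 3 by (auto simp: set_syn_attrs)
        then have "\<beta> \<noteq> \<alpha>" using that S_I_disjoint by blast
        then have "\<beta> \<in> set (proj i M2)" using that by (auto simp: proj_def e split: if_splits)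
        then show ?thesis using IH unfolding set_proj by blast
      qed
      moreover have "\<alpha> \<in> set (proj i (e # M2))" by (simp add: proj_def e)
      ultimately show ?thesis by (rule Node.IH)
    qed
    then show ?case using IH by (auto simp: e key_of_def)
  qed simp
  from this[of "[]" M'] show ?case
    using Node.prems(5) unfolding M'(2)[symmetric] set_proj by (auto simp: child_def)
qed

lemma guess_total:
  assumes "run (set N) s 0 s'"
  shows "\<exists>n t. eval D (mark s') n (Node (Inr (init D, [1])) []) t"
proof -
  let ?u = "mark s'"
  obtain p t w where r: "run (set N) s (state p t w) s'" and f: "final_ok F t0 L I R (init A) p t w"
    using assms run_guess_final by blast
  have ok: "root_ok I H w" and a0: "mk_attr (init A) 0 0 \<in> set w" using f by (auto simp: final_ok_def)
  \<comment> \<open>Along the order of the topmost input node, marker rules supply the inherited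
    attributes and \<open>guess_derives\<close> the others, each from attributes settled
    before.\<close>
  have "root_ok I H w' \<Longrightarrow> w = w1 @ w' \<Longrightarrow> \<beta> \<in> set w' \<Longrightarrow> derives ?u \<beta> [1]" for w1 w' \<beta>
  proof (induction w' arbitrary: w1 \<beta>)
    case (Cons \<alpha> w')
    have IH: "derives ?u \<beta> [1]" if "\<beta> \<in> set w'" for \<beta>
      using Cons.IH[of "w1 @ [\<alpha>]"] Cons.prems that by auto
    show ?case
    proof (cases "base \<alpha> \<in> set I")
      case True
      then obtain \<xi> lv where h: "(\<alpha>, \<xi>, lv) \<in> set H" "\<forall>l \<in> set lv. fst l \<in> set w'"
        using Cons.prems by (auto simp: root_step_def)
      note hash = hash[OF h(1)]
      have "derives ?u \<alpha> (child [] 1)"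
      proof (rule derives_rule[OF _ _ hash(3)])
        show "label_at ?u [] = Some None" by (simp add: mark_def)
        show "(None, \<alpha>, 1, \<xi>) \<in> rules D" using h by (auto simp: det_att_def set_det_rules)
        fix \<beta> i assume "(\<beta>, i) \<in> set lv"
        then show "derives ?u \<beta> (child [] i)" using h(2) hash(4) IH by (force simp: child_def)
      qed
      then show ?thesis using IH Cons.prems(3) by (auto simp: child_def)
    next
      case False
      have "derives ?u \<alpha> [1]"
        by (rule guess_derives[OF r subtree_at_mark Cons.prems(2)]) (use False IH in auto)
      then show ?thesis using IH Cons.prems(3) by auto
    qed
  qed simp
  from this[OF ok, of "[]", OF _ a0] show ?thesis by (simp add: derives_def) (simp add: det_att_def)
qed

end

section \<open>Existence of guesses from minimal evaluations\<close>

context guess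
begin

definition attainable :: "nat option tree \<Rightarrow> nat \<Rightarrow> nat \<Rightarrow> node \<Rightarrow> bool" where
  "attainable u \<gamma> q w \<longleftrightarrow> (\<exists>n. producible A u L n \<gamma> q w)"

definition rank :: "nat option tree \<Rightarrow> nat \<Rightarrow> nat \<Rightarrow> node \<Rightarrow> nat" where
  "rank u \<gamma> q w = (LEAST n. producible A u L n \<gamma> q w)"

lemma producible_rank: "producible A u L n \<gamma> q w \<Longrightarrow> attainable u \<gamma> q w \<and> rank u \<gamma> q w \<le> n"
  unfolding attainable_def rank_def by (blast intro: Least_le)

text \<open>The first rule of a minimal evaluation leaves an evaluation with a strictly smaller
  bound \<open>m\<close>, and \<open>m\<close> bounds the rank of all attributes that the rule
  calls.\<close>

lemma attainable_step:
  assumes "attainable u \<gamma> q w"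
  obtains v x i \<xi> t m where "w = child v i" "label_at u v = Some x" "(x, \<gamma>, i, \<xi>) \<in> set R"
    "eval A u m (at_node \<xi> v) t" "accepts L t q" "m < rank u \<gamma> q w"
proof -
  have "producible A u L (rank u \<gamma> q w) \<gamma> q w"
    using assms unfolding attainable_def rank_def by (rule LeastI_ex)
  then obtain t where "eval A u (rank u \<gamma> q w) (Node (Inr (\<gamma>, w)) []) t" "accepts L t q"
    by (auto simp: producible_def)
  then show ?thesis using that R by (auto elim!: eval_AttrE)
qed

lemma attainable_state: "attainable u \<gamma> q w \<Longrightarrow> q \<in> set (states_of L)"
  by (auto simp: attainable_def producible_def accepts_state)

lemma root_choice:
  assumes "b \<in> set I" "attainable u b q [1]" "label_at u [] = Some None"
  shows "\<exists>\<xi> lv. (mk_attr b q (Suc (enc \<xi>)), \<xi>, lv) \<in> set H \<and> (\<forall>(\<alpha>, i) \<in> set lv. i = 1 \<and>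
    (\<exists>a q'. \<alpha> = mk_attr a q' 0 \<and> a \<in> set S \<and> attainable u a q' [1] \<and> rank u a q' [1] < rank u b q [1]))"
proof -
  obtain v x i \<xi> t m where 1: "[1] = child v i" "label_at u v = Some x" "(x, b, i, \<xi>) \<in> set R"
    "eval A u m (at_node \<xi> v) t" "accepts L t q" "m < rank u b q [1]"
    using attainable_step[OF assms(2)] by metis
  \<comment> \<open>This excludes the reading \<open>v = [1]\<close> and \<open>i = 0\<close> of
    \<open>[1] = child v i\<close>: inherited attributes are defined at the parent, here the
    marker.\<close>
  have "i \<noteq> 0"
  proof (cases x)
    case (Some \<sigma>)
    have "att_rule_ok A (Some \<sigma>, b, i, \<xi>)" using A 1(3) R Some unfolding is_att_def by blast
    then show ?thesis using S_I_disjoint assms(1) S I by (auto simp: att_rule_ok_def)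
  next
    case None
    then show ?thesis using rule_None(2)[OF 1(3)[unfolded None]] by simp
  qed
  then have v: "v = []" "x = None" using 1(1,2) assms(3) by (auto simp: child_def)
  note r = rule_None[OF 1(3)[unfolded v]]
  have "\<exists>\<xi>' lv. (q, \<xi>', lv) \<in> set (annotate L [0] \<xi>) \<and> (\<forall>(\<alpha>, i) \<in> set lv. \<exists>\<gamma> q.
     \<alpha> = mk_attr \<gamma> q 0 \<and> (\<gamma>, i) \<in> set S \<times> {1} \<and> producible A u L m \<gamma> q (child v i))"
    by (rule annotate_complete[OF r(3) 1(4,5), where tg="\<lambda>_ _ _. 0"]) simp
  then obtain \<xi>' lv where 2: "(q, \<xi>', lv) \<in> set (annotate L [0] \<xi>)"
    "\<And>\<alpha> i. (\<alpha>, i) \<in> set lv \<Longrightarrow>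
      \<exists>\<gamma> q. \<alpha> = mk_attr \<gamma> q 0 \<and> (\<gamma>, i) \<in> set S \<times> {1} \<and> producible A u L m \<gamma> q (child v i)" by blast
  have "(mk_attr b q (Suc (enc \<xi>')), \<xi>', lv) \<in> set H"
    unfolding set_hashes using 1(3) 2(1) v by blast
  moreover have "i = 1 \<and> (\<exists>a q'. \<alpha> = mk_attr a q' 0 \<and> a \<in> set S \<and> attainable u a q' [1] \<and> rank u a q' [1] < rank u b q [1])"
    if l: "(\<alpha>, i) \<in> set lv" for \<alpha> i
  proof -
    obtain a q' where 3: "\<alpha> = mk_attr a q' 0" "(a, i) \<in> set S \<times> {1}" "producible A u L m a q' (child v i)"
      using 2(2)[OF l] by blast
    then have "i = 1" "a \<in> set S" by simp_all
    have "producible A u L m a q' [1]" using 3(3) v \<open>i = 1\<close> by (simp add: child_def)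
    then have "attainable u a q' [1]" "rank u a q' [1] < rank u b q [1]"
      using producible_rank le_less_trans[OF _ 1(6)] by blast+
    then show ?thesis using 3(1) \<open>i = 1\<close> \<open>a \<in> set S\<close> by blast
  qed
  ultimately show ?thesis by blast
qed

text \<open>The rule is chosen once per attribute and state, so that all occurrences receive the
  same tag. The condition mentions only synthesized attributes, whose tag is 0, and so
  \<open>tag\<close> can be defined from it without circularity.\<close>

definition root_rhs :: "nat option tree \<Rightarrow> nat \<Rightarrow> nat \<Rightarrow> rhs" where
  "root_rhs u b q = (SOME \<xi>. \<exists>lv. (mk_attr b q (Suc (enc \<xi>)), \<xi>, lv) \<in> set H \<and> (\<forall>(\<alpha>, i) \<in> set lv. i = 1 \<and>
    (\<exists>a q'. \<alpha> = mk_attr a q' 0 \<and> a \<in> set S \<and> attainable u a q' [1] \<and> rank u a q' [1] < rank u b q [1])))"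

definition tag :: "nat option tree \<Rightarrow> nat \<Rightarrow> nat \<Rightarrow> node \<Rightarrow> nat" where
  "tag u \<gamma> q w = (if \<gamma> \<in> set I \<and> w = [1] then Suc (enc (root_rhs u \<gamma> q)) else 0)"

lemma root_rhs:
  assumes "b \<in> set I" "attainable u b q [1]" "label_at u [] = Some None"
  obtains lv where "(mk_attr b q (tag u b q [1]), root_rhs u b q, lv) \<in> set H"
    "\<And>\<alpha> i. (\<alpha>, i) \<in> set lv \<Longrightarrow>
      \<exists>a q'. \<alpha> = mk_attr a q' 0 \<and> a \<in> set S \<and> attainable u a q' [1] \<and> rank u a q' [1] < rank u b q [1]"
  using someI_ex[OF root_choice[OF assms]] assms(1) unfolding root_rhs_def[symmetric] tag_def by fastforce

lemma tag_syn: "\<gamma> \<in> set S \<Longrightarrow> tag u \<gamma> q w = 0"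
  using S_I_disjoint by (auto simp: tag_def)

lemma tag_in_tags:
  assumes "attainable u \<gamma> q w" "label_at u [] = Some None"
  shows "tag u \<gamma> q w \<in> set (tags L R)"
proof (cases "\<gamma> \<in> set I \<and> w = [1]")
  case True
  then obtain lv where "(mk_attr \<gamma> q (tag u \<gamma> q [1]), root_rhs u \<gamma> q, lv) \<in> set H"
    using root_rhs assms by metis
  then show ?thesis using True unfolding set_tags tag_def by auto
qed (auto simp: tag_def set_tags)

lemma own_choice:
  assumes "attainable u \<gamma> q (child v i)" "label_at u v = Some (Some \<sigma>)" "(\<sigma>, k) \<in> set \<Gamma>"
    "\<gamma> \<in> set S \<and> i = 0 \<or> \<gamma> \<in> set I \<and> 1 \<le> i \<and> i \<le> k" "label_at u [] = Some None"
  shows "\<exists>\<xi> lv. (mk_attr \<gamma> q 0, i, lv, [\<xi>]) \<in> set (own_entries L R \<sigma>) \<and> (\<forall>(\<alpha>, j) \<in> set lv. \<exists>\<gamma>' q'.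
     \<alpha> = mk_attr \<gamma>' q' (tag u \<gamma>' q' (child v j)) \<and> (\<gamma>', j) \<in> set S \<times> {1..k} \<union> set I \<times> {0} \<and>
     attainable u \<gamma>' q' (child v j) \<and> rank u \<gamma>' q' (child v j) < rank u \<gamma> q (child v i))"
proof -
  obtain v' x i' \<xi> t m where 1: "child v i = child v' i'" "label_at u v' = Some x" "(x, \<gamma>, i', \<xi>) \<in> set R"
    "eval A u m (at_node \<xi> v') t" "accepts L t q" "m < rank u \<gamma> q (child v i)"
    using attainable_step[OF assms(1)] by metis
  have ok: "att_rule_ok A (x, \<gamma>, i', \<xi>)" using A 1(3) R unfolding is_att_def by blast
  \<comment> \<open>Whether the index is 0 is determined by the kind of the attribute; then
    \<open>child v i\<close> determines both the node at which the rule applies and the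
    index.\<close>
  have "i' = 0 \<longleftrightarrow> i = 0" using ok assms(4) S_I_disjoint S I by (cases x) (auto simp: att_rule_ok_def)
  then have v': "v' = v" "i' = i" using 1(1) by (auto simp: child_def split: if_splits)
  then have x: "x = Some \<sigma>" using 1(2) assms(2) by simp
  note r = rule_Some[OF 1(3)[unfolded x] assms(3)]
  let ?\<Lambda> = "set S \<times> {1..k} \<union> set I \<times> {0}"
  have "\<exists>\<xi>' lv. (q, \<xi>', lv) \<in> set (annotate L (tags L R) \<xi>) \<and> (\<forall>(\<alpha>, j) \<in> set lv. \<exists>\<gamma> q.
     \<alpha> = mk_attr \<gamma> q (tag u \<gamma> q (child v j)) \<and> (\<gamma>, j) \<in> ?\<Lambda> \<and> producible A u L m \<gamma> q (child v j))"
  proof (rule annotate_complete[OF r(2) 1(4)[unfolded v'] 1(5)])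
    fix \<gamma> q j assume "(\<gamma>, j) \<in> ?\<Lambda>" "producible A u L m \<gamma> q (child v j)"
    then show "tag u \<gamma> q (child v j) \<in> set (if j = 0 then tags L R else [0])"
      using tag_in_tags assms(5) producible_rank tag_syn by auto
  qed
  then obtain \<xi>' lv where 2: "(q, \<xi>', lv) \<in> set (annotate L (tags L R) \<xi>)"
    "\<And>\<alpha> j. (\<alpha>, j) \<in> set lv \<Longrightarrow> \<exists>\<gamma> q. \<alpha> = mk_attr \<gamma> q (tag u \<gamma> q (child v j)) \<and> (\<gamma>, j) \<in> ?\<Lambda> \<and>
        producible A u L m \<gamma> q (child v j)" by blast
  have "(mk_attr \<gamma> q 0, i, lv, [\<xi>']) \<in> set (own_entries L R \<sigma>)"
    unfolding set_own_entries using 1(3) 2(1) v' x by blast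
  moreover have "\<exists>\<gamma>' q'. \<alpha> = mk_attr \<gamma>' q' (tag u \<gamma>' q' (child v j)) \<and> (\<gamma>', j) \<in> ?\<Lambda> \<and>
     attainable u \<gamma>' q' (child v j) \<and> rank u \<gamma>' q' (child v j) < rank u \<gamma> q (child v i)"
    if l: "(\<alpha>, j) \<in> set lv" for \<alpha> j
  proof -
    obtain \<gamma>' q' where 3: "\<alpha> = mk_attr \<gamma>' q' (tag u \<gamma>' q' (child v j))" "(\<gamma>', j) \<in> ?\<Lambda>"
      "producible A u L m \<gamma>' q' (child v j)" using 2(2)[OF l] by blast
    have "attainable u \<gamma>' q' (child v j)" "rank u \<gamma>' q' (child v j) < rank u \<gamma> q (child v i)"
      using producible_rank[OF 3(3)] le_less_trans[OF _ 1(6)] by blast+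
    then show ?thesis using 3 by blast
  qed
  ultimately show ?thesis by blast
qed

text \<open>All attainable attributes are collected, whether or not the initial attribute calls
  them. The set thus depends on the node alone, and neighbours agree on it without any record of
  demand.\<close>

definition attrs :: "nat option tree \<Rightarrow> node \<Rightarrow> nat set" where
  "attrs u w = {mk_attr \<gamma> q (tag u \<gamma> q w) | \<gamma> q. \<gamma> \<in> set S \<union> set I \<and> attainable u \<gamma> q w}"

definition rk :: "nat option tree \<Rightarrow> node \<Rightarrow> nat \<Rightarrow> nat" where
  "rk u w \<alpha> = rank u (base \<alpha>) (target \<alpha>) w"

lemma finite_attrs: "finite (attrs u w)"
proof (rule finite_subset)
  show "attrs u w \<subseteq> (\<lambda>(\<gamma>, q). mk_attr \<gamma> q (tag u \<gamma> q w)) ` ((set S \<union> set I) \<times> set (states_of L))"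
    using attainable_state by (force simp: attrs_def)
qed simp

lemma entry_exists:
  assumes "\<alpha> \<in> attrs u (child v i)" "label_at u v = Some (Some \<sigma>)" "(\<sigma>, k) \<in> set \<Gamma>" "i \<le> k"
    "label_at u [] = Some None"
  shows "\<exists>e. e \<in> set (E \<sigma> k) \<and> key_of e = (\<alpha>, i) \<and> (\<forall>(\<beta>, j) \<in> set (fst (snd (snd e))).
     j \<le> k \<and> \<beta> \<in> attrs u (child v j) \<and> rk u (child v j) \<beta> < rk u (child v i) \<alpha>)"
proof -
  obtain \<gamma> q where 1: "\<alpha> = mk_attr \<gamma> q (tag u \<gamma> q (child v i))" "\<gamma> \<in> set S \<union> set I" "attainable u \<gamma> q (child v i)"
    using assms(1) by (auto simp: attrs_def)
  show ?thesis
  proof (cases "\<gamma> \<in> set S \<and> i = 0 \<or> \<gamma> \<in> set I \<and> 1 \<le> i")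
    case True
    then have "\<gamma> \<in> set S \<and> i = 0 \<or> \<gamma> \<in> set I \<and> 1 \<le> i \<and> i \<le> k" using assms(4) by blast
    from own_choice[OF 1(3) assms(2,3) this assms(5)] obtain \<xi> lv where
      2: "(mk_attr \<gamma> q 0, i, lv, [\<xi>]) \<in> set (own_entries L R \<sigma>)"
      "\<And>\<beta> j. (\<beta>, j) \<in> set lv \<Longrightarrow> \<exists>\<gamma>' q'. \<beta> = mk_attr \<gamma>' q' (tag u \<gamma>' q' (child v j)) \<and>
        (\<gamma>', j) \<in> set S \<times> {1..k} \<union> set I \<times> {0} \<and>
        attainable u \<gamma>' q' (child v j) \<and> rank u \<gamma>' q' (child v j) < rank u \<gamma> q (child v i)" by blast
    \<comment> \<open>The label shows that \<open>v\<close> is not the marker, so an attribute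
      defined at \<open>v\<close> is no inherited attribute of \<open>[1]\<close> and has tag
      0.\<close>
    have "v \<noteq> []" using assms(2,5) by auto
    then have "tag u \<gamma> q (child v i) = 0"
      using True tag_syn[of \<gamma> u q v] by (cases "i = 0") (auto simp: tag_def child_def)
    then have "(\<alpha>, i, lv, [\<xi>]) \<in> set (E \<sigma> k)" using 2(1) 1(1) by (simp add: set_entries)
    moreover have "j \<le> k \<and> \<beta> \<in> attrs u (child v j) \<and> rk u (child v j) \<beta> < rk u (child v i) \<alpha>"
      if "(\<beta>, j) \<in> set lv" for \<beta> j
      using 2(2)[OF that] 1(1) by (auto simp: attrs_def rk_def)
    ultimately show ?thesis by (intro exI[of _ "(\<alpha>, i, lv, [\<xi>])"]) (auto simp: key_of_def)
  next
    case False
    \<comment> \<open>The rule of this attribute belongs to the parent or to a child; the entry only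
      records the place of the attribute in the order.\<close>
    then have "(\<alpha>, i, [], []) \<in> set (E \<sigma> k)"
      using 1 assms(4,5) attainable_state tag_in_tags tag_syn
      by (cases "i = 0") (auto simp: set_entries set_syn_attrs set_inh_attrs)
    then show ?thesis by (intro exI[of _ "(\<alpha>, i, [], [])"]) (auto simp: key_of_def)
  qed
qed

text \<open>Attributes of equal rank stay in numerical order, which makes the list a function of the
  node.\<close>

definition schedule :: "nat option tree \<Rightarrow> node \<Rightarrow> nat list" where
  "schedule u w = sort_key (rk u w) (sorted_list_of_set (attrs u w))"

lemma set_schedule: "set (schedule u w) = attrs u w"
  by (simp add: schedule_def finite_attrs)

text \<open>Sorting by rank makes all rules at a node refer to earlier attributes; since \<open>sort_key\<close> is
  stable, the orders at neighbouring nodes agree on the attributes that they share.\<close>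

lemma order_exists:
  assumes "label_at u v = Some (Some \<sigma>)" "(\<sigma>, k) \<in> set \<Gamma>" "label_at u [] = Some None"
  shows "\<exists>M. valid (E \<sigma> k) M \<and> (\<forall>i \<le> k. proj i M = rev (schedule u (child v i)))"
proof -
  define g where "g = (\<lambda>(\<alpha>, i). rk u (child v i) \<alpha>)"
  define xs where "xs = concat (map (\<lambda>i. map (\<lambda>\<alpha>. (\<alpha>, i)) (sorted_list_of_set (attrs u (child v i)))) [0..<Suc k])"
  have in_xs: "(\<alpha>, i) \<in> set xs \<longleftrightarrow> i \<le> k \<and> \<alpha> \<in> attrs u (child v i)" for \<alpha> i
    unfolding xs_def by (auto simp: finite_attrs simp del: upt_Suc)
  have "\<forall>x. \<exists>e. x \<in> set xs \<longrightarrow> e \<in> set (E \<sigma> k) \<and> key_of e = x \<and>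
      (\<forall>l \<in> set (fst (snd (snd e))). l \<in> set xs \<and> g l < g x)"
  proof
    fix x :: key
    obtain \<alpha> i where x: "x = (\<alpha>, i)" by (cases x)
    show "\<exists>e. x \<in> set xs \<longrightarrow> e \<in> set (E \<sigma> k) \<and> key_of e = x \<and>
      (\<forall>l \<in> set (fst (snd (snd e))). l \<in> set xs \<and> g l < g x)"
    proof (cases "x \<in> set xs")
      case True
      then have "\<alpha> \<in> attrs u (child v i)" "i \<le> k" by (simp_all add: x in_xs)
      from entry_exists[OF this(1) assms(1,2) this(2) assms(3)]
      show ?thesis unfolding x g_def by (fastforce simp: in_xs)
    qed simp
  qed
  from choice[OF this] obtain e where e: "\<And>x. x \<in> set xs \<Longrightarrow> e x \<in> set (E \<sigma> k) \<and> key_of (e x) = x \<and>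
      (\<forall>l \<in> set (fst (snd (snd (e x)))). l \<in> set xs \<and> g l < g x)" by blast
  let ?ys = "sort_key g xs"
  have "distinct xs"
  proof -
    have "distinct (concat (map (\<lambda>i. map (\<lambda>\<alpha>. (\<alpha>, i)) (sorted_list_of_set (attrs u (child v i)))) [0..<n]))" for n
      by (induction n) (auto simp: distinct_map inj_on_def)
    then show ?thesis unfolding xs_def .
  qed
  then have "valid (E \<sigma> k) (rev (map e ?ys))"
    by (intro valid_sorted[of g]) (use e in auto)
  moreover have "proj i (rev (map e ?ys)) = rev (schedule u (child v i))" if "i \<le> k" for i
  proof -
    have "proj i (map e zs) = map fst (filter (\<lambda>x. snd x = i) zs)" if "set zs \<subseteq> set xs" for zs
      using that
    proof (induction zs)
      case (Cons z zs)
      then have "(fst (e z), fst (snd (e z))) = z" using e[of z] by (simp add: key_of_def)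
      then have "fst (e z) = fst z" "fst (snd (e z)) = snd z" by (metis fst_conv snd_conv)+
      then show ?case using Cons by (simp add: proj_def)
    qed (simp add: proj_def)
    from this[of "rev ?ys"] have "proj i (rev (map e ?ys)) = rev (map fst (filter (\<lambda>x. snd x = i) ?ys))"
      by (simp add: rev_map rev_filter)
    also have "filter (\<lambda>x. snd x = i) ?ys = sort_key g (map (\<lambda>\<alpha>. (\<alpha>, i)) (sorted_list_of_set (attrs u (child v i))))"
      unfolding filter_sort xs_def filter_snd_concat using that by simp
    also have "map fst \<dots> = schedule u (child v i)"
      by (simp add: sort_key_map_Pair schedule_def g_def o_def)
    finally show ?thesis .
  qed
  ultimately show ?thesis by blast
qed

text \<open>All nodes restrict their order to the same schedules, so the states demanded by a parent
  are those that its children reach, and the local guesses combine into one run.\<close>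

lemma guess_complete:
  assumes "run (set Bt) s p s1" "run (set Tt) s1 t s2" "subtree_at u v = Some (map_tree Some s2)"
    "label_at u [] = Some None"
  shows "\<exists>s'. run (set N) s (state p t (rev (schedule u v))) s'"
  using assms
proof (induction s arbitrary: p t s1 s2 v)
  case (Node \<sigma> ss)
  obtain ps \<sigma>1 ss1 where 1: "s1 = Node \<sigma>1 ss1" "(\<sigma>, ps, p, \<sigma>1) \<in> set Bt" "length ss = length ps" "length ss1 = length ps"
    "\<And>j. j < length ps \<Longrightarrow> run (set Bt) (ss ! j) (ps ! j) (ss1 ! j)"
    using Node.prems(1) by (auto simp: run_Node)
  obtain ts \<sigma>2 ss2 where 2: "s2 = Node \<sigma>2 ss2" "(\<sigma>1, ts, t, \<sigma>2) \<in> set Tt" "length ts = length ps" "length ss2 = length ps"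
    "\<And>j. j < length ps \<Longrightarrow> run (set Tt) (ss1 ! j) (ts ! j) (ss2 ! j)"
    using Node.prems(2) 1 by (auto simp: run_Node)
  have lab: "label_at u v = Some (Some \<sigma>2)" using Node.prems(3) 2(1) by (simp add: label_at_eq)
  have k: "(\<sigma>2, length ps) \<in> set \<Gamma>" using Tt[OF 2(2)] 2(3) by simp
  obtain M where M: "valid (E \<sigma>2 (length ps)) M" "\<And>i. i \<le> length ps \<Longrightarrow> proj i M = rev (schedule u (child v i))"
    using order_exists[OF lab k Node.prems(4)] by blast
  have "\<exists>s'. run (set N) (ss ! j) (state (ps ! j) (ts ! j) (proj (Suc j) M)) s'" if "j < length ps" for j
  proof -
    have "subtree_at u (v @ [Suc j]) = Some (map_tree Some (ss2 ! j))"
      using subtree_at_child[of u v "Some \<sigma>2" "map (map_tree Some) ss2" j] Node.prems(3) 2(1,4) that by simp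
    then show ?thesis
      using Node.IH[OF _ 1(5)[OF that] 2(5)[OF that] _ Node.prems(4), of "v @ [Suc j]"] 1(3) that M(2)[of "Suc j"]
      by (simp add: child_def)
  qed
  then obtain f where f: "\<And>j. j < length ps \<Longrightarrow> run (set N) (ss ! j) (state (ps ! j) (ts ! j) (proj (Suc j) M)) (f j)"
    by metis
  let ?ns = "map (\<lambda>j. state (ps ! j) (ts ! j) (proj (Suc j) M)) [0..<length ps]"
  have "proj 0 M = rev (schedule u v)" using M(2)[of 0] by (simp add: child_def)
  then have "(\<sigma>, ?ns, state p t (rev (schedule u v)), enc (\<sigma>2, M)) \<in> set N"
    unfolding guesses_iff using 1(2) 2(2,3) M(1) by metis
  then have "run (set N) (Node \<sigma> ss) (state p t (rev (schedule u v))) (Node (enc (\<sigma>2, M)) (map f [0..<length ps]))"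
    unfolding run_Node using f 1(3) by (intro exI[of _ ?ns]) auto
  then show ?case by blast
qed

text \<open>The tag of an inherited attribute names a marker rule whose attributes have smaller
  rank, and these come earlier in the schedule.\<close>

lemma root_ok_schedule:
  assumes "label_at u [] = Some None"
  shows "root_ok I H (rev (schedule u [1]))"
proof (rule root_ok_decomp)
  fix w1 \<beta> w2 assume w: "rev (schedule u [1]) = w1 @ \<beta> # w2"
  show "root_step I H \<beta> w2"
    unfolding root_step_def
  proof
    assume b: "base \<beta> \<in> set I"
    have "\<beta> \<in> set (rev (schedule u [1]))" unfolding w by simp
    then have "\<beta> \<in> attrs u [1]" by (simp add: set_schedule)
    then obtain q where q: "\<beta> = mk_attr (base \<beta>) q (tag u (base \<beta>) q [1])" "attainable u (base \<beta>) q [1]"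
      by (auto simp: attrs_def)
    from root_rhs[OF b q(2) assms] obtain lv where lv: "(\<beta>, root_rhs u (base \<beta>) q, lv) \<in> set H"
      "\<And>\<alpha> i. (\<alpha>, i) \<in> set lv \<Longrightarrow> \<exists>a q'. \<alpha> = mk_attr a q' 0 \<and> a \<in> set S \<and> attainable u a q' [1] \<and>
         rank u a q' [1] < rank u (base \<beta>) q [1]" using q(1) by metis
    have "\<alpha> \<in> set w2" if "(\<alpha>, i) \<in> set lv" for \<alpha> i
    proof (rule rev_sorted_before[OF _ w])
      show "sorted (map (rk u [1]) (schedule u [1]))" by (simp add: schedule_def)
      obtain a q' where a: "\<alpha> = mk_attr a q' 0" "a \<in> set S" "attainable u a q' [1]" "rank u a q' [1] < rank u (base \<beta>) q [1]"
        using lv(2)[OF \<open>(\<alpha>, i) \<in> set lv\<close>] by blast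
      then show "\<alpha> \<in> set (schedule u [1])" using tag_syn by (force simp: set_schedule attrs_def)
      have "target \<beta> = q" using q(1) target_mk by metis
      then show "rk u [1] \<alpha> < rk u [1] \<beta>" using a by (simp add: rk_def)
    qed
    then show "\<exists>h \<in> set H. fst h = \<beta> \<and> (\<forall>l \<in> set (snd (snd h)). fst l \<in> set w2)"
      using lv(1) by force
  qed
qed

lemma guess_complete_root:
  assumes "run (set Bt) s p s1" "run (set Tt) s1 t0 s2" "p \<in> set F"
    "eval A (mark s2) n (Node (Inr (init A, [1])) []) t" "accepts L t 0"
  shows "\<exists>s'. run (set N) s 0 s'"
proof -
  let ?u = "mark s2"
  have root: "label_at ?u [] = Some None" by (simp add: mark_def)
  obtain s' where s': "run (set N) s (state p t0 (rev (schedule ?u [1]))) s'"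
    using guess_complete[OF assms(1,2) subtree_at_mark root] by blast
  have a0: "init A \<in> set S" using A S by (auto simp: is_att_def)
  have "attainable ?u (init A) 0 [1]" using assms(4,5) by (auto simp: attainable_def producible_def)
  then have "mk_attr (init A) 0 0 \<in> attrs ?u [1]" using a0 tag_syn by (force simp: attrs_def)
  then have "final_ok F t0 L I R (init A) p t0 (rev (schedule ?u [1]))"
    using assms(3) root_ok_schedule[OF root] by (simp add: final_ok_def set_schedule)
  then show ?thesis using run_guess_final s' by blast
qed

end

section \<open>The construction for compositions\<close>

definition rule_of :: "nat \<Rightarrow> rule" where
  "rule_of n = (opt_of (list_nth n 0), list_nth n 1, list_nth n 2, rhs_of (list_nth n 3))"

definition bu_rule_of :: "nat \<Rightarrow> transition" where
  "bu_rule_of n = (list_nth n 0, list_decode (list_nth n 1), list_nth n 2, list_nth n 3)"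

lemma list_nth_list_encode_Cons [simp]:
  "list_nth (list_encode (x # xs)) 0 = x"
  "list_nth (list_encode (x # y # xs)) (Suc 0) = y"
  "list_nth (list_encode (x # y # z # xs)) 2 = z"
  "list_nth (list_encode (x # y # z # w # xs)) 3 = w"
  "list_nth (list_encode (x # y # z # w # v # xs)) 4 = v"
  "list_nth (list_encode (x # y # z # w # v # r # xs)) 5 = r"
  by (simp_all add: list_nth_encode del: list_encode.simps)

lemma rule_of_code [simp]: "rule_of (code_rule r) = r"
proof -
  obtain x \<gamma> i \<xi> where r: "r = (x, \<gamma>, i, \<xi>)" by (metis prod_cases4)
  show ?thesis unfolding r code_rule.simps rule_of_def code_rhs_eq_enc
    by (simp del: list_encode.simps add: opt_of_def split: option.split)
qed

lemma bu_rule_of_code [simp]: "bu_rule_of (code_bu_rule r) = r"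
proof -
  obtain x \<gamma> i \<xi> where r: "r = (x, \<gamma>, i, \<xi>)" by (metis prod_cases4)
  show ?thesis unfolding r code_bu_rule.simps bu_rule_of_def
    by (simp del: list_encode.simps)
qed

definition elems :: "(nat \<Rightarrow> 'a) \<Rightarrow> nat \<Rightarrow> 'a list" where
  "elems d n = map (\<lambda>x. d x) (set_list n)"

lemma set_elems: "finite X \<Longrightarrow> (\<And>x. d (c x) = x) \<Longrightarrow> set (elems d (code_set c X)) = X"
  by (simp add: elems_def code_set_def image_image)

text \<open>Right-hand sides of a top-down relabeling have the form \<open>td_rhs\<close>, from
  which the states and the label can be read off; the value 0 makes the function total on arbitrary
  rules.\<close>

definition td_list :: "rule list \<Rightarrow> transition list" where
  "td_list Tr = concat (map (\<lambda>(x, q, i, \<xi>). case x of None \<Rightarrow> [] | Some \<sigma> \<Rightarrow>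
     [(\<sigma>, map (\<lambda>c. case label c of Inl _ \<Rightarrow> 0 | Inr p \<Rightarrow> fst p) (subtrees \<xi>), q,
       case label \<xi> of Inl \<sigma>' \<Rightarrow> \<sigma>' | Inr _ \<Rightarrow> 0)]) Tr)"

lemma set_td_list:
  assumes "is_tdrel T" "set Tr = rules T"
  shows "set (td_list Tr) = td_transitions T"
proof -
  have td: "map (\<lambda>c. case label c of Inl _ \<Rightarrow> 0 | Inr p \<Rightarrow> fst p) (subtrees (td_rhs \<sigma> qs)) = qs"
    "(case label (td_rhs \<sigma> qs) of Inl \<sigma>' \<Rightarrow> \<sigma>' | Inr _ \<Rightarrow> 0) = \<sigma>" for \<sigma> qs
    by (auto simp: td_rhs_def intro!: nth_equalityI)
  have "(\<sigma>, qs, q, \<sigma>') \<in> set (td_list Tr) \<longleftrightarrow> (Some \<sigma>, q, 0, td_rhs \<sigma>' qs) \<in> rules T" for \<sigma> qs q \<sigma>'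
  proof
    assume "(\<sigma>, qs, q, \<sigma>') \<in> set (td_list Tr)"
    then obtain i \<xi> where 1: "(Some \<sigma>, q, i, \<xi>) \<in> rules T"
      "qs = map (\<lambda>c. case label c of Inl _ \<Rightarrow> 0 | Inr p \<Rightarrow> fst p) (subtrees \<xi>)"
      "\<sigma>' = (case label \<xi> of Inl \<sigma>' \<Rightarrow> \<sigma>' | Inr _ \<Rightarrow> 0)"
      unfolding td_list_def assms(2)[symmetric] by (auto split: option.splits)
    obtain \<sigma>'' qs' where "i = 0" "\<xi> = td_rhs \<sigma>'' qs'" using td_rule[OF assms(1) 1(1)] by metis
    then show "(Some \<sigma>, q, 0, td_rhs \<sigma>' qs) \<in> rules T" using 1 by (simp add: td)
  next
    assume "(Some \<sigma>, q, 0, td_rhs \<sigma>' qs) \<in> rules T"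
    then have "(Some \<sigma>, q, 0, td_rhs \<sigma>' qs) \<in> set Tr" using assms(2) by simp
    then show "(\<sigma>, qs, q, \<sigma>') \<in> set (td_list Tr)"
      unfolding td_list_def by (rule concat_mapI) (simp add: td)
  qed
  then show ?thesis by (auto simp: td_transitions_def)
qed

text \<open>The positions follow the codes: 0, 1, 2 in \<open>a\<close> are the bottom-up
  relabeling, the top-down relabeling and the att. Positions 3 and 4 of the first are final states
  and rules; 0, 1, 4 and 5 of an att are synthesized attributes, inherited attributes, initial
  attribute and rules.\<close>

definition step_trans :: "nat \<Rightarrow> transition list \<Rightarrow> transition list" where
  "step_trans a L = guesses (elems bu_rule_of (list_nth (list_nth a 0) 4)) (set_list (list_nth (list_nth a 0) 3))
     (td_list (elems rule_of (list_nth (list_nth a 1) 5))) (list_nth (list_nth a 1) 4)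
     (set_list (list_nth (list_nth a 2) 0)) (set_list (list_nth (list_nth a 2) 1))
     (elems rule_of (list_nth (list_nth a 2) 5)) (list_nth (list_nth a 2) 4) L"

definition step_attU :: "nat \<Rightarrow> transition list \<Rightarrow> attU" where
  "step_attU a L = (let N = step_trans a L; \<Sigma> = elems prod_decode (list_nth (list_nth a 0) 1);
     S = set_list (list_nth (list_nth a 2) 0); I = set_list (list_nth (list_nth a 2) 1);
     \<Gamma> = elems prod_decode (list_nth (list_nth a 2) 2); \<Delta> = elems prod_decode (list_nth (list_nth a 2) 3);
     R = elems rule_of (list_nth (list_nth a 2) 5)
   in ((subset_burel N \<Sigma>, choice_tdrel N \<Sigma> (det_alph L S I R \<Gamma>)),
       det_att L S I R (list_nth (list_nth a 2) 4) \<Gamma> \<Delta>))"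

text \<open>\<open>L\<close> specifies the admissible outputs, and \<open>N\<close> is handed back
  as the specification of the admissible inputs. \<open>D\<close> may lose outputs but no admissible
  input, which is what the induction over the composition requires.\<close>

theorem step_correct:
  fixes L :: "transition list"
  assumes "is_attU a"
  defines "N \<equiv> step_trans (code_attU a) L" and "D \<equiv> step_attU (code_attU a) L"
  shows "is_dattU D" "inalphU D = inalphU a" "outalphU D = outalphU a"
    "(s, t) \<in> attU_rel D \<Longrightarrow> (s, t) \<in> attU_rel a"
    "accepts N s 0 \<longleftrightarrow> (\<exists>t. (s, t) \<in> attU_rel a \<and> accepts L t 0)"
    "accepts N s 0 \<Longrightarrow> \<exists>t. (s, t) \<in> attU_rel D \<and> accepts L t 0"
proof -
  obtain B T A where a: "a = ((B, T), A)" by (metis prod.collapse)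
  have B: "is_burel B" and T: "is_tdrel T" and BT: "bu_out B = inalph T"
    and TA: "outalph T = inalph A" and A: "is_att A"
    using assms(1) by (auto simp: a is_attU_def is_lookaround_def)
  define Bt F Tt t0 S I R a0 \<Sigma> \<Gamma> \<Delta> where
    "Bt = elems bu_rule_of (code_set code_bu_rule (bu_rules B))" and
    "F = set_list (set_encode (bu_final B))" and
    "Tt = td_list (elems rule_of (code_set code_rule (rules T)))" and
    "t0 = init T" and
    "S = set_list (set_encode (syn A))" and "I = set_list (set_encode (inh A))" and
    "R = elems rule_of (code_set code_rule (rules A))" and "a0 = init A" and
    "\<Sigma> = elems prod_decode (code_set prod_encode (bu_in B))" and
    "\<Gamma> = elems prod_decode (code_set prod_encode (inalph A))" and
    "\<Delta> = elems prod_decode (code_set prod_encode (outalph A))"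
  note defs = this
  have fin: "finite (bu_rules B)" "finite (bu_final B)" "finite (rules T)" "finite (syn A)" "finite (inh A)"
    "finite (rules A)" "finite (bu_in B)" "finite (inalph A)" "finite (outalph A)"
    using B T A by (auto simp: is_burel_def is_tdrel_def is_datt_def is_att_def ranked_alphabet_def intro: finite_subset)
  have sets: "set Bt = bu_rules B" "set F = bu_final B" "set S = syn A" "set I = inh A" "set R = rules A"
    "set \<Sigma> = bu_in B" "set \<Gamma> = inalph A" "set \<Delta> = outalph A"
    using fin by (simp_all add: defs set_elems)
  have Tt: "set Tt = td_transitions T"
    unfolding defs by (rule set_td_list[OF T]) (use fin set_elems rule_of_code in blast)
  have N: "N = guesses Bt F Tt t0 S I R a0 L"
    by (simp add: N_def step_trans_def a code_burel_def code_att_def defs del: list_encode.simps)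
  have D: "D = ((subset_burel N \<Sigma>, choice_tdrel N \<Sigma> (det_alph L S I R \<Gamma>)), det_att L S I R a0 \<Gamma> \<Delta>)"
    by (simp add: D_def N_def step_attU_def Let_def a code_burel_def code_att_def defs del: list_encode.simps)
  have Tt_sound: "(\<sigma>, length ts) \<in> inalph T \<and> (\<sigma>', length ts) \<in> inalph A" if "(\<sigma>, ts, t, \<sigma>') \<in> set Tt" for \<sigma> ts t \<sigma>'
  proof -
    from that have "(Some \<sigma>, t, 0, td_rhs \<sigma>' ts) \<in> rules T" by (simp add: Tt td_transitions_def)
    from td_rule[OF T this] show ?thesis by (auto simp: td_rhs_eq_iff TA)
  qed
  have Bt_sound: "(\<sigma>, length ps) \<in> bu_in B \<and> (\<sigma>', length ps) \<in> bu_out B" if "(\<sigma>, ps, p, \<sigma>') \<in> set Bt" for \<sigma> ps p \<sigma>'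
    using B that sets(1) by (auto simp: is_burel_def)
  interpret g: guess A S I R \<Gamma> \<Delta> L Bt Tt F t0
  proof
    show "(\<sigma>', length ts) \<in> set \<Gamma>" if "(\<sigma>, ts, t, \<sigma>') \<in> set Tt" for \<sigma> ts t \<sigma>'
      using Tt_sound[OF that] sets(7) by simp
    show "is_att A" by (rule A)
    show "set S = syn A" by (rule sets)
    show "set I = inh A" by (rule sets)
    show "set R = rules A" by (rule sets)
    show "set \<Gamma> = inalph A" by (rule sets)
    show "set \<Delta> = outalph A" by (rule sets)
  qed
  have N_sound: "(\<sigma>, length ns) \<in> set \<Sigma> \<and> (l, length ns) \<in> set (det_alph L S I R \<Gamma>)"
    if "(\<sigma>, ns, n, l) \<in> set N" for \<sigma> ns n l
  proof -
    from that[unfolded N guesses_iff] obtain ps p \<sigma>1 ts t \<sigma>2 M where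
      1: "(\<sigma>, ps, p, \<sigma>1) \<in> set Bt" "(\<sigma>1, ts, t, \<sigma>2) \<in> set Tt"
      "length ts = length ps" "valid (entries L S I R \<sigma>2 (length ps)) M" "l = enc (\<sigma>2, M)"
      "ns = map (\<lambda>j. state (ps ! j) (ts ! j) (proj (Suc j) M)) [0..<length ps]" by (elim exE conjE)
    moreover have "length ns = length ps" using 1(6) by simp
    ultimately show ?thesis using Bt_sound[OF 1(1)] Tt_sound[OF 1(2)] sets by (auto simp: set_det_alph)
  qed
  interpret r: relabeling N \<Sigma> "det_alph L S I R \<Gamma>"
  proof
    show "ranked_alphabet (set \<Sigma>)" using B sets by (simp add: is_burel_def)
    show "ranked_alphabet (set (det_alph L S I R \<Gamma>))"
      using g.det_is_att by (simp add: is_att_def det_att_def)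
  qed (rule N_sound)
  have N': "N = guesses Bt F Tt t0 S I R (init A) L" using N by (simp add: a0_def)
  have D': "snd D = det_att L S I R (init A) \<Gamma> \<Delta>" by (simp add: D a0_def)
  have la_D: "fst D = (subset_burel N \<Sigma>, choice_tdrel N \<Sigma> (det_alph L S I R \<Gamma>))" by (simp add: D)
  show "is_dattU D"
    using r.is_lookaround g.det_is_att g.det_deterministic
    by (simp add: is_dattU_def is_attU_def la_D D') (simp add: choice_tdrel_def det_att_def)
  show "inalphU D = inalphU a" "outalphU D = outalphU a"
    using sets by (auto simp: inalphU_def outalphU_def a la_D D' subset_burel_def det_att_def)
  \<comment> \<open>Every output of \<open>D\<close> is admissible, because acceptance by
    \<open>L\<close> is built into the initial attribute.\<close>
  have sound: "(s, t) \<in> attU_rel a \<and> accepts L t 0" if "(s, t) \<in> attU_rel D" for s t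
  proof -
    from that obtain s' where 1: "(s, s') \<in> la_rel (fst D)" "(s', t) \<in> att_rel (snd D)"
      by (auto simp: attU_rel_def)
    from 1(1) have "run (set N) s 0 s'" unfolding la_D by (rule r.la_rel_sound)
    then obtain p t1 w where 2: "run (set N) s (state p t1 w) s'" "final_ok F t0 L I R (init A) p t1 w"
      unfolding N' g.run_guess_final by blast
    then have f: "p \<in> bu_final B" "t1 = init T" using sets by (auto simp: final_ok_def t0_def)
    obtain s1 where 3: "run (set Bt) s p s1" "run (set Tt) s1 t1 (map_tree g.symbol s')"
      using g.run_guess_sound 2(1) unfolding N' by blast
    have "(s, s1) \<in> bu_rel B" using 3(1) f(1) run_trees_in[OF 3(1)] Bt_sound sets(1)
      by (auto simp: bu_rel_def bu_run_eq)
    moreover have "(s1, map_tree g.symbol s') \<in> att_rel T"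
      unfolding att_rel_td[OF T] using 3(2) f(2) run_trees_out[OF 3(1)] Bt_sound BT Tt by auto
    moreover have "(map_tree g.symbol s', t) \<in> att_rel A \<and> accepts L t 0"
    proof -
      obtain n where n: "eval (snd D) (mark s') n (Node (Inr (mk_attr (init A) 0 0, [1])) []) t"
        using 1(2) att_rel_eval[OF g.det_is_att] unfolding D' by (auto simp: det_att_def)
      have "map_tree g.symbol s' \<in> trees (inalph A)"
        using 3(2) by (rule run_trees_out) (use Tt_sound in blast)
      moreover have "eval A (mark (map_tree g.symbol s')) n (Node (Inr (init A, [1])) []) t"
        using g.det_eval_sound(1)[OF n[unfolded D']] by (simp add: strip_def)
      moreover have "accepts L t 0"
        using g.det_eval_sound(2)[OF n[unfolded D']] by (simp add: typed_Inr)
      ultimately show ?thesis using att_rel_eval[OF A] by blast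
    qed
    ultimately show ?thesis by (auto simp: attU_rel_def la_rel_def a)
  qed
  then show "(s, t) \<in> attU_rel D \<Longrightarrow> (s, t) \<in> attU_rel a" by blast
  \<comment> \<open>The look-around may pick any run of \<open>N\<close>: the orders in the labels
    of each of them guarantee that the evaluation succeeds.\<close>
  have total: "\<exists>t. (s, t) \<in> attU_rel D" if "accepts N s 0" for s
  proof -
    obtain s' where 1: "(s, s') \<in> la_rel (fst D)"
      using \<open>accepts N s 0\<close> r.la_rel_total unfolding la_D accepts_def by blast
    then have 2: "run (set N) s 0 s'" unfolding la_D by (rule r.la_rel_sound)
    obtain n t where "eval (snd D) (mark s') n (Node (Inr (init (snd D), [1])) []) t"
      using g.guess_total 2 unfolding N' D' by blast
    moreover have "s' \<in> trees (inalph (snd D))"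
      using 2 by (rule run_trees_out) (use N_sound in \<open>auto simp: D' det_att_def\<close>)
    ultimately have "(s', t) \<in> att_rel (snd D)" using att_rel_eval[OF g.det_is_att] unfolding D' by blast
    then show ?thesis using 1 by (auto simp: attU_rel_def)
  qed
  then show "accepts N s 0 \<Longrightarrow> \<exists>t. (s, t) \<in> attU_rel D \<and> accepts L t 0" using sound by blast
  have complete: "accepts N s 0" if "(s, t) \<in> attU_rel a" "accepts L t 0" for s t
  proof -
    obtain s1 s2 where 1: "(s, s1) \<in> bu_rel B" "(s1, s2) \<in> att_rel T" "(s2, t) \<in> att_rel A"
      using \<open>(s, t) \<in> attU_rel a\<close> by (auto simp: attU_rel_def la_rel_def a)
    obtain p where "p \<in> set F" "run (set Bt) s p s1" using 1(1) sets by (auto simp: bu_rel_def bu_run_eq)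
    moreover have "run (set Tt) s1 t0 s2" using 1(2) unfolding att_rel_td[OF T] Tt t0_def by blast
    moreover obtain n where "eval A (mark s2) n (Node (Inr (init A, [1])) []) t"
      using 1(3) att_rel_eval[OF A] by blast
    ultimately show ?thesis using g.guess_complete_root \<open>accepts L t 0\<close> unfolding N' accepts_def by blast
  qed
  then show "accepts N s 0 \<longleftrightarrow> (\<exists>t. (s, t) \<in> attU_rel a \<and> accepts L t 0)" using total sound by blast
qed

section \<open>Induction over the composition\<close>

definition all_trans :: "alph \<Rightarrow> transition list" where
  "all_trans \<Delta> = map (\<lambda>(\<delta>, k). (\<delta>, map (\<lambda>_. 0) [0..<k], 0, 0)) \<Delta>"

lemma accepts_all_trans: "t \<in> trees (set \<Delta>) \<Longrightarrow> accepts (all_trans \<Delta>) t 0"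
proof (induction t rule: tree.induct)
  case (Node \<delta> ts)
  then have "(\<delta>, map (\<lambda>_. 0) [0..<length ts], 0, 0) \<in> set (all_trans \<Delta>)"
    by (force simp: trees_Node all_trans_def)
  then show ?case using Node unfolding accepts_Node trees_Node
    by (intro exI[of _ "map (\<lambda>_. 0) [0..<length ts]"] exI[of _ 0]) auto
qed

definition build :: "nat list \<Rightarrow> transition list \<Rightarrow> nat list \<times> transition list" where
  "build as L = foldr (\<lambda>a r. (code_attU (step_attU a (snd r)) # fst r, step_trans a (snd r))) as ([], L)"

lemma composition_Cons: "composition (A # As) = attU_rel A O composition As"
  by (simp add: composition_def)

text \<open>Functionality is a property of the whole composition that its suffixes need not share.
  The invariant therefore consists of containment and totality on the accepted inputs, both of which
  survive prepending a transducer.\<close>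

lemma build_correct:
  assumes "\<forall>A \<in> set As. is_attU A"
  shows "\<exists>Ds. fst (build (map code_attU As) L) = map code_attU Ds \<and> (\<forall>D \<in> set Ds. is_dattU D) \<and>
    map inalphU Ds = map inalphU As \<and> map outalphU Ds = map outalphU As \<and>
    composition Ds \<subseteq> composition As \<and>
    (\<forall>s. accepts (snd (build (map code_attU As) L)) s 0 \<longleftrightarrow> (\<exists>t. (s, t) \<in> composition As \<and> accepts L t 0)) \<and>
    (\<forall>s. accepts (snd (build (map code_attU As) L)) s 0 \<longrightarrow> s \<in> Domain (composition Ds))"
  using assms
proof (induction As)
  case Nil
  show ?case by (intro exI[of _ "[]"]) (auto simp: build_def composition_def)
next
  case (Cons A As)
  let ?L = "snd (build (map code_attU As) L)"
  obtain Ds where Ds: "fst (build (map code_attU As) L) = map code_attU Ds" "\<forall>D \<in> set Ds. is_dattU D"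
    "map inalphU Ds = map inalphU As" "map outalphU Ds = map outalphU As"
    "composition Ds \<subseteq> composition As"
    "\<And>s. accepts ?L s 0 \<longleftrightarrow> (\<exists>t. (s, t) \<in> composition As \<and> accepts L t 0)"
    "\<And>s. accepts ?L s 0 \<Longrightarrow> s \<in> Domain (composition Ds)" using Cons by auto
  let ?D = "step_attU (code_attU A) ?L"
  have A: "is_attU A" using Cons.prems by simp
  have b: "build (map code_attU (A # As)) L = (map code_attU (?D # Ds), step_trans (code_attU A) ?L)"
    by (simp add: build_def Ds(1)[unfolded build_def])
  note st = step_correct[OF A, where L="?L"]
  show ?case
  proof (intro exI[of _ "?D # Ds"] conjI allI impI)
    show "composition (?D # Ds) \<subseteq> composition (A # As)"
      using st(4) Ds(5) unfolding composition_Cons by blast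
    fix s
    show "accepts (snd (build (map code_attU (A # As)) L)) s 0 \<longleftrightarrow> (\<exists>t. (s, t) \<in> composition (A # As) \<and> accepts L t 0)"
      unfolding b snd_conv st(5) composition_Cons Ds(6) by blast
    assume "accepts (snd (build (map code_attU (A # As)) L)) s 0"
    then obtain t where "(s, t) \<in> attU_rel ?D" "accepts ?L t 0" using st(6) unfolding b snd_conv by blast
    then show "s \<in> Domain (composition (?D # Ds))" using Ds(7) unfolding composition_Cons by blast
  qed (use b st(1-3) Ds in auto)
qed

text \<open>The nested lookups read the output alphabet (position 3) of the att (position 2) of the
  last transducer. Starting from \<open>all_trans\<close> makes all of its outputs
  admissible.\<close>

definition construct :: "nat \<Rightarrow> nat" where
  "construct n = list_encode (fst (build (list_decode n)
     (all_trans (elems prod_decode (list_nth (list_nth (list_nth n (length (list_decode n) - 1)) 2) 3)))))"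

lemma construct_correct:
  assumes "length As \<ge> 1" "\<forall>A \<in> set As. is_attU A" "composable As" "single_valued (composition As)"
  shows "\<exists>Ds. construct (code_attUs As) = code_attUs Ds \<and> length Ds = length As \<and>
    (\<forall>D \<in> set Ds. is_dattU D) \<and> composable Ds \<and> inalphU (hd Ds) = inalphU (hd As) \<and>
    outalphU (last Ds) = outalphU (last As) \<and> composition Ds = composition As"
proof -
  have ne: "As \<noteq> []" using assms(1) by auto
  define \<Delta> where "\<Delta> = elems prod_decode (code_set prod_encode (outalphU (last As)))"
  have "is_att (snd (last As))" using assms(2) ne by (auto simp: is_attU_def)
  then have \<Delta>: "set \<Delta> = outalphU (last As)"
    by (simp add: \<Delta>_def set_elems outalphU_def is_att_def ranked_alphabet_def)
  have "list_nth (code_attUs As) (length As - 1) = code_attU (last As)"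
    using ne by (simp add: code_attUs_def list_nth_encode last_conv_nth)
  moreover have "list_nth (list_nth (code_attU x) 2) 3 = code_set prod_encode (outalphU x)" for x
  proof -
    obtain B T A where x: "x = ((B, T), A)" by (metis prod.collapse)
    show ?thesis unfolding x by (simp add: code_att_def outalphU_def del: list_encode.simps)
  qed
  ultimately have c: "construct (code_attUs As) = list_encode (fst (build (map code_attU As) (all_trans \<Delta>)))"
    by (simp add: construct_def code_attUs_def \<Delta>_def)
  obtain Ds where Ds: "fst (build (map code_attU As) (all_trans \<Delta>)) = map code_attU Ds" "\<forall>D \<in> set Ds. is_dattU D"
    "map inalphU Ds = map inalphU As" "map outalphU Ds = map outalphU As"
    "composition Ds \<subseteq> composition As"
    "\<And>s. accepts (snd (build (map code_attU As) (all_trans \<Delta>))) s 0 \<longleftrightarrow>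
       (\<exists>t. (s, t) \<in> composition As \<and> accepts (all_trans \<Delta>) t 0)"
    "\<And>s. accepts (snd (build (map code_attU As) (all_trans \<Delta>))) s 0 \<Longrightarrow> s \<in> Domain (composition Ds)"
    using build_correct[OF assms(2), of "all_trans \<Delta>"] by blast
  have len: "length Ds = length As" using Ds(3) map_eq_imp_length_eq by blast
  have at: "inalphU (Ds ! i) = inalphU (As ! i)" "outalphU (Ds ! i) = outalphU (As ! i)" if "i < length As" for i
    using Ds(3,4) len that by (metis nth_map)+
  have "composable Ds" using assms(3) at len by (auto simp: composable_def)
  moreover have "inalphU (hd Ds) = inalphU (hd As)" "outalphU (last Ds) = outalphU (last As)"
  proof -
    have "Ds \<noteq> []" using len ne by auto
    then show "inalphU (hd Ds) = inalphU (hd As)" "outalphU (last Ds) = outalphU (last As)"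
      using at[of 0] at[of "length As - 1"] len ne by (auto simp: hd_conv_nth last_conv_nth)
  qed
  moreover have "composition As \<subseteq> composition Ds"
  proof
    fix z assume z: "z \<in> composition As"
    obtain s t where st: "z = (s, t)" by (cases z)
    have "t \<in> trees (set \<Delta>)"
    proof -
      have "(s, t) \<in> composition As \<Longrightarrow> As \<noteq> [] \<Longrightarrow> t \<in> trees (outalphU (last As))" for s
        by (induction As arbitrary: s)
          (auto simp: composition_Cons attU_rel_def att_rel_def outalphU_def composition_def)
      then show ?thesis using z ne \<Delta> st by simp
    qed
    then have "accepts (all_trans \<Delta>) t 0" by (rule accepts_all_trans)
    then obtain t' where "(s, t') \<in> composition Ds" using Ds(6,7) z st by blast
    \<comment> \<open>Functionality enters here: \<open>t'\<close> is an output of the original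
      composition as well.\<close>
    moreover from this have "t' = t" using Ds(5) z st assms(4) by (auto dest: single_valuedD)
    ultimately show "z \<in> composition Ds" using st by simp
  qed
  ultimately show ?thesis using Ds(1,2,5) len c by (intro exI[of _ Ds]) (auto simp: code_attUs_def)
qed

section \<open>Computability of the construction\<close>

lemma computable_set_insert [comp_intros]:
  assumes "computable f" "computable g" shows "computable (\<lambda>e. set_insert (f e) (g e))"
  unfolding set_insert_def by (intro comp_intros assms)

lemma computable_prod_encode_pair:
  fixes f :: "_ \<Rightarrow> nat \<times> nat"
  assumes "computable f" shows "computable (\<lambda>e. prod_encode (f e))"
  using computable_enc[OF assms] by (simp add: enc_prod_def)

lemma computable_product_lists [comp_intros]:
  assumes "computable f" shows "computable (\<lambda>e. product_lists (f e))"
proof -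
  have *: "product_lists xss = foldr (\<lambda>xs r. concat (map (\<lambda>x. map (\<lambda>l. x # l) r) xs)) xss [[]]" for xss :: "'b list list"
    by (induction xss) auto
  show ?thesis unfolding * by (intro comp_intros assms)
qed

lemma computable_n_lists [comp_intros]:
  assumes "computable n" "computable f" shows "computable (\<lambda>e. List.n_lists (n e) (f e))"
proof -
  have *: "List.n_lists n xs = rec_nat [[]] (\<lambda>_ r. concat (map (\<lambda>ys. map (\<lambda>y. y # ys) xs) r)) n" for n and xs :: "'b list"
    by (induction n) auto
  show ?thesis unfolding * by (intro comp_intros assms computable_comp[OF assms(2)])
qed

lemma computable_td_rhs [comp_intros]:
  assumes "computable \<sigma>" "computable qs" shows "computable (\<lambda>e. td_rhs (\<sigma> e) (qs e))"
  unfolding td_rhs_get by (intro comp_intros assms computable_comp[OF assms(2)])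

lemma computable_states_of [comp_intros]:
  assumes "computable N" shows "computable (\<lambda>e. states_of (N e))"
  unfolding states_of_def by (intro comp_intros assms)

lemma computable_subset_codes [comp_intros]:
  assumes "computable f" shows "computable (\<lambda>e. subset_codes (f e))"
  unfolding subset_codes_def by (intro comp_intros assms)

lemma computable_matches [comp_intros]:
  assumes "computable f" "computable g" shows "computable (\<lambda>e. matches (f e) (g e))"
  \<comment> \<open>Under binders the environment is a tuple that also contains the bound variables.
    Composing the hypotheses with the projection to the old environment makes them applicable there;
    the same device recurs below.\<close>
  unfolding matches_def by (intro comp_intros assms[THEN computable_comp])

lemma computable_enabled [comp_intros]:
  assumes "computable N" "computable \<sigma>" "computable Ps" shows "computable (\<lambda>e. enabled (N e) (\<sigma> e) (Ps e))"
  unfolding enabled_def by (intro comp_intros assms[THEN computable_comp])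

lemma computable_successor [comp_intros]:
  assumes "computable N" "computable \<sigma>" "computable Ps" shows "computable (\<lambda>e. successor (N e) (\<sigma> e) (Ps e))"
  unfolding successor_def by (intro comp_intros assms[THEN computable_comp])

lemma computable_first [comp_intros]:
  assumes "computable f" shows "computable (\<lambda>e. first (f e))"
  unfolding first_def by (intro comp_intros assms)

lemma computable_subset_finals [comp_intros]:
  assumes "computable N" shows "computable (\<lambda>e. subset_finals (N e))"
  unfolding subset_finals_def by (intro comp_intros assms)

context
  fixes N :: "'e::enc \<Rightarrow> transition list" and \<Sigma> :: "'e \<Rightarrow> alph"
  assumes N: "computable N" and \<Sigma>: "computable \<Sigma>"
begin

lemma computable_subset_symbols [comp_intros]: "computable (\<lambda>e. subset_symbols (N e) (\<Sigma> e))"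
  unfolding subset_symbols_def by (intro comp_intros N \<Sigma> N[THEN computable_comp])

lemma computable_subset_alph [comp_intros]: "computable (\<lambda>e. subset_alph (N e) (\<Sigma> e))"
  unfolding subset_alph_def by (intro comp_intros)

lemma computable_subset_rules [comp_intros]: "computable (\<lambda>e. subset_rules (N e) (\<Sigma> e))"
  unfolding subset_rules_def by (intro comp_intros N[THEN computable_comp])

lemma computable_choice_rules [comp_intros]: "computable (\<lambda>e. choice_rules (N e) (\<Sigma> e))"
  unfolding choice_rules_def by (intro comp_intros N[THEN computable_comp])

end

lemma computable_mk_attr [comp_intros]:
  assumes "computable \<gamma>" "computable q" "computable g"
  shows "computable (\<lambda>e. mk_attr (\<gamma> e) (q e) (g e))"
  unfolding mk_attr_def by (intro comp_intros assms)

lemma computable_annotate [comp_intros]: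
  assumes "computable L" "computable gs" "computable \<xi>"
  shows "computable (\<lambda>e. annotate (L e) (gs e) (\<xi> e))"
  unfolding annotate_def annotate_node_def
  by (intro comp_intros assms[THEN computable_comp])

lemma computable_key_of [comp_intros]:
  "computable f \<Longrightarrow> computable (\<lambda>e. key_of (f e))"
  unfolding key_of_def by (intro comp_intros)

lemma computable_addable [comp_intros]:
  assumes "computable f" "computable g" shows "computable (\<lambda>e. addable (f e) (g e))"
  unfolding addable_def by (intro comp_intros assms[THEN computable_comp])

lemma computable_orders [comp_intros]:
  assumes "computable f" shows "computable (\<lambda>e. orders (f e))"
  unfolding orders_def orders_upto_def by (intro comp_intros assms[THEN computable_comp])

lemma computable_proj [comp_intros]:
  assumes "computable f" "computable g" shows "computable (\<lambda>e. proj (f e) (g e))"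
  unfolding proj_def by (intro comp_intros assms[THEN computable_comp])

lemma computable_state [comp_intros]:
  assumes "computable f" "computable g" "computable h" shows "computable (\<lambda>e. state (f e) (g e) (h e))"
  unfolding state_def by (intro comp_intros assms)

lemma computable_hashes [comp_intros]:
  assumes "computable L" "computable R" shows "computable (\<lambda>e. hashes (L e) (R e))"
  unfolding hashes_def by (intro comp_intros assms[THEN computable_comp])

lemma computable_tags [comp_intros]:
  assumes "computable L" "computable R" shows "computable (\<lambda>e. tags (L e) (R e))"
  unfolding tags_def by (intro comp_intros assms[THEN computable_comp])

lemma computable_own_entries [comp_intros]:
  assumes "computable L" "computable R" "computable \<sigma>" shows "computable (\<lambda>e. own_entries (L e) (R e) (\<sigma> e))"
  unfolding own_entries_def by (intro comp_intros assms[THEN computable_comp])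

lemma computable_syn_attrs [comp_intros]:
  assumes "computable L" "computable S" shows "computable (\<lambda>e. syn_attrs (L e) (S e))"
  unfolding syn_attrs_def by (intro comp_intros assms[THEN computable_comp])

lemma computable_inh_attrs [comp_intros]:
  assumes "computable L" "computable R" "computable I" shows "computable (\<lambda>e. inh_attrs (L e) (R e) (I e))"
  unfolding inh_attrs_def by (intro comp_intros assms[THEN computable_comp])

lemma computable_entries [comp_intros]:
  assumes "computable L" "computable S" "computable I" "computable R" "computable \<sigma>" "computable k"
  shows "computable (\<lambda>e. entries (L e) (S e) (I e) (R e) (\<sigma> e) (k e))"
  unfolding entries_def by (intro comp_intros assms[THEN computable_comp])

lemma computable_root_ok [comp_intros]:
  assumes "computable I" "computable H" "computable w" shows "computable (\<lambda>e. root_ok (I e) (H e) (w e))"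
  unfolding root_ok_def root_step_def base_def by (intro comp_intros assms[THEN computable_comp])

lemma computable_guesses [comp_intros]:
  assumes "computable Bt" "computable F" "computable Tt" "computable t0" "computable S" "computable I"
    "computable R" "computable a0" "computable L"
  shows "computable (\<lambda>e. guesses (Bt e) (F e) (Tt e) (t0 e) (S e) (I e) (R e) (a0 e) (L e))"
  unfolding guesses_def final_ok_def by (intro comp_intros assms[THEN computable_comp])

lemma computable_det_symbols [comp_intros]:
  assumes "computable L" "computable S" "computable I" "computable R" "computable \<Gamma>"
  shows "computable (\<lambda>e. det_symbols (L e) (S e) (I e) (R e) (\<Gamma> e))"
  unfolding det_symbols_def by (intro comp_intros assms[THEN computable_comp])

lemma computable_det_alph [comp_intros]:
  assumes "computable L" "computable S" "computable I" "computable R" "computable \<Gamma>"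
  shows "computable (\<lambda>e. det_alph (L e) (S e) (I e) (R e) (\<Gamma> e))"
  unfolding det_alph_def by (intro comp_intros assms[THEN computable_comp])

lemma computable_det_rules [comp_intros]:
  assumes "computable L" "computable S" "computable I" "computable R" "computable \<Gamma>"
  shows "computable (\<lambda>e. det_rules (L e) (S e) (I e) (R e) (\<Gamma> e))"
  unfolding det_rules_def by (intro comp_intros assms[THEN computable_comp])

lemma computable_code_rule [comp_intros]:
  assumes "computable f" shows "computable (\<lambda>e. code_rule (f e))"
proof -
  have *: "code_rule r = (case r of (x, \<gamma>, i, \<xi>) \<Rightarrow> list_encode [enc x, \<gamma>, i, enc \<xi>])" for r
    by (cases r) (simp add: code_rhs_eq_enc enc_option_def split: option.split)
  show ?thesis unfolding * by (intro comp_intros assms)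
qed

lemma computable_code_bu_rule [comp_intros]:
  assumes "computable f" shows "computable (\<lambda>e. code_bu_rule (f e))"
proof -
  have *: "code_bu_rule r = (case r of (\<sigma>, ps, p, l) \<Rightarrow> list_encode [\<sigma>, list_encode ps, p, l])" for r
    by (cases r) simp
  show ?thesis unfolding * by (intro comp_intros assms)
qed

text \<open>The components of the new transducers are sets given by lists; their codes become
  computable by moving the coding function onto the list.\<close>

lemma code_set_list: "code_set c (set xs) = set_encode (set (map (\<lambda>x. c x) xs))"
  by (simp add: code_set_def)

lemma computable_td_list [comp_intros]:
  assumes "computable f" shows "computable (\<lambda>e. td_list (f e))"
  unfolding td_list_def by (intro comp_intros assms)

lemma computable_elems [comp_intros]:
  assumes "computable f"
  shows "computable (\<lambda>e. elems rule_of (f e))" "computable (\<lambda>e. elems bu_rule_of (f e))"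
    "computable (\<lambda>e. elems prod_decode (f e))"
  unfolding elems_def rule_of_def bu_rule_of_def by (intro comp_intros assms)+

lemma computable_step_trans [comp_intros]:
  assumes "computable a" "computable L" shows "computable (\<lambda>e. step_trans (a e) (L e))"
  unfolding step_trans_def by (intro comp_intros assms)

lemma computable_step_attU [comp_intros]:
  assumes "computable a" "computable L" shows "computable (\<lambda>e. code_attU (step_attU (a e) (L e)))"
  unfolding step_attU_def Let_def code_attU.simps code_burel_def code_att_def
    subset_burel_def choice_tdrel_def det_att_def att.simps burel.simps code_set_list
    set_empty[symmetric]
  by (intro comp_intros assms computable_prod_encode_pair)

lemma computable_construct: "computable construct"
  unfolding construct_def build_def all_trans_def
  by (intro comp_intros)

theorem theorem3:
  shows "\<exists>construct. partial_recursive construct \<and>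
    (\<forall>As :: attU list.
       length As \<ge> 1 \<and> (\<forall>A \<in> set As. is_attU A) \<and> composable As \<and>
       single_valued (composition As) \<longrightarrow>
       (\<exists>Ds :: attU list.
          construct (code_attUs As) = Some (code_attUs Ds) \<and>
          length Ds = length As \<and> (\<forall>D \<in> set Ds. is_dattU D) \<and> composable Ds \<and>
          inalphU (hd Ds) = inalphU (hd As) \<and> outalphU (last Ds) = outalphU (last As) \<and>
          composition Ds = composition As))"
proof (intro exI[of _ "\<lambda>n. Some (construct n)"] conjI allI impI, goal_cases)
  case 1
  show ?case using computable_construct by (simp add: computable_nat_iff total_rec_def)
next
  case (2 As)
  then show ?case using construct_correct[of As] by simp
qed

end
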